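(* Suppose that $X$ is recurrent. Let $$I(\lambda)=\int_0^\infty e^{\lambda t}g(t)\,dt=\mathbb E\big[e^{\lambda W}1_{(H^1<1)}\big].$$ If there exists a $\phi$ such that $I(\phi)=1$ and $I'(\phi-)<\infty$, then for each $i\in\hat S$, $$e^{\phi t}s_i(t)\to p_i>0\quad\text{as } t\to\infty,$$ where the function $p$ is given by $$p_{(0,0)}=\frac{e^{\phi-q_0}}{\phi I'(\phi-)}=:\kappa,\qquad p_{(0,u)}=\frac{\int_0^{1-u}e^{(\phi-q_0)s}ds}{\int_0^1e^{(\phi-q_0)s}ds}\,\kappa\quad(u\in[0,1)),$$ and, for $i\in C$, $$p_i=F_{i,0}(\phi)\,\kappa,\qquad\text{where } F_{i,0}(\lambda)=\mathbb E\, e^{\lambda\tau^{(i)}_0}=\int_0^\infty e^{\lambda t}\rho_i(t)\,dt.$$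
   Context: $X=(X_t)_{t\ge 0}$ is an irreducible, non-explosive continuous-time Markov chain on $S=\mathbb Z^+=\{0,1,2,\dots\}$ or $S=\{0,\dots,K\}$, with distinguished state $0$; $C=S\setminus\{0\}$. Its $Q$-matrix is $(q_{i,j})$ and $q_i=-q_{i,i}$. The current holding time $H_t$ is the time elapsed since the most recent entry of $X$ into $0$ if $X_t=0$, and $H_t=\emptyset$ if $X_t\ne0$. Let $\tau=\inf\{t: H_t\ge1\}$. Let $\hat S=C\cup(\{0\}\times[0,1))$; $\hat X$ denotes the process $(X_t,H_t)$ killed at $\tau$, viewed as a process on $\hat S$: it is in state $i\in C$ when $X_t=i$ and in state $(0,u)$ when $X_t=0$, $H_t=u$. The state $0$ is identified with $(0,0)$. $\mathbb P_i$ is the law started from $i\in\hat S$ (starting from $(0,u)$ means that $X_0=0$ and the chain has already been at $0$ for time $u$). For $i\in\hat S$, $s_i(t)=\mathbb P_i(\tau>t)$. $H^1$ denotes a full holding time of $X$ in $0$ (from an entry to $0$ until the next departure), and $R^1$ the subsequent return time (from that departure until the next return to $0$); $W=H^1+R^1$ is the first return time of $X$ to $0$ from $0$. $g$ is the (defective) density of $W1_{(H^1<1)}$ on $(0,\infty)$, i.e. $\int_B g(t)\,dt=\mathbb P(W\in B,\,H^1<1)$ for Borel $B\subseteq(0,\infty)$. $\tau_0^{(i)}$ is a random variable distributed as the hitting time of $0$ by $X$ started from $i\in C$, and $\rho_i$ is its density. $I'(\phi-)$ is the left derivative of $I$ at $\phi$. *)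

theory Defs
  imports "HOL-Probability.Probability"
begin

section \<open>Continuous-time Markov chains\<close>

text \<open>
  A chain is given by a state space \<open>S\<close>, a \<open>Q\<close>-matrix \<open>q\<close>, the laws \<open>P i\<close> of the chain started
  from \<open>i\<close>, and the coordinate process \<open>X t\<close> (only times \<open>t \<ge> 0\<close> matter).
\<close>

definition state_space :: "nat set \<Rightarrow> bool" where
  "state_space S \<longleftrightarrow> S = UNIV \<or> (\<exists>K. S = {..K})"

text \<open>
  The left limit is required to be a state: a path whose jump times accumulate at a finite
  time has none there. Hence this is the path regularity of a non-explosive chain.
\<close>

definition step_path :: "(real \<Rightarrow> nat) \<Rightarrow> bool" where
  "step_path x \<longleftrightarrow>
     (\<forall>t\<ge>0. eventually (\<lambda>s. x s = x t) (at_right t)) \<and>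
     (\<forall>t>0. \<exists>j. eventually (\<lambda>s. x s = j) (at_left t))"

definition trans_prob :: "(nat \<Rightarrow> 'w measure) \<Rightarrow> (real \<Rightarrow> 'w \<Rightarrow> nat) \<Rightarrow> real \<Rightarrow> nat \<Rightarrow> nat \<Rightarrow> real" where
  "trans_prob P X t i j = measure (P i) {\<omega> \<in> space (P i). X t \<omega> = j}"

definition markov_property :: "nat set \<Rightarrow> (nat \<Rightarrow> 'w measure) \<Rightarrow> (real \<Rightarrow> 'w \<Rightarrow> nat) \<Rightarrow> bool" where
  "markov_property S P X \<longleftrightarrow>
     (\<forall>i\<in>S. \<forall>(n::nat) (t :: nat \<Rightarrow> real) (j :: nat \<Rightarrow> nat). \<forall>h\<ge>0. \<forall>l\<in>S.
        0 \<le> t 0 \<and> (\<forall>k<n. t k \<le> t (Suc k)) \<and> (\<forall>k\<le>n. j k \<in> S) \<longrightarrow>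
        measure (P i) {\<omega> \<in> space (P i). (\<forall>k\<le>n. X (t k) \<omega> = j k) \<and> X (t n + h) \<omega> = l} =
        measure (P i) {\<omega> \<in> space (P i). \<forall>k\<le>n. X (t k) \<omega> = j k} * trans_prob P X h (j n) l)"

definition nonexplosive_chain ::
  "nat set \<Rightarrow> (nat \<Rightarrow> nat \<Rightarrow> real) \<Rightarrow> (nat \<Rightarrow> 'w measure) \<Rightarrow> (real \<Rightarrow> 'w \<Rightarrow> nat) \<Rightarrow> bool" where
  "nonexplosive_chain S q P X \<longleftrightarrow>
     (\<forall>i\<in>S. prob_space (P i)) \<and>
     (\<forall>i\<in>S. \<forall>t\<ge>0. X t \<in> measurable (P i) (count_space UNIV)) \<and>
     (\<forall>i\<in>S. \<forall>\<omega>\<in>space (P i). (\<forall>t\<ge>0. X t \<omega> \<in> S) \<and> step_path (\<lambda>t. X t \<omega>)) \<and>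
     (\<forall>i\<in>S. AE \<omega> in P i. X 0 \<omega> = i) \<and>
     markov_property S P X \<and>
     (\<forall>i\<in>S. \<forall>j\<in>S. ((\<lambda>t. trans_prob P X t i j) has_real_derivative q i j) (at_right 0))"

definition irreducible_chain :: "nat set \<Rightarrow> (nat \<Rightarrow> 'w measure) \<Rightarrow> (real \<Rightarrow> 'w \<Rightarrow> nat) \<Rightarrow> bool" where
  "irreducible_chain S P X \<longleftrightarrow> (\<forall>i\<in>S. \<forall>j\<in>S. \<exists>t\<ge>0. trans_prob P X t i j > 0)"

definition recurrent_chain :: "nat set \<Rightarrow> (nat \<Rightarrow> 'w measure) \<Rightarrow> (real \<Rightarrow> 'w \<Rightarrow> nat) \<Rightarrow> bool" where
  "recurrent_chain S P X \<longleftrightarrow> (\<forall>i\<in>S. AE \<omega> in P i. \<forall>t\<ge>0. \<exists>s\<ge>t. X s \<omega> = i)"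


section \<open>Path functionals\<close>

text \<open>
  Random times take the value \<open>\<infinity>\<close> when the event they wait for never happens.
  \<open>hold_time\<close> and \<open>return_time\<close> are meant for paths started in 0; there they are \<open>H\<^sup>1\<close> and
  \<open>W = H\<^sup>1 + R\<^sup>1\<close>.
\<close>

definition hit_time :: "(real \<Rightarrow> nat) \<Rightarrow> ereal" where
  "hit_time x = Inf {ereal t | t. 0 \<le> t \<and> x t = 0}"

definition hold_time :: "(real \<Rightarrow> nat) \<Rightarrow> ereal" where
  "hold_time x = Inf {ereal t | t. 0 \<le> t \<and> x t \<noteq> 0}"

definition return_time :: "(real \<Rightarrow> nat) \<Rightarrow> ereal" where
  "return_time x = Inf {ereal t | t. hold_time x \<le> ereal t \<and> x t = 0}"

text \<open>
  The current holding time at \<open>t\<close>; \<open>u\<close> is the time already spent at 0 before time 0, which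
  counts only as long as the path has not left 0. The infimum is the most recent entry into 0.
\<close>

definition current_hold :: "real \<Rightarrow> (real \<Rightarrow> nat) \<Rightarrow> real \<Rightarrow> real option" where
  "current_hold u x t =
     (if x t \<noteq> 0 then None
      else if \<forall>r\<in>{0..t}. x r = 0 then Some (u + t)
      else Some (t - Inf {s. 0 \<le> s \<and> s \<le> t \<and> (\<forall>r\<in>{s..t}. x r = 0)}))"

definition kill_time :: "real \<Rightarrow> (real \<Rightarrow> nat) \<Rightarrow> ereal" where
  "kill_time u x = Inf {ereal t | t. 0 \<le> t \<and> (\<exists>h. current_hold u x t = Some h \<and> 1 \<le> h)}"


section \<open>The killed process and its survival function\<close>

text \<open>\<open>AtZero u\<close> is the state \<open>(0,u)\<close>; the state 0 is \<open>AtZero 0\<close>.\<close>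

datatype hstate = Away nat | AtZero real

definition S_hat :: "nat set \<Rightarrow> hstate set" where
  "S_hat S = Away ` (S - {0}) \<union> AtZero ` {0..<1}"

text \<open>
  Starting from \<open>(0,u)\<close>, the process \<open>X\<close> has law \<open>P 0\<close> and the holding clock starts at \<open>u\<close>.
\<close>

primrec survival :: "(nat \<Rightarrow> 'w measure) \<Rightarrow> (real \<Rightarrow> 'w \<Rightarrow> nat) \<Rightarrow> hstate \<Rightarrow> real \<Rightarrow> real" where
  "survival P X (Away i) t =
     measure (P i) {\<omega> \<in> space (P i). ereal t < kill_time 0 (\<lambda>r. X r \<omega>)}"
| "survival P X (AtZero u) t =
     measure (P 0) {\<omega> \<in> space (P 0). ereal t < kill_time u (\<lambda>r. X r \<omega>)}"


section \<open>Densities and exponential moments\<close>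

text \<open>\<open>f\<close> is the (possibly defective) density on \<open>(0,\<infinity>)\<close> of \<open>T\<close> restricted to the event \<open>A\<close>.\<close>

definition density_on_event ::
  "'w measure \<Rightarrow> ('w \<Rightarrow> ereal) \<Rightarrow> ('w \<Rightarrow> bool) \<Rightarrow> (real \<Rightarrow> real) \<Rightarrow> bool" where
  "density_on_event M T A f \<longleftrightarrow>
     f \<in> borel_measurable borel \<and> (\<forall>t>0. 0 \<le> f t) \<and>
     (\<forall>B\<in>sets borel. B \<subseteq> {0<..} \<longrightarrow>
        (\<integral>\<^sup>+t\<in>B. ennreal (f t) \<partial>lborel) =
        emeasure M {\<omega> \<in> space M. T \<omega> \<in> ereal ` B \<and> A \<omega>})"

definition exp_moment :: "(real \<Rightarrow> real) \<Rightarrow> real \<Rightarrow> ennreal" where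
  "exp_moment f c = (\<integral>\<^sup>+t\<in>{0<..}. ennreal (exp (c * t) * f t) \<partial>lborel)"

end

theory Submission
  imports Defs
begin

text \<open>
  Put \<open>Z(t) = e\<^sup>\<phi>\<^sup>t s\<^sub>0(t)\<close>, with \<open>s\<^sub>0 = 1\<close> on the negative half-line. The strong Markov property at the
  first return \<open>W\<close> to 0 gives, on the whole real line, the renewal equation \<open>Z = z + \<mu> * Z\<close>, where
  \<open>z(t) = e\<^sup>\<phi>\<^sup>t e\<^sup>-\<^sup>q\<^sup>0\<close> for \<open>t < 1\<close> and \<open>z = 0\<close> afterwards, and \<open>\<mu>\<close> is the law of \<open>W\<close> on \<open>H\<^sup>1 < 1\<close> tilted by
  \<open>e\<^sup>\<phi>\<^sup>W\<close>: a probability law without atoms and with mean \<open>I'(\<phi>-)\<close>. Fubini turns it into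
  \<open>\<integral>\<^sub>0\<^sup>\<infinity> Z(t - v) \<mu>(v,\<infinity>) dv = e\<^sup>\<phi>\<^sup>-\<^sup>q\<^sup>0/\<phi>\<close> for \<open>t \<ge> 1\<close>. As in Feller's proof of the renewal theorem, limits
  of translates of \<open>Z\<close> along sequences realising its upper or lower limit are continuous solutions
  of \<open>\<xi> = \<mu> * \<xi>\<close> that attain an extremum; they therefore tend to it at \<open>-\<infinity>\<close>, and the identity
  determines its value as \<open>\<kappa>\<close>. Compactness comes from Helly's theorem, since \<open>s\<^sub>0\<close> is monotone.

  The other initial states reduce to 0 by conditioning on the first entry into 0. The ratio in
  \<open>p\<^sub>(\<^sub>0\<^sub>,\<^sub>u\<^sub>)\<close> comes from the cocycle identity satisfied by \<open>c \<mapsto> E(e\<^sup>\<phi>\<^sup>W; H\<^sup>1 \<le> c)\<close>, a consequence of the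
  Markov property at fixed times, which also shows that \<open>F\<^sub>i\<^sub>,\<^sub>0(\<phi>)\<close> is finite.
\<close>

section \<open>Renewal theorem for atomless laws\<close>

text \<open>Besides giving \<open>I\<close> and \<open>F\<close>, the densities serve to exclude
  atoms. Countable sets are then null, which does three jobs: the support of \<mu> is uncountable
  and so has points arbitrarily close together, which rules out a lattice; a limit known only at the
  continuity points of a monotone function becomes a limit everywhere, and a continuous one, after
  convolution with \<mu>; and the return time almost surely misses the jumps of
  \<open>s\<^sub>0\<close>, which the passage from fixed to random times requires.

  The obstacle is that translates of \<open>Z\<close> are not known to be equicontinuous. The
  substitute is that \<open>exp (- \<phi> x) Z(x)\<close> is nonincreasing, so \<open>Z\<close>
  grows at most by the factor \<open>exp (\<phi> e)\<close> over a distance \<open>e\<close>.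

  \<open>I\<close> may be infinite to the right of \<phi>, hence the mean of \<mu> is recovered from
  left difference quotients alone. Positivity of \<phi> is forced by \<open>I(\<phi>) = 1\<close>,
  since \<open>H\<^sup>1 < 1\<close> has probability \<open>1 - exp (- q\<^sub>0) < 1\<close>; it
  makes \<open>Z\<close> integrable at minus infinity. The value 1 of \<open>s\<^sub>0\<close> at
  negative times reflects that a path with \<open>H\<^sup>1 < 1\<close> which has not returned by
  time t is still alive.\<close>

lemma extremal_sequence:
  fixes h :: "real \<Rightarrow> real"
  assumes "\<And>x. \<bar>h x\<bar> \<le> B"
  obtains M t where "filterlim t at_top sequentially" "(\<lambda>n. h (t n)) \<longlonglongrightarrow> M"
    "\<And>e. e > 0 \<Longrightarrow> eventually (\<lambda>x. h x \<le> M + e) at_top"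
proof -
  \<comment> \<open>The suprema over half-lines decrease to the upper limit \<open>M\<close>.
    Choosing \<open>t n\<close> with a value within \<open>1 / (n + 1)\<close> of the supremum over
    \<open>{n..}\<close> forces \<open>h (t n)\<close> to the same limit.\<close>
  define m where "m n = (SUP x\<in>{real n..}. h x)" for n
  have bdd: "bdd_above (h ` {a..})" for a
    by (intro bdd_aboveI[of _ B]) (use assms abs_le_D1 in auto)
  have le_m: "h x \<le> m n" if "real n \<le> x" for n x
    unfolding m_def using bdd that by (intro cSUP_upper) auto
  have m_lb: "- B \<le> m n" for n
    using le_m[of n "real n"] assms[of "real n"] by (simp add: abs_le_iff)
  have "decseq m"
    unfolding decseq_def
  proof (intro allI impI)
    fix i j :: nat assume "i \<le> j"
    then have "real i \<le> real j" by simp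
    then show "m j \<le> m i"
      unfolding m_def[of j] by (intro cSUP_least) (auto intro!: le_m)
  qed
  then obtain M where M: "m \<longlonglongrightarrow> M" "\<And>n. M \<le> m n"
    using decseq_convergent[of m "-B"] m_lb by auto
  have "\<exists>x\<ge>real n. m n - 1 / real (Suc n) < h x" for n
  proof (rule ccontr)
    assume "\<not> ?thesis"
    then have "m n \<le> m n - 1 / real (Suc n)"
      unfolding m_def[of n] by (intro cSUP_least) (auto simp: not_less m_def)
    then show False by simp
  qed
  then obtain t where t: "\<And>n. real n \<le> t n" "\<And>n. m n - 1 / real (Suc n) < h (t n)"
    by metis
  show ?thesis
  proof
    show "filterlim t at_top sequentially"
      by (rule filterlim_at_top_mono[OF filterlim_real_sequentially]) (use t(1) in auto)
    have "(\<lambda>n. m n - 1 / real (Suc n)) \<longlonglongrightarrow> M - 0"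
      using LIMSEQ_inverse_real_of_nat by (intro tendsto_diff M) (simp add: inverse_eq_divide)
    then have lim: "(\<lambda>n. m n - 1 / real (Suc n)) \<longlonglongrightarrow> M" by simp
    show "(\<lambda>n. h (t n)) \<longlonglongrightarrow> M"
    proof (rule tendsto_sandwich[OF _ _ lim M(1)])
      show "\<forall>\<^sub>F n in sequentially. m n - 1 / real (Suc n) \<le> h (t n)"
        using t(2) less_imp_le by (intro always_eventually allI) blast
      show "\<forall>\<^sub>F n in sequentially. h (t n) \<le> m n"
        using t(1) le_m by (intro always_eventually allI) blast
    qed
    fix e :: real assume "e > 0"
    then obtain n where "m n < M + e"
      using order_tendstoD(2)[OF M(1), of "M + e"] by (auto simp: eventually_sequentially)
    then have "h x \<le> M + e" if "x \<ge> real n" for x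
      using le_m[OF that] by linarith
    then show "eventually (\<lambda>x. h x \<le> M + e) at_top"
      by (auto simp: eventually_at_top_linorder)
  qed
qed

text \<open>
  The points \<open>(k - j) u + j v\<close>, \<open>0 \<le> j \<le> k\<close>, subdivide \<open>[k u, k v]\<close> into steps of length \<open>v - u\<close>,
  and these intervals overlap as soon as \<open>k (v - u) \<ge> v\<close>.
\<close>

lemma semigroup_eventually_dense:
  fixes u v y :: real
  assumes "0 \<le> u" "u < v" "v * v / (v - u) \<le> y"
  obtains j k :: nat where "j \<le> k" "real (k - j) * u + real j * v \<le> y"
    "y < real (k - j) * u + real j * v + (v - u)"
proof -
  define d where "d = v - u"
  have d: "d > 0" "v > 0" using assms by (auto simp: d_def)
  \<comment> \<open>The least \<open>k\<close> with \<open>y \<le> k v\<close>. The bound on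
    \<open>y\<close> makes \<open>k (v - u) \<ge> v\<close>, so
    \<open>k u \<le> k v - v < y\<close>, and \<open>y\<close> lies between \<open>k u\<close> and
    \<open>k v\<close>; rounding down then finds its step.\<close>
  define k where "k = nat \<lceil>y / v\<rceil>"
  have y0: "0 < y"
    using assms(3) d by (simp add: d_def[symmetric]) (smt (verit) divide_pos_pos mult_pos_pos)
  have k: "real k * v \<ge> y" "real k * v < y + v"
  proof -
    have "real k = of_int \<lceil>y / v\<rceil>" unfolding k_def using y0 d by (simp add: ceiling_le_iff)
    then have "y / v \<le> real k" "real k < y / v + 1" by linarith+
    then show "real k * v \<ge> y" "real k * v < y + v" using d by (auto simp: field_simps)
  qed
  have "v \<le> real k * d"
  proof -
    have "v * v \<le> y * d" using assms(3) d by (simp add: d_def[symmetric] field_simps)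
    also have "\<dots> \<le> real k * v * d" using k d by (intro mult_right_mono) auto
    finally show ?thesis using d by (simp add: algebra_simps)
  qed
  then have ku: "real k * u \<le> y"
    using k(2) by (simp add: d_def algebra_simps)
  define j where "j = nat \<lfloor>(y - real k * u) / d\<rfloor>"
  have j: "real j = of_int \<lfloor>(y - real k * u) / d\<rfloor>"
    unfolding j_def using ku d by simp
  then have "real j \<le> (y - real k * u) / d" "(y - real k * u) / d < real j + 1" by linarith+
  then have j1: "real j * d \<le> y - real k * u" "y - real k * u < real j * d + d"
    using d by (auto simp: field_simps)
  have "real j * d \<le> real k * d"
    using j1(1) k(1) by (simp add: d_def algebra_simps)
  then have jk: "j \<le> k" using d by simp
  have "real (k - j) * u + real j * v = real k * u + real j * d"
    using jk by (simp add: of_nat_diff d_def algebra_simps)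
  then show ?thesis
    using j1 jk by (intro that[of j k]) (auto simp: d_def[symmetric])
qed

section \<open>Support of an atomless law on the positive half-line, and its bounded harmonic
  functions\<close>

locale renewal_law = prob_space \<mu> for \<mu> :: "real measure" +
  assumes sets_law [measurable_cong, simp]: "sets \<mu> = sets borel"
    and atomless: "\<And>x. emeasure \<mu> {x} = 0"
    and law_pos: "AE v in \<mu>. 0 < v"
begin

lemma space_law [simp]: "space \<mu> = UNIV"
  using sets_eq_imp_space_eq[OF sets_law] by simp

lemma AE_not_countable:
  assumes "countable N"
  shows "AE v in \<mu>. v \<notin> N"
proof -
  have "(\<Union>x\<in>N. {x}) \<in> null_sets \<mu>"
    using assms atomless by (intro null_sets_UN') (auto simp: null_sets_def)
  then show ?thesis
    by (intro AE_I'[of N]) auto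
qed

text \<open>The closed support of \<mu>. Negated almost-everywhere statements take the place of
  positive measure, because vanishing integrals deliver facts of exactly that form.\<close>

definition supp :: "real set" where
  "supp = {u. \<forall>d>0. \<not> (AE v in \<mu>. v \<notin> {u - d<..<u + d})}"

text \<open>The complement of the support is covered by the countably many null intervals with
  rational endpoints.\<close>

lemma AE_supp: "AE v in \<mu>. v \<in> supp"
proof -
  define R where "R = {(a, b). a \<in> \<rat> \<and> b \<in> \<rat> \<and> (AE v in \<mu>. v \<notin> {a<..<b})}"
  have "countable R"
    by (rule countable_subset[of _ "\<rat> \<times> \<rat>"]) (auto simp: R_def countable_rat)
  moreover have "AE v in \<mu>. v \<notin> {fst p<..<snd p}" if "p \<in> R" for p
    using that by (auto simp: R_def)
  ultimately have "AE v in \<mu>. \<forall>p\<in>R. v \<notin> {fst p<..<snd p}"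
    by (simp add: AE_ball_countable)
  then show ?thesis
  proof (rule AE_mp, intro AE_I2 impI)
    fix v assume *: "\<forall>p\<in>R. v \<notin> {fst p<..<snd p}"
    show "v \<in> supp"
    proof (rule ccontr)
      assume "v \<notin> supp"
      then obtain d where d: "d > 0" "AE w in \<mu>. w \<notin> {v - d<..<v + d}"
        by (auto simp: supp_def)
      obtain a b where ab: "a \<in> \<rat>" "b \<in> \<rat>" "v - d < a" "a < v" "v < b" "b < v + d"
        using Rats_dense_in_real[of "v - d" v] Rats_dense_in_real[of v "v + d"] d(1) by auto
      have "AE w in \<mu>. w \<notin> {a<..<b}"
        using d(2) by (rule AE_mp) (use ab in auto)
      then have "(a, b) \<in> R" using ab by (simp add: R_def)
      then show False using * ab by force
    qed
  qed
qed

lemma supp_nonneg: "u \<in> supp \<Longrightarrow> 0 \<le> u"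
proof (rule ccontr)
  assume "u \<in> supp" "\<not> 0 \<le> u"
  then have "-u > 0" and *: "\<forall>d>0. \<not> (AE v in \<mu>. v \<notin> {u - d<..<u + d})"
    unfolding supp_def by simp_all
  from *[rule_format, OF \<open>-u > 0\<close>]
  have "\<not> (AE v in \<mu>. v \<notin> {u - (-u)<..<u + (- u)})" .
  moreover have "AE v in \<mu>. v \<notin> {u - (-u)<..<u + (- u)}"
    using law_pos by (rule AE_mp) auto
  ultimately show False by simp
qed

text \<open>Without atoms no countable set carries \<mu>, so the support is uncountable and two of
  its points share a cell of the grid of mesh \<open>e\<close>. This plays the part of the
  non-lattice condition.\<close>

lemma supp_close:
  assumes "0 < e"
  obtains u v where "u \<in> supp" "v \<in> supp" "u < v" "v - u < e"
proof -
  have "\<not> countable supp"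
  proof
    assume "countable supp"
    from AE_not_countable[OF this] AE_supp have "AE v in \<mu>. False" by eventually_elim auto
    then show False by simp
  qed
  then have "\<not> inj_on (\<lambda>v. \<lfloor>v / e\<rfloor>) supp"
    using countable_image_inj_on[OF countableI_type, of _ supp] by (rule contrapos_nn)
  then obtain a b where ab: "a \<in> supp" "b \<in> supp" "a \<noteq> b" "\<lfloor>a / e\<rfloor> = \<lfloor>b / e\<rfloor>"
    unfolding inj_on_def by blast
  define u v where "u = min a b" and "v = max a b"
  have uv: "u \<in> supp" "v \<in> supp" "u < v" "\<lfloor>v / e\<rfloor> = \<lfloor>u / e\<rfloor>"
    using ab by (auto simp: u_def v_def min_def max_def)
  then have "v / e - u / e < 1"
    by linarith
  then have "v - u < e" using assms by (simp add: field_simps)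
  with uv show ?thesis using that by blast
qed

text \<open>Maximum principle. If \<xi> attains its extremum \<open>c\<close> at \<open>x\<close>,
  then \<open>\<xi> (x - v) - c\<close> has one sign and average zero, so it vanishes for almost
  every \<open>v\<close>. A different value at \<open>x - u\<close> would persist nearby by
  continuity and make a neighbourhood of \<open>u\<close> null.\<close>

lemma harmonic_const_on_semigroup:
  fixes \<xi> :: "real \<Rightarrow> real"
  assumes cont: "\<And>x. isCont \<xi> x" and bnd: "\<And>x. \<bar>\<xi> x\<bar> \<le> B"
    and harm: "\<And>x. \<xi> x = (\<integral>v. \<xi> (x - v) \<partial>\<mu>)"
    and ext: "(\<forall>x. \<xi> x \<le> c) \<or> (\<forall>x. c \<le> \<xi> x)"
    and u: "u \<in> supp" and x: "\<xi> x = c"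
  shows "\<xi> (x - u) = c"
proof (rule ccontr)
  assume neq: "\<xi> (x - u) \<noteq> c"
  have [measurable]: "\<xi> \<in> borel_measurable borel"
    using cont by (intro borel_measurable_continuous_onI continuous_at_imp_continuous_on) auto
  have int: "integrable \<mu> (\<lambda>v. \<xi> (x - v))"
    by (intro integrable_const_bound[of _ B]) (use bnd in auto)
  have "(\<integral>v. \<xi> (x - v) - c \<partial>\<mu>) = (\<integral>v. \<xi> (x - v) \<partial>\<mu>) - c"
    using prob_space by (subst Bochner_Integration.integral_diff[OF int]) simp_all
  then have zero: "(\<integral>v. \<xi> (x - v) - c \<partial>\<mu>) = 0"
    unfolding harm[of x, symmetric] x by (rule trans) simp
  have AE0: "AE v in \<mu>. \<xi> (x - v) - c = 0"
    using ext
  proof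
    assume "\<forall>x. \<xi> x \<le> c"
    have "(\<integral>v. c - \<xi> (x - v) \<partial>\<mu>) = c - (\<integral>v. \<xi> (x - v) \<partial>\<mu>)"
      using prob_space by (subst Bochner_Integration.integral_diff[OF _ int]) simp_all
    then have "(\<integral>v. c - \<xi> (x - v) \<partial>\<mu>) = 0"
      unfolding harm[of x, symmetric] x by (rule trans) simp
    then have "AE v in \<mu>. c - \<xi> (x - v) = 0"
      using \<open>\<forall>x. \<xi> x \<le> c\<close> int by (subst (asm) integral_nonneg_eq_0_iff_AE) auto
    then show ?thesis by (rule AE_mp) auto
  next
    assume "\<forall>x. c \<le> \<xi> x"
    then show ?thesis
      using zero int by (subst (asm) integral_nonneg_eq_0_iff_AE) auto
  qed
  have "eventually (\<lambda>y. \<xi> y \<noteq> c) (at (x - u))"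
    using cont[of "x - u"] neq by (intro tendsto_imp_eventually_ne) (auto simp: isCont_def)
  then obtain d where d0: "d > 0" "\<And>y. y \<noteq> x - u \<Longrightarrow> dist y (x - u) < d \<Longrightarrow> \<xi> y \<noteq> c"
    unfolding eventually_at by blast
  have d: "d > 0" "\<And>y. dist y (x - u) < d \<Longrightarrow> \<xi> y \<noteq> c"
    using d0(1) apply blast
    subgoal for y using d0(2)[of y] neq by (cases "y = x - u") simp_all
    done
  have "AE v in \<mu>. v \<notin> {u - d<..<u + d}"
    using AE0
  proof (rule AE_mp, intro AE_I2 impI notI)
    fix v assume "\<xi> (x - v) - c = 0" "v \<in> {u - d<..<u + d}"
    then have "dist (x - v) (x - u) < d" "\<xi> (x - v) = c"
      by (auto simp: dist_real_def abs_less_iff)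
    then show False using d(2)[of "x - v"] by blast
  qed
  then show False using u d(1) by (auto simp: supp_def)
qed

lemma harmonic_const_on_multiples:
  fixes \<xi> :: "real \<Rightarrow> real"
  assumes cont: "\<And>x. isCont \<xi> x" and bnd: "\<And>x. \<bar>\<xi> x\<bar> \<le> B"
    and harm: "\<And>x. \<xi> x = (\<integral>v. \<xi> (x - v) \<partial>\<mu>)"
    and ext: "(\<forall>x. \<xi> x \<le> c) \<or> (\<forall>x. c \<le> \<xi> x)"
    and u: "u \<in> supp" and x: "\<xi> x = c"
  shows "\<xi> (x - real n * u) = c"
proof (induction n)
  case (Suc n)
  from harmonic_const_on_semigroup[OF cont bnd harm ext u Suc] show ?case
    by (simp add: algebra_simps)
qed (use x in simp)

text \<open>Going left from 0 by nonnegative combinations of two support points at distance less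
  than \<open>e\<close> keeps the value \<open>c\<close>, and far out these points leave no gap of
  length \<open>e\<close>. The hypothesis \<open>slow\<close> carries the value to all points
  between them at the cost of a factor \<open>exp (\<phi> * e)\<close>.\<close>

lemma harmonic_tendsto_extremum:
  fixes \<xi> :: "real \<Rightarrow> real"
  assumes cont: "\<And>x. isCont \<xi> x" and bnd: "\<And>x. \<bar>\<xi> x\<bar> \<le> B" and nonneg: "\<And>x. 0 \<le> \<xi> x"
    and harm: "\<And>x. \<xi> x = (\<integral>v. \<xi> (x - v) \<partial>\<mu>)"
    and ext: "(\<forall>x. \<xi> x \<le> c) \<or> (\<forall>x. c \<le> \<xi> x)"
    and x: "\<xi> 0 = c"
    and slow: "\<And>x y. x \<le> y \<Longrightarrow> exp (- \<phi> * y) * \<xi> y \<le> exp (- \<phi> * x) * \<xi> x"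
    and "0 < \<phi>"
  shows "((\<lambda>y. \<xi> (- y)) \<longlongrightarrow> c) at_top"
proof -
  have c0: "0 \<le> c" using x nonneg[of 0] by simp
  have near: "eventually (\<lambda>y. exp (- \<phi> * e) * c \<le> \<xi> (- y) \<and> \<xi> (- y) \<le> exp (\<phi> * e) * c) at_top"
    if "e > 0" for e
  proof -
    obtain u v where uv: "u \<in> supp" "v \<in> supp" "u < v" "v - u < e"
      using supp_close[OF \<open>e > 0\<close>] .
    have u0: "0 \<le> u" using uv supp_nonneg by auto
    have pt: "\<exists>p. \<xi> (- p) = c \<and> p \<le> y \<and> y < p + e" if y: "v * v / (v - u) \<le> y" for y
    proof -
      obtain j k :: nat where jk: "real (k - j) * u + real j * v \<le> y"
        "y < real (k - j) * u + real j * v + (v - u)"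
        using semigroup_eventually_dense[OF u0 uv(3) y] .
      have "\<xi> (0 - real (k - j) * u) = c"
        by (rule harmonic_const_on_multiples[OF cont bnd harm ext uv(1) x])
      from harmonic_const_on_multiples[OF cont bnd harm ext uv(2) this, of j]
      have "\<xi> (- (real (k - j) * u + real j * v)) = c"
        by simp
      then show ?thesis using jk uv by (intro exI[of _ "real (k - j) * u + real j * v"]) auto
    qed
    show ?thesis
    proof (rule eventually_mono[OF eventually_ge_at_top[of "v * v / (v - u)"]], intro conjI)
      fix y assume y: "v * v / (v - u) \<le> y"
      obtain p where p: "\<xi> (- p) = c" "p \<le> y" "y < p + e" using pt[OF y] by blast
      have "exp (\<phi> * p) * c \<le> exp (\<phi> * y) * \<xi> (- y)" using slow[of "-y" "-p"] p by simp
      then have "exp (\<phi> * (p - y)) * c \<le> \<xi> (- y)"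
        by (simp add: right_diff_distrib exp_diff field_simps)
      moreover have "exp (- \<phi> * e) * c \<le> exp (\<phi> * (p - y)) * c"
      proof (intro mult_right_mono c0, unfold exp_le_cancel_iff)
        have "\<phi> * (- e) \<le> \<phi> * (p - y)"
          using p \<open>0 < \<phi>\<close> by (intro mult_left_mono) auto
        then show "- \<phi> * e \<le> \<phi> * (p - y)" by simp
      qed
      ultimately show "exp (- \<phi> * e) * c \<le> \<xi> (- y)" by linarith
      \<comment> \<open>Applying \<open>pt\<close> at \<open>y + e\<close> gives a point with
        \<open>y < p' \<le> y + e\<close>, on the other side of \<open>y\<close>;
        \<open>slow\<close> then yields the upper bound.\<close>
      obtain p' where p': "\<xi> (- p') = c" "p' \<le> y + e" "y + e < p' + e"
        using pt[of "y + e"] y \<open>e > 0\<close> by auto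
      have "exp (\<phi> * y) * \<xi> (- y) \<le> exp (\<phi> * p') * c" using slow[of "-p'" "-y"] p' by simp
      then have "\<xi> (- y) \<le> exp (\<phi> * (p' - y)) * c"
        by (simp add: right_diff_distrib exp_diff field_simps)
      moreover have "exp (\<phi> * (p' - y)) * c \<le> exp (\<phi> * e) * c"
        using p' \<open>0 < \<phi>\<close> c0 by (intro mult_right_mono) auto
      ultimately show "\<xi> (- y) \<le> exp (\<phi> * e) * c" by linarith
    qed
  qed
  show ?thesis
  proof (rule tendstoI)
    fix r :: real assume r: "r > 0"
    have "isCont (\<lambda>e. exp (- \<phi> * e) * c) 0" "isCont (\<lambda>e. exp (\<phi> * e) * c) 0"
      by (auto intro!: continuous_intros)
    then have "((\<lambda>e. exp (- \<phi> * e) * c) \<longlongrightarrow> c) (at_right 0)"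
      "((\<lambda>e. exp (\<phi> * e) * c) \<longlongrightarrow> c) (at_right 0)"
      by (auto simp: isCont_def intro: filterlim_at_within_not_equal tendsto_within_subset)
    from order_tendstoD(1)[OF this(1), of "c - r"] order_tendstoD(2)[OF this(2), of "c + r"] r
    have "eventually (\<lambda>e. c - r < exp (- \<phi> * e) * c) (at_right 0)"
      "eventually (\<lambda>e. exp (\<phi> * e) * c < c + r) (at_right 0)"
      by simp_all
    with eventually_at_right_less[of "0::real"]
    have "eventually (\<lambda>e. e > 0 \<and> c - r < exp (- \<phi> * e) * c \<and> exp (\<phi> * e) * c < c + r) (at_right 0)"
      by eventually_elim (intro conjI)
    from eventually_happens[OF this] trivial_limit_at_right_real
    obtain e where e: "e > 0" "c - r < exp (- \<phi> * e) * c" "exp (\<phi> * e) * c < c + r"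
      by blast
    show "eventually (\<lambda>y. dist (\<xi> (- y)) c < r) at_top"
      by (rule eventually_mono[OF near[OF e(1)]]) (use e in \<open>auto simp: dist_real_def\<close>)
  qed
qed

end

section \<open>The renewal equation on the whole line and its integrated form\<close>

lemma nn_integral_exp_at_least:
  fixes a t c :: real
  assumes "a > 0"
  shows "(\<integral>\<^sup>+v. ennreal (exp (a * (t - v))) * indicator {c..} v \<partial>lborel) = ennreal (exp (a * (t - c)) / a)"
proof -
  have "((\<lambda>v. - exp (a * (t - v)) / a) \<longlongrightarrow> - 0 / a) at_top"
  proof (intro tendsto_intros)
    have "filterlim (\<lambda>v. v - t) at_top at_top"
      using filterlim_tendsto_add_at_top[OF tendsto_const[of "-t"] filterlim_ident] by simp
    then have "filterlim (\<lambda>v. a * (v - t)) at_top at_top"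
      by (rule filterlim_tendsto_pos_mult_at_top[OF tendsto_const assms])
    then have "((\<lambda>v. exp (- (a * (v - t)))) \<longlongrightarrow> 0) at_top"
      by (intro filterlim_compose[OF exp_at_bot]) (simp add: filterlim_uminus_at_top)
    then show "((\<lambda>v. exp (a * (t - v))) \<longlongrightarrow> 0) at_top"
      by (simp add: algebra_simps)
  qed (use assms in auto)
  then have "(\<integral>\<^sup>+v. ennreal (exp (a * (t - v))) * indicator {c..} v \<partial>lborel)
      = ennreal (0 - (- exp (a * (t - c)) / a))"
    using assms
    by (intro nn_integral_FTC_atLeast) (auto intro!: derivative_eq_intros simp: field_simps)
  then show ?thesis by simp
qed

lemma borel_measurable_antimono_real:
  fixes f :: "real \<Rightarrow> real"
  assumes "\<And>x y. x \<le> y \<Longrightarrow> f y \<le> f x"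
  shows "f \<in> borel_measurable borel"
proof -
  have "(\<lambda>x. - f x) \<in> borel_measurable borel"
    using assms by (intro borel_measurable_mono) (auto simp: mono_def)
  from borel_measurable_uminus[OF this] show ?thesis by simp
qed

text \<open>Convolution with an atomless law smooths: for fixed \<open>x\<close>, the
  \<open>v\<close> with a discontinuity at \<open>x - v\<close> form a countable, hence null set.
  Dominated convergence makes the right-hand side continuous in \<open>x\<close>, and by hypothesis
  it is \<xi> itself.\<close>

lemma isCont_of_countable_discontinuities:
  fixes \<xi> :: "real \<Rightarrow> real"
  assumes "countable {x. \<not> isCont \<xi> x}" "\<And>x. \<bar>\<xi> x\<bar> \<le> B"
    and [measurable]: "\<xi> \<in> borel_measurable borel"
    and "renewal_law \<mu>" "\<And>x. \<xi> x = (\<integral>v. \<xi> (x - v) \<partial>\<mu>)"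
  shows "isCont \<xi> x"
proof -
  interpret renewal_law \<mu> by fact
  have "(\<lambda>n. \<xi> (X n)) \<longlonglongrightarrow> \<xi> x" if X: "X \<longlonglongrightarrow> x" for X
    unfolding assms(5)[of "X _"] assms(5)[of x]
  proof (rule integral_dominated_convergence[where w = "\<lambda>_. B"])
    have "countable ((\<lambda>y. x - y) ` {x. \<not> isCont \<xi> x})"
      using assms(1) by simp
    from AE_not_countable[OF this]
    show "AE v in \<mu>. (\<lambda>n. \<xi> (X n - v)) \<longlonglongrightarrow> \<xi> (x - v)"
    proof (rule AE_mp, intro AE_I2 impI)
      fix v assume "v \<notin> (\<lambda>y. x - y) ` {x. \<not> isCont \<xi> x}"
      then have "isCont \<xi> (x - v)" by (auto simp: image_iff)
      then show "(\<lambda>n. \<xi> (X n - v)) \<longlonglongrightarrow> \<xi> (x - v)"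
        by (rule isCont_tendsto_compose) (intro tendsto_intros X)
    qed
  qed (use assms(2) in auto)
  then show ?thesis
    by (simp add: continuous_at_sequentially o_def)
qed

text \<open>The equation is stated with nonnegative extended integrals, so that it has a meaning
  before \<open>Z\<close> is known to be bounded. In the application \<open>k\<close> is the
  probability of staying at 0 for a unit of time.\<close>

locale survival_renewal = renewal_law +
  fixes s :: "real \<Rightarrow> real" and \<phi> k D :: real
  assumes \<phi>_pos: "0 < \<phi>" and k_pos: "0 < k"
    and D_nonneg: "0 \<le> D"
    and mean: "(\<integral>\<^sup>+v. ennreal v \<partial>\<mu>) = ennreal D"
    and s_antimono: "\<And>x y. x \<le> y \<Longrightarrow> s y \<le> s x"
    and s_nonneg: "\<And>x. 0 \<le> s x" and s_le_1: "\<And>x. s x \<le> 1"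
    and s_rcont: "\<And>x. continuous (at_right x) s"
    and renewal: "\<And>t. ennreal (exp (\<phi> * t) * s t) =
      ennreal (if t < 1 then k * exp (\<phi> * t) else 0) + (\<integral>\<^sup>+v. ennreal (exp (\<phi> * (t - v)) * s (t - v)) \<partial>\<mu>)"
begin

definition Z :: "real \<Rightarrow> real" where "Z t = exp (\<phi> * t) * s t"

definition tail :: "real \<Rightarrow> real" where "tail v = measure \<mu> {v<..}"

lemma s_measurable [measurable]: "s \<in> borel_measurable borel"
  by (rule borel_measurable_antimono_real) (rule s_antimono)

lemma Z_measurable [measurable]: "Z \<in> borel_measurable borel"
  unfolding Z_def by measurable

lemma Z_nonneg: "0 \<le> Z t"
  by (simp add: Z_def s_nonneg)

lemma Z_slow:
  assumes "x \<le> y"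
  shows "exp (- \<phi> * y) * Z y \<le> exp (- \<phi> * x) * Z x"
  using s_antimono[OF assms] by (simp add: Z_def mult.assoc[symmetric] exp_add[symmetric])

lemma tail_antimono: "x \<le> y \<Longrightarrow> tail y \<le> tail x"
  unfolding tail_def by (intro finite_measure_mono) auto

lemma tail_measurable [measurable]: "tail \<in> borel_measurable borel"
  by (rule borel_measurable_antimono_real) (rule tail_antimono)

lemma emeasure_tail: "emeasure \<mu> {v<..} = ennreal (tail v)"
  by (simp add: tail_def emeasure_eq_measure)

lemma Fubini_lborel:
  assumes [measurable]: "case_prod f \<in> borel_measurable (lborel \<Otimes>\<^sub>M \<mu>)"
  shows "(\<integral>\<^sup>+x. (\<integral>\<^sup>+y. f x y \<partial>\<mu>) \<partial>lborel) = (\<integral>\<^sup>+y. (\<integral>\<^sup>+x. f x y \<partial>lborel) \<partial>\<mu>)"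
proof -
  interpret pair_sigma_finite lborel \<mu> ..
  show ?thesis by (rule Fubini'[symmetric]) fact
qed

lemma nn_integral_tail: "(\<integral>\<^sup>+v. ennreal (tail v) * indicator {0..} v \<partial>lborel) = ennreal D"
proof -
  have "(\<integral>\<^sup>+v. ennreal (tail v) * indicator {0..} v \<partial>lborel)
      = (\<integral>\<^sup>+v. (\<integral>\<^sup>+w. indicator {0..} v * indicator {v<..} w \<partial>\<mu>) \<partial>lborel)"
    by (intro nn_integral_cong) (simp add: nn_integral_cmult emeasure_tail mult.commute)
  also have "\<dots> = (\<integral>\<^sup>+v. (\<integral>\<^sup>+w. (if 0 \<le> v \<and> v < w then 1 else 0) \<partial>\<mu>) \<partial>lborel)"
    by (intro nn_integral_cong) (auto simp: indicator_def)
  also have "\<dots> = (\<integral>\<^sup>+w. (\<integral>\<^sup>+v. (if 0 \<le> v \<and> v < w then 1 else 0) \<partial>lborel) \<partial>\<mu>)"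
    by (rule Fubini_lborel) measurable
  also have "\<dots> = (\<integral>\<^sup>+w. (\<integral>\<^sup>+v. indicator {0..<w} v \<partial>lborel) \<partial>\<mu>)"
    by (intro nn_integral_cong) (auto simp: indicator_def)
  also have "\<dots> = (\<integral>\<^sup>+w. ennreal w \<partial>\<mu>)"
    using law_pos by (intro nn_integral_cong_AE) (auto elim!: AE_mp)
  finally show ?thesis by (simp add: mean)
qed

text \<open>Integrate the renewal equation over all arguments up to \<open>t\<close>. Exchanging the
  integrals in the convolution term leaves \<open>Z\<close> weighted by the mass of
  \<open>{..x}\<close>; subtracting this from the total \<open>U\<close> leaves the complementary
  weight, the tail. The subtraction is legitimate because \<open>U\<close> is finite, by
  \<open>s \<le> 1\<close> and \<open>\<phi> > 0\<close>.\<close>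

lemma renewal_identity:
  "(\<integral>\<^sup>+v. ennreal (Z (t - v) * tail v) * indicator {0..} v \<partial>lborel) =
   (\<integral>\<^sup>+v. ennreal (if t - v < 1 then k * exp (\<phi> * (t - v)) else 0) * indicator {0..} v \<partial>lborel)"
  (is "?J = ?z")
proof -
  define U where "U = (\<integral>\<^sup>+v. ennreal (Z (t - v)) * indicator {0..} v \<partial>lborel)"
  define V where "V = (\<integral>\<^sup>+x. ennreal (Z (t - x) * measure \<mu> {..x}) * indicator {0..} x \<partial>lborel)"
  have [measurable]: "(\<lambda>x. measure \<mu> {..x}) \<in> borel_measurable borel"
    by (intro borel_measurable_mono) (auto simp: mono_def intro!: finite_measure_mono)
  have "U \<le> (\<integral>\<^sup>+v. ennreal (exp (\<phi> * (t - v))) * indicator {0..} v \<partial>lborel)"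
    unfolding U_def using s_le_1
    by (intro nn_integral_mono mult_right_mono ennreal_leI) (auto simp: Z_def mult_left_le)
  also have "\<dots> = ennreal (exp (\<phi> * (t - 0)) / \<phi>)"
    by (rule nn_integral_exp_at_least[OF \<phi>_pos])
  also have "\<dots> < \<infinity>" by simp
  finally have U: "U < \<infinity>" .
  have "U = ?z + (\<integral>\<^sup>+v. (\<integral>\<^sup>+w. ennreal (Z (t - v - w)) * indicator {0..} v \<partial>\<mu>) \<partial>lborel)"
  proof -
    have "U = (\<integral>\<^sup>+v. (ennreal (if t - v < 1 then k * exp (\<phi> * (t - v)) else 0)
        + (\<integral>\<^sup>+w. ennreal (Z (t - v - w)) \<partial>\<mu>)) * indicator {0..} v \<partial>lborel)"
      unfolding U_def Z_def by (subst renewal) simp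
    then show ?thesis
      by (simp add: distrib_right nn_integral_add nn_integral_multc)
  qed
  also have "(\<integral>\<^sup>+v. (\<integral>\<^sup>+w. ennreal (Z (t - v - w)) * indicator {0..} v \<partial>\<mu>) \<partial>lborel)
      = (\<integral>\<^sup>+w. (\<integral>\<^sup>+v. ennreal (Z (t - v - w)) * indicator {0..} v \<partial>lborel) \<partial>\<mu>)"
    by (rule Fubini_lborel) measurable
  also have "\<dots> = (\<integral>\<^sup>+w. (\<integral>\<^sup>+x. ennreal (Z (t - x)) * indicator {w..} x \<partial>lborel) \<partial>\<mu>)"
  proof (rule nn_integral_cong)
    fix w
    show "(\<integral>\<^sup>+v. ennreal (Z (t - v - w)) * indicator {0..} v \<partial>lborel)
        = (\<integral>\<^sup>+x. ennreal (Z (t - x)) * indicator {w..} x \<partial>lborel)"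
      by (subst nn_integral_real_affine[where c = 1 and t = w])
         (auto simp: indicator_def algebra_simps intro!: nn_integral_cong)
  qed
  also have "\<dots> = (\<integral>\<^sup>+w. (\<integral>\<^sup>+x. ennreal (Z (t - x)) * (if w \<le> x then 1 else 0) \<partial>lborel) \<partial>\<mu>)"
    by (intro nn_integral_cong) (auto simp: indicator_def)
  also have "\<dots> = (\<integral>\<^sup>+x. (\<integral>\<^sup>+w. ennreal (Z (t - x)) * (if w \<le> x then 1 else 0) \<partial>\<mu>) \<partial>lborel)"
    by (rule Fubini_lborel[symmetric]) measurable
  also have "\<dots> = V"
    unfolding V_def
  proof (rule nn_integral_cong)
    fix x :: real
    have "(\<integral>\<^sup>+w. ennreal (Z (t - x)) * (if w \<le> x then 1 else 0) \<partial>\<mu>)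
        = (\<integral>\<^sup>+w. ennreal (Z (t - x)) * indicator {..x} w \<partial>\<mu>)"
      by (intro nn_integral_cong) (auto simp: indicator_def)
    also have "\<dots> = ennreal (Z (t - x)) * emeasure \<mu> {..x}"
      by (simp add: nn_integral_cmult)
    also have "\<dots> = ennreal (Z (t - x) * measure \<mu> {..x}) * indicator {0..} x"
    proof (cases "0 \<le> x")
      case False
      have "AE w in \<mu>. w \<notin> {..x}"
        using law_pos by (rule AE_mp) (use False in auto)
      then have "emeasure \<mu> {..x} = 0"
        by (subst AE_iff_measurable[symmetric, of _ _ "\<lambda>w. w \<notin> {..x}"]) auto
      then show ?thesis using False by simp
    qed (simp add: emeasure_eq_measure ennreal_mult' Z_nonneg)
    finally show "(\<integral>\<^sup>+w. ennreal (Z (t - x)) * (if w \<le> x then 1 else 0) \<partial>\<mu>)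
        = ennreal (Z (t - x) * measure \<mu> {..x}) * indicator {0..} x" .
  qed
  finally have 1: "U = ?z + V" .
  have "U = (\<integral>\<^sup>+x. ennreal (Z (t - x) * tail x) * indicator {0..} x
      + ennreal (Z (t - x) * measure \<mu> {..x}) * indicator {0..} x \<partial>lborel)"
    unfolding U_def
  proof (rule nn_integral_cong)
    fix x :: real
    have "measure \<mu> ({x<..} \<union> {..x}) = tail x + measure \<mu> {..x}"
      unfolding tail_def by (intro finite_measure_Union) auto
    moreover have "{x<..} \<union> {..x} = space \<mu>" by auto
    ultimately have "Z (t - x) = Z (t - x) * tail x + Z (t - x) * measure \<mu> {..x}"
      using prob_space by (simp add: distrib_left[symmetric])
    then show "ennreal (Z (t - x)) * indicator {0..} x = ennreal (Z (t - x) * tail x) * indicator {0..} x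
      + ennreal (Z (t - x) * measure \<mu> {..x}) * indicator {0..} x"
      by (subst (1) \<open>Z (t - x) = _\<close>)
         (simp add: Z_nonneg tail_def distrib_right[symmetric] ennreal_plus[symmetric] del: ennreal_plus)
  qed
  also have "\<dots> = ?J + V"
    unfolding V_def by (intro nn_integral_add) auto
  finally have 2: "U = ?J + V" .
  have "V \<noteq> \<infinity>" using 1 U by auto
  moreover have "V + ?J = V + ?z" using 1 2 by (simp add: add.commute)
  ultimately show ?thesis by (simp add: ennreal_add_left_cancel)
qed

text \<open>For \<open>t < 1\<close> the range \<open>v > t - 1\<close> is cut off at
  \<open>v = 0\<close>, which leaves an inequality. Being uniform in \<open>t\<close>, it is what
  bounds \<open>Z\<close>.\<close>

lemma renewal_identity_le:
  "(\<integral>\<^sup>+v. ennreal (Z (t - v) * tail v) * indicator {0..} v \<partial>lborel) \<le> ennreal (k * exp \<phi> / \<phi>)"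
proof -
  have "(\<integral>\<^sup>+v. ennreal (Z (t - v) * tail v) * indicator {0..} v \<partial>lborel)
      \<le> (\<integral>\<^sup>+v. ennreal k * (ennreal (exp (\<phi> * (t - v))) * indicator {t-1..} v) \<partial>lborel)"
    unfolding renewal_identity using k_pos
    by (intro nn_integral_mono) (auto simp: indicator_def ennreal_mult'[symmetric])
  also have "\<dots> = ennreal (k * exp \<phi> / \<phi>)"
    using k_pos by (simp add: nn_integral_cmult nn_integral_exp_at_least[OF \<phi>_pos] ennreal_mult'[symmetric])
  finally show ?thesis .
qed

text \<open>For \<open>t \<ge> 1\<close> the whole range \<open>v > t - 1\<close> lies in
  \<open>v \<ge> 0\<close>, and the constant is the integral of
  \<open>k * exp (\<phi> * (t - v))\<close> over it.\<close>

lemma renewal_identity_eq: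
  assumes "1 \<le> t"
  shows "(\<integral>\<^sup>+v. ennreal (Z (t - v) * tail v) * indicator {0..} v \<partial>lborel) = ennreal (k * exp \<phi> / \<phi>)"
proof -
  have "(\<integral>\<^sup>+v. ennreal (Z (t - v) * tail v) * indicator {0..} v \<partial>lborel)
      = (\<integral>\<^sup>+v. ennreal k * (ennreal (exp (\<phi> * (t - v))) * indicator {t-1..} v) \<partial>lborel)"
    unfolding renewal_identity
  proof (rule nn_integral_cong_AE)
    show "AE v in lborel. ennreal (if t - v < 1 then k * exp (\<phi> * (t - v)) else 0) * indicator {0..} v
        = ennreal k * (ennreal (exp (\<phi> * (t - v))) * indicator {t-1..} v)"
      using AE_lborel_singleton[of "t - 1"]
    proof eventually_elim
      case (elim v)
      then show ?case
        using k_pos assms by (cases "t - 1 < v") (simp_all add: indicator_def ennreal_mult')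
    qed
  qed
  also have "\<dots> = ennreal (k * exp \<phi> / \<phi>)"
    using k_pos by (simp add: nn_integral_cmult nn_integral_exp_at_least[OF \<phi>_pos] ennreal_mult'[symmetric])
  finally show ?thesis .
qed

text \<open>Choose \<open>b > 0\<close> with \<open>tail b > 0\<close>, which exists because \<mu>
  lives on positive numbers. For \<open>v\<close> in \<open>{0..b}\<close> the integrand of the
  identity is at least \<open>Z t * exp (- \<phi> * b) * tail b\<close>, since \<open>Z\<close>
  cannot have grown faster than exponentially between \<open>t - v\<close> and
  \<open>t\<close>.\<close>

lemma Z_bounded: obtains B where "\<And>t. Z t \<le> B"
proof -
  have "\<exists>b>0. tail b > 0"
  proof (rule ccontr)
    assume "\<not> ?thesis"
    then have z: "tail b = 0" if "b > 0" for b
      using that by (metis tail_def measure_nonneg less_eq_real_def)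
    have "AE v in \<mu>. \<forall>n. v \<notin> {1 / real (Suc n)<..}"
      unfolding AE_all_countable
    proof
      fix n
      show "AE v in \<mu>. v \<notin> {1 / real (Suc n)<..}"
        using emeasure_tail[of "1 / real (Suc n)"] z[of "1 / real (Suc n)"]
        by (intro AE_not_in) (auto simp: null_sets_def)
    qed
    with law_pos have "AE v in \<mu>. False"
    proof eventually_elim
      fix v :: real assume v: "0 < v" "\<forall>n. v \<notin> {1 / real (Suc n)<..}"
      then obtain n where "1 / real (Suc n) < v"
        using nat_approx_posE by blast
      then show False using v by auto
    qed
    then show False by simp
  qed
  then obtain b where b: "b > 0" "tail b > 0" by blast
  define C where "C = k * exp \<phi> / \<phi>"
  have C: "C \<ge> 0" using k_pos \<phi>_pos by (simp add: C_def)
  have "Z t \<le> C / (b * exp (- \<phi> * b) * tail b)" for t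
  proof -
    have le: "Z t * exp (- \<phi> * b) * tail b \<le> Z (t - v) * tail v" if "v \<in> {0..b}" for v
    proof (intro mult_mono)
      have "exp (- \<phi> * t) * Z t \<le> exp (- \<phi> * (t - v)) * Z (t - v)"
        using that by (intro Z_slow) auto
      then have "exp (- \<phi> * v) * Z t \<le> Z (t - v)"
        by (simp add: algebra_simps exp_add exp_diff exp_minus field_simps)
      moreover have "exp (- \<phi> * b) * Z t \<le> exp (- \<phi> * v) * Z t"
        using that \<phi>_pos Z_nonneg by (intro mult_right_mono) auto
      ultimately show "Z t * exp (- \<phi> * b) \<le> Z (t - v)" by (simp add: mult.commute)
    qed (use that tail_antimono Z_nonneg b in \<open>auto simp: tail_def\<close>)
    have "ennreal (Z t * exp (- \<phi> * b) * tail b) * ennreal b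
        = (\<integral>\<^sup>+v. ennreal (Z t * exp (- \<phi> * b) * tail b) * indicator {0..b} v \<partial>lborel)"
      using b by (simp add: nn_integral_cmult)
    also have "\<dots> \<le> (\<integral>\<^sup>+v. ennreal (Z (t - v) * tail v) * indicator {0..} v \<partial>lborel)"
      using le by (intro nn_integral_mono) (auto simp: indicator_def intro!: ennreal_leI)
    also have "\<dots> \<le> ennreal C"
      unfolding C_def by (rule renewal_identity_le)
    finally have "Z t * exp (- \<phi> * b) * tail b * b \<le> C"
      using b C Z_nonneg by (simp add: ennreal_mult'[symmetric] ennreal_le_iff)
    then show ?thesis using b by (simp add: field_simps)
  qed
  then show ?thesis using that by blast
qed

end

section \<open>Limits of translates and the extremal argument\<close>

context survival_renewal
begin

lemma Z_integrable: "integrable \<mu> (\<lambda>v. Z (t - v))"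
proof -
  obtain B where B: "\<And>t. Z t \<le> B" using Z_bounded by blast
  show ?thesis
    by (intro integrable_const_bound[of _ B]) (use B Z_nonneg in auto)
qed

lemma Z_harmonic:
  assumes "1 \<le> t"
  shows "Z t = (\<integral>v. Z (t - v) \<partial>\<mu>)"
proof -
  have "ennreal (Z t) = (\<integral>\<^sup>+v. ennreal (Z (t - v)) \<partial>\<mu>)"
    using renewal[of t] assms by (simp add: Z_def)
  also have "\<dots> = ennreal (\<integral>v. Z (t - v) \<partial>\<mu>)"
    by (intro nn_integral_eq_integral Z_integrable) (simp add: Z_nonneg)
  finally show ?thesis
    by (subst (asm) ennreal_inj) (auto simp: Z_nonneg integral_nonneg_AE)
qed

text \<open>Helly's theorem gives convergence only at continuity points of the limit. These suffice
  inside an integral against \<mu>, so the equation \<open>Z = \<mu> * Z\<close>, valid from 1 on,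
  upgrades the convergence to every \<open>x\<close>. The limit inherits the monotonicity of
  \<open>exp (- \<phi> * x) * Z x\<close>, hence has countably many discontinuities, and harmonicity
  removes them.\<close>

lemma Z_shifts_converge:
  assumes t: "filterlim t at_top sequentially"
  obtains r \<xi> where "strict_mono (r :: nat \<Rightarrow> nat)" "\<And>x. (\<lambda>n. Z (t (r n) + x)) \<longlonglongrightarrow> \<xi> x"
    "\<And>x. isCont \<xi> x" "\<And>x. \<xi> x = (\<integral>v. \<xi> (x - v) \<partial>\<mu>)"
proof -
  obtain B where B: "\<And>t. Z t \<le> B" using Z_bounded by blast
  have B0: "0 \<le> B" using B[of 0] Z_nonneg[of 0] by simp
  text \<open>The reciprocals are monotone and uniformly bounded, as Helly's theorem demands.\<close>
  define G where "G n x = 1 / (1 + exp (- \<phi> * x) * Z (t n + x))" for n x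
  have G_eq: "G n x = 1 / (1 + exp (\<phi> * t n) * s (t n + x))" for n x
    by (simp add: G_def Z_def mult.assoc[symmetric] exp_add[symmetric] algebra_simps)
  have den: "1 \<le> 1 + exp (\<phi> * t n) * s (t n + x)" for n x
    using s_nonneg by simp
  have "\<exists>r. strict_mono r \<and> (\<exists>F. (\<forall>x. continuous (at_right x) F) \<and> mono F \<and> (\<forall>x. \<bar>F x\<bar> \<le> 1) \<and>
    (\<forall>x. continuous (at x) F \<longrightarrow> (\<lambda>n. G (r n) x) \<longlonglongrightarrow> F x))"
  proof (rule Helly_selection)
    fix n x
    have "((\<lambda>x. t n + x) \<longlongrightarrow> t n + x) (at_right x)"
      by (intro tendsto_intros)
    then have "filterlim (\<lambda>x. t n + x) (at_right (t n + x)) (at_right x)"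
      using eventually_at_right_less[of x] by (simp add: filterlim_at eventually_mono)
    with s_rcont[of "t n + x"] have "((\<lambda>x. s (t n + x)) \<longlongrightarrow> s (t n + x)) (at_right x)"
      unfolding continuous_within by (rule filterlim_compose)
    then show "continuous (at_right x) (G n)"
      unfolding continuous_within G_eq using den[of n x]
      by (intro tendsto_intros) auto
    show "mono (G n)"
      unfolding mono_def G_eq
    proof (intro allI impI)
      fix x y :: real assume "x \<le> y"
      then have "s (t n + y) \<le> s (t n + x)" by (intro s_antimono) auto
      then show "1 / (1 + exp (\<phi> * t n) * s (t n + x)) \<le> 1 / (1 + exp (\<phi> * t n) * s (t n + y))"
        using den[of n x] den[of n y] by (intro divide_left_mono) auto
    qed
    show "\<bar>G n x\<bar> \<le> 1"
      unfolding G_eq using den[of n x] by (simp add: divide_le_eq)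
  qed
  then obtain r F where r: "strict_mono r" and F: "mono F"
    and lim: "\<And>x. isCont F x \<Longrightarrow> (\<lambda>n. G (r n) x) \<longlonglongrightarrow> F x"
    by blast
  have [measurable]: "F \<in> borel_measurable borel"
    using F by (rule borel_measurable_mono)
  have tr: "filterlim (\<lambda>n. t (r n)) at_top sequentially"
    using filterlim_compose[OF t filterlim_subseq[OF r]] by simp
  have trx: "eventually (\<lambda>n. 1 \<le> t (r n) + x) sequentially" for x
    using tr[unfolded filterlim_at_top, rule_format, of "1 - x"] by (rule eventually_mono) auto
  \<comment> \<open>\<open>\<xi>0\<close> undoes the passage to reciprocals and is the limit
    wherever \<open>F\<close> is continuous. Its values elsewhere do not affect
    \<open>\<xi>\<close>, its convolution with \<mu>.\<close>
  define \<xi>0 where "\<xi>0 x = exp (\<phi> * x) * (1 / F x - 1)" for x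
  define \<xi> where "\<xi> x = (\<integral>v. \<xi>0 (x - v) \<partial>\<mu>)" for x
  have lim0: "(\<lambda>n. Z (t (r n) + x)) \<longlonglongrightarrow> \<xi>0 x" if "isCont F x" for x
  proof -
    \<comment> \<open>The bound on \<open>Z\<close> keeps the reciprocals away from 0, so that they
      can be inverted in the limit.\<close>
    have "1 / (1 + exp (- \<phi> * x) * B) \<le> G (r n) x" for n
      unfolding G_def using B B0 Z_nonneg[of "t (r n) + x"]
      by (intro divide_left_mono add_left_mono mult_left_mono mult_pos_pos add_pos_nonneg mult_nonneg_nonneg) auto
    then have "1 / (1 + exp (- \<phi> * x) * B) \<le> F x"
      by (intro LIMSEQ_le_const[OF lim[OF that]]) auto
    moreover have "0 < 1 / (1 + exp (- \<phi> * x) * B)"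
      using B0 by (intro divide_pos_pos add_pos_nonneg) auto
    ultimately have "F x \<noteq> 0" by linarith
    then have "(\<lambda>n. exp (\<phi> * x) * (1 / G (r n) x - 1)) \<longlonglongrightarrow> \<xi>0 x"
      unfolding \<xi>0_def by (intro tendsto_intros lim that)
    moreover have "exp (\<phi> * x) * (1 / G (r n) x - 1) = Z (t (r n) + x)" for n
      by (simp add: G_def mult.assoc[symmetric] exp_add[symmetric])
    ultimately show ?thesis by simp
  qed
  have [measurable]: "\<xi>0 \<in> borel_measurable borel"
    unfolding \<xi>0_def by measurable
  have \<xi>: "(\<lambda>n. Z (t (r n) + x)) \<longlonglongrightarrow> \<xi> x" for x
  proof -
    have "countable ((\<lambda>y. x - y) ` {y. \<not> isCont F y})"
      using mono_ctble_discont[OF F] by simp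
    from AE_not_countable[OF this]
    have "AE v in \<mu>. (\<lambda>n. Z (t (r n) + x - v)) \<longlonglongrightarrow> \<xi>0 (x - v)"
    proof (rule AE_mp, intro AE_I2 impI)
      fix v assume "v \<notin> (\<lambda>y. x - y) ` {y. \<not> isCont F y}"
      then have "isCont F (x - v)" by (auto simp: image_iff)
      from lim0[OF this] show "(\<lambda>n. Z (t (r n) + x - v)) \<longlonglongrightarrow> \<xi>0 (x - v)"
        by (simp add: add_diff_eq)
    qed
    then have "(\<lambda>n. \<integral>v. Z (t (r n) + x - v) \<partial>\<mu>) \<longlonglongrightarrow> \<xi> x"
      unfolding \<xi>_def
      by (intro integral_dominated_convergence[where w = "\<lambda>_. B"]) (use B Z_nonneg in auto)
    then show ?thesis
      by (rule Lim_transform_eventually) (use trx[of x] in \<open>auto elim!: eventually_mono simp: Z_harmonic\<close>)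
  qed
  have [measurable]: "\<xi> \<in> borel_measurable borel"
    by (rule borel_measurable_LIMSEQ_real[OF \<xi>]) measurable
  have \<xi>_bnd: "\<bar>\<xi> x\<bar> \<le> B" for x
  proof -
    have "0 \<le> \<xi> x" by (rule LIMSEQ_le_const[OF \<xi>]) (use Z_nonneg in auto)
    moreover have "\<xi> x \<le> B" by (rule LIMSEQ_le_const2[OF \<xi>]) (use B in auto)
    ultimately show ?thesis by simp
  qed
  have harm: "\<xi> x = (\<integral>v. \<xi> (x - v) \<partial>\<mu>)" for x
  proof (rule LIMSEQ_unique[OF \<xi>])
    have "(\<lambda>n. \<integral>v. Z (t (r n) + x - v) \<partial>\<mu>) \<longlonglongrightarrow> (\<integral>v. \<xi> (x - v) \<partial>\<mu>)"
      using \<xi>[of "x - _"]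
      by (intro integral_dominated_convergence[where w = "\<lambda>_. B"]) (use B Z_nonneg in \<open>auto simp: add_diff_eq\<close>)
    then show "(\<lambda>n. Z (t (r n) + x)) \<longlonglongrightarrow> (\<integral>v. \<xi> (x - v) \<partial>\<mu>)"
      by (rule Lim_transform_eventually) (use trx[of x] in \<open>auto elim!: eventually_mono simp: Z_harmonic\<close>)
  qed
  have "mono (\<lambda>x. - (exp (- \<phi> * x) * \<xi> x))"
    unfolding mono_def
  proof (intro allI impI)
    fix x y :: real assume "x \<le> y"
    have "exp (- \<phi> * y) * Z (t (r n) + y) \<le> exp (- \<phi> * x) * Z (t (r n) + x)" for n
    proof -
      have "exp (\<phi> * t (r n)) * s (t (r n) + y) \<le> exp (\<phi> * t (r n)) * s (t (r n) + x)"
        using \<open>x \<le> y\<close> by (intro mult_left_mono s_antimono) auto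
      then show ?thesis
        by (simp add: Z_def mult.assoc[symmetric] exp_add[symmetric] algebra_simps)
    qed
    then have "exp (- \<phi> * y) * \<xi> y \<le> exp (- \<phi> * x) * \<xi> x"
      by (intro LIMSEQ_le[OF tendsto_mult_left[OF \<xi>] tendsto_mult_left[OF \<xi>]]) auto
    then show "- (exp (- \<phi> * x) * \<xi> x) \<le> - (exp (- \<phi> * y) * \<xi> y)" by simp
  qed
  from mono_ctble_discont[OF this]
  have "countable {x. \<not> isCont \<xi> x}"
  proof (rule countable_subset[rotated], intro Collect_mono impI)
    fix x assume "\<not> isCont \<xi> x"
    show "\<not> isCont (\<lambda>x. - (exp (- \<phi> * x) * \<xi> x)) x"
    proof
      assume *: "isCont (\<lambda>x. - (exp (- \<phi> * x) * \<xi> x)) x"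
      have "isCont (\<lambda>x. - exp (\<phi> * x)) x"
        by (intro continuous_intros)
      from continuous_mult[OF this *] show False using \<open>\<not> isCont \<xi> x\<close>
        by (simp add: mult.assoc[symmetric] exp_add[symmetric])
    qed
  qed
  from isCont_of_countable_discontinuities[OF this \<xi>_bnd _ renewal_law_axioms harm]
  have "isCont \<xi> x" for x by simp
  with r \<xi> harm that show ?thesis by blast
qed

lemma tail_nonneg: "0 \<le> tail v"
  by (simp add: tail_def)

lemma tail_integrable: "integrable lborel (\<lambda>v. tail v * indicator {0..} v)"
  and tail_integral: "(\<integral>v. tail v * indicator {0..} v \<partial>lborel) = D"
proof -
  have eq: "(\<integral>\<^sup>+v. ennreal (tail v * indicator {0..} v) \<partial>lborel) = ennreal D"
    using nn_integral_tail by (simp add: ennreal_mult'' ennreal_indicator)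
  then show "integrable lborel (\<lambda>v. tail v * indicator {0..} v)"
    by (intro integrableI_nonneg) (auto simp: tail_nonneg)
  show "(\<integral>v. tail v * indicator {0..} v \<partial>lborel) = D"
    by (rule integral_eq_nn_integral[THEN trans]) (use eq D_nonneg in \<open>auto simp: tail_nonneg\<close>)
qed

text \<open>By \<open>ext\<close>, a limit of translates along \<open>t\<close> lies on one side of
  \<open>c\<close> everywhere and equals \<open>c\<close> at 0, so it tends to \<open>c\<close> at
  minus infinity. The integrated identity survives two limits, first along the translates and then
  towards minus infinity, both dominated by \<open>B\<close> times the tail, which is integrable
  because the mean is finite.\<close>

lemma extremal_limit:
  assumes t: "filterlim t at_top sequentially" and c: "(\<lambda>n. Z (t n)) \<longlonglongrightarrow> c"
    and ext: "(\<forall>e>0. eventually (\<lambda>x. Z x \<le> c + e) at_top) \<or> (\<forall>e>0. eventually (\<lambda>x. c - e \<le> Z x) at_top)"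
  shows "c * D = k * exp \<phi> / \<phi>"
proof -
  obtain B where B: "\<And>t. Z t \<le> B" using Z_bounded by blast
  have B0: "0 \<le> B" using B[of 0] Z_nonneg[of 0] by simp
  obtain r \<xi> where r: "strict_mono r" and \<xi>: "\<And>x. (\<lambda>n. Z (t (r n) + x)) \<longlonglongrightarrow> \<xi> x"
    and cont: "\<And>x. isCont \<xi> x" and harm: "\<And>x. \<xi> x = (\<integral>v. \<xi> (x - v) \<partial>\<mu>)"
    using Z_shifts_converge[OF t] by blast
  have tr: "filterlim (\<lambda>n. t (r n)) at_top sequentially"
    using filterlim_compose[OF t filterlim_subseq[OF r]] by simp
  have trx: "filterlim (\<lambda>n. t (r n) + x) at_top sequentially" for x
    using filterlim_tendsto_add_at_top[OF tendsto_const[of x] tr] by (simp add: add.commute)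
  have [measurable]: "\<xi> \<in> borel_measurable borel"
    by (rule borel_measurable_LIMSEQ_real[OF \<xi>]) measurable
  have \<xi>0: "0 \<le> \<xi> x" for x by (rule LIMSEQ_le_const[OF \<xi>]) (use Z_nonneg in auto)
  have \<xi>B: "\<xi> x \<le> B" for x by (rule LIMSEQ_le_const2[OF \<xi>]) (use B in auto)
  have "\<xi> 0 = c"
    using LIMSEQ_unique[OF \<xi>[of 0]] LIMSEQ_subseq_LIMSEQ[OF c r] by (simp add: o_def)
  have "\<xi> x \<le> c" if *: "\<forall>e>0. eventually (\<lambda>x. Z x \<le> c + e) at_top" for x
  proof (rule field_le_epsilon)
    fix e :: real assume "0 < e"
    then have "eventually (\<lambda>n. Z (t (r n) + x) \<le> c + e) sequentially"
      using * trx[of x] by (auto simp: filterlim_iff)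
    then show "\<xi> x \<le> c + e"
      by (intro tendsto_upperbound[OF \<xi>]) auto
  qed
  moreover have "c \<le> \<xi> x" if *: "\<forall>e>0. eventually (\<lambda>x. c - e \<le> Z x) at_top" for x
  proof (rule field_le_epsilon)
    fix e :: real assume "0 < e"
    then have "eventually (\<lambda>n. c - e \<le> Z (t (r n) + x)) sequentially"
      using * trx[of x] by (auto simp: filterlim_iff)
    then have "c - e \<le> \<xi> x"
      by (intro tendsto_lowerbound[OF \<xi>]) auto
    then show "c \<le> \<xi> x + e" by simp
  qed
  ultimately have ext\<xi>: "(\<forall>x. \<xi> x \<le> c) \<or> (\<forall>x. c \<le> \<xi> x)"
    using ext by blast
  have lim: "((\<lambda>y. \<xi> (- y)) \<longlongrightarrow> c) at_top"
  proof (rule harmonic_tendsto_extremum[OF cont _ \<xi>0 harm ext\<xi> \<open>\<xi> 0 = c\<close> _ \<phi>_pos])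
    show "\<bar>\<xi> x\<bar> \<le> B" for x using \<xi>0[of x] \<xi>B[of x] by simp
    fix x y :: real assume "x \<le> y"
    have "exp (- \<phi> * y) * Z (t (r n) + y) \<le> exp (- \<phi> * x) * Z (t (r n) + x)" for n
    proof -
      have "exp (\<phi> * t (r n)) * s (t (r n) + y) \<le> exp (\<phi> * t (r n)) * s (t (r n) + x)"
        using \<open>x \<le> y\<close> by (intro mult_left_mono s_antimono) auto
      then show ?thesis
        by (simp add: Z_def mult.assoc[symmetric] exp_add[symmetric] algebra_simps)
    qed
    then show "exp (- \<phi> * y) * \<xi> y \<le> exp (- \<phi> * x) * \<xi> x"
      by (intro LIMSEQ_le[OF tendsto_mult_left[OF \<xi>] tendsto_mult_left[OF \<xi>]]) auto
  qed
  define C where "C = k * exp \<phi> / \<phi>"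
  define T where "T v = tail v * indicator {0..} v" for v
  have T_int: "integrable lborel T" and T_D: "integral\<^sup>L lborel T = D" and T0: "\<And>v. 0 \<le> T v"
    using tail_integrable tail_integral by (simp_all add: T_def[abs_def] tail_nonneg)
  have [measurable]: "T \<in> borel_measurable borel" unfolding T_def by measurable
  have dom: "integrable lborel (\<lambda>v. B * T v)" using T_int by simp
  have Z_C: "(\<integral>v. Z (t - v) * T v \<partial>lborel) = C" if "1 \<le> t" for t
  proof -
    have "(\<integral>\<^sup>+v. ennreal (Z (t - v) * T v) \<partial>lborel) = ennreal C"
      using renewal_identity_eq[OF that]
      by (simp add: T_def C_def ennreal_mult'' ennreal_indicator mult.assoc[symmetric])
    then show ?thesis
      using k_pos \<phi>_pos Z_nonneg T0
      by (subst integral_eq_nn_integral) (auto simp: C_def)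
  qed
  \<comment> \<open>One sequence has two limits: the integrals converge by dominated convergence,
    and they are eventually constant because \<open>t (r n) - y\<close> exceeds 1 in the
    end.\<close>
  have \<xi>_C: "(\<integral>v. \<xi> (- y - v) * T v \<partial>lborel) = C" for y
  proof (rule LIMSEQ_unique)
    show "(\<lambda>n. \<integral>v. Z (t (r n) + (- y - v)) * T v \<partial>lborel) \<longlonglongrightarrow> (\<integral>v. \<xi> (- y - v) * T v \<partial>lborel)"
      by (intro integral_dominated_convergence[OF _ _ dom])
         (use B Z_nonneg T0 \<xi> in \<open>auto intro!: tendsto_intros mult_right_mono AE_I2\<close>)
    have "eventually (\<lambda>n. 1 \<le> t (r n) + - y) sequentially"
      using trx[of "-y", unfolded filterlim_at_top] by blast
    then have "eventually (\<lambda>n. C = (\<integral>v. Z (t (r n) + (- y - v)) * T v \<partial>lborel)) sequentially"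
      by eventually_elim (simp add: Z_C[symmetric] add_diff_eq)
    then show "(\<lambda>n. \<integral>v. Z (t (r n) + (- y - v)) * T v \<partial>lborel) \<longlonglongrightarrow> C"
      by (rule Lim_transform_eventually[OF tendsto_const])
  qed
  have "(\<lambda>n. \<integral>v. \<xi> (- real n - v) * T v \<partial>lborel) \<longlonglongrightarrow> (\<integral>v. c * T v \<partial>lborel)"
  proof (intro integral_dominated_convergence[OF _ _ dom] AE_I2 tendsto_mult tendsto_const)
    fix v
    have "filterlim (\<lambda>n. v + real n) at_top sequentially"
      by (intro filterlim_tendsto_add_at_top[OF tendsto_const] filterlim_real_sequentially)
    moreover have "- (v + real n) = - real n - v" for n by simp
    ultimately show "(\<lambda>n. \<xi> (- real n - v)) \<longlonglongrightarrow> c"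
      using filterlim_compose[OF lim, of "\<lambda>n. v + real n"] by (simp only:)
  qed (use \<xi>0 \<xi>B T0 in \<open>auto intro!: mult_right_mono\<close>)
  then have "C = c * D"
    by (simp add: \<xi>_C LIMSEQ_const_iff T_D)
  then show ?thesis by (simp add: C_def)
qed

text \<open>Upper and lower limit, the latter obtained from \<open>- Z\<close>, solve the same
  equation \<open>c * D = C\<close>. As \<open>C > 0\<close>, this forces \<open>D > 0\<close> and
  then their equality.\<close>

theorem Z_tendsto: "(Z \<longlongrightarrow> exp \<phi> * k / (\<phi> * D)) at_top" and D_pos: "0 < D"
proof -
  define C where "C = k * exp \<phi> / \<phi>"
  have C: "0 < C" using k_pos \<phi>_pos by (simp add: C_def)
  obtain B where B: "\<And>t. Z t \<le> B" using Z_bounded by blast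
  have ZB: "\<bar>Z t\<bar> \<le> B" for t using B[of t] Z_nonneg[of t] by simp
  obtain c1 t1 where 1: "filterlim t1 at_top sequentially" "(\<lambda>n. Z (t1 n)) \<longlonglongrightarrow> c1"
    and ext1: "\<And>e. e > 0 \<Longrightarrow> eventually (\<lambda>x. Z x \<le> c1 + e) at_top"
    by (rule extremal_sequence[of Z, OF ZB]) (rule that)
  obtain c2 t2 where 2: "filterlim t2 at_top sequentially" "(\<lambda>n. - Z (t2 n)) \<longlonglongrightarrow> c2"
    and ext2: "\<And>e. e > 0 \<Longrightarrow> eventually (\<lambda>x. - Z x \<le> c2 + e) at_top"
  proof (rule extremal_sequence[of "\<lambda>x. - Z x" B])
    show "\<bar>- Z t\<bar> \<le> B" for t using ZB[of t] by simp
  qed (rule that)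
  have "c1 * D = C"
    unfolding C_def using ext1 by (intro extremal_limit[OF 1]) auto
  moreover have "- c2 * D = C"
    unfolding C_def
  proof (rule extremal_limit[OF 2(1)])
    show "(\<lambda>n. Z (t2 n)) \<longlonglongrightarrow> - c2" using tendsto_minus[OF 2(2)] by simp
    have "- c2 - e \<le> Z x \<longleftrightarrow> - Z x \<le> c2 + e" for x e by linarith
    then show "(\<forall>e>0. \<forall>\<^sub>F x in at_top. Z x \<le> - c2 + e) \<or> (\<forall>e>0. \<forall>\<^sub>F x in at_top. - c2 - e \<le> Z x)"
      using ext2 by simp
  qed
  ultimately have D: "D > 0" and c: "c1 = C / D" "c2 = - (C / D)"
    using C D_nonneg by (cases "D = 0"; auto simp: field_simps)+
  show "0 < D" by fact
  have "(Z \<longlongrightarrow> C / D) at_top"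
  proof (rule tendstoI)
    fix e :: real assume e: "0 < e"
    have "eventually (\<lambda>x. Z x \<le> c1 + e / 2) at_top" "eventually (\<lambda>x. - Z x \<le> c2 + e / 2) at_top"
      using ext1[of "e / 2"] ext2[of "e / 2"] e by auto
    then show "eventually (\<lambda>x. dist (Z x) (C / D) < e) at_top"
      by eventually_elim (use e in \<open>auto simp: dist_real_def c\<close>)
  qed
  then show "(Z \<longlongrightarrow> exp \<phi> * k / (\<phi> * D)) at_top"
    by (simp add: C_def field_simps)
qed

end

section \<open>Step paths\<close>

definition zero_on :: "(real \<Rightarrow> nat) \<Rightarrow> real \<Rightarrow> real \<Rightarrow> bool" where
  "zero_on x a b \<longleftrightarrow> (\<forall>r\<in>{a..b}. x r = 0)"

text \<open>For \<open>b = 0\<close> this is the event of being killed by time \<open>t\<close> when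
  the clock starts at 0. A general \<open>b\<close> disregards everything before a regeneration
  time.\<close>

definition unit_hold :: "real \<Rightarrow> real \<Rightarrow> (real \<Rightarrow> nat) \<Rightarrow> bool" where
  "unit_hold b t x \<longleftrightarrow> (\<exists>a\<in>{b..t - 1}. zero_on x a (a + 1))"

definition shift :: "real \<Rightarrow> (real \<Rightarrow> nat) \<Rightarrow> real \<Rightarrow> nat" where
  "shift s x = (\<lambda>t. x (s + t))"

lemma zero_onD: "zero_on x a b \<Longrightarrow> a \<le> r \<Longrightarrow> r \<le> b \<Longrightarrow> x r = 0"
  by (auto simp: zero_on_def)

lemma step_path_right:
  assumes "step_path x" "0 \<le> t"
  shows "\<exists>d>0. \<forall>s. t \<le> s \<longrightarrow> s < t + d \<longrightarrow> x s = x t"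
proof -
  have "eventually (\<lambda>s. x s = x t) (at_right t)"
    using assms by (auto simp: step_path_def)
  then obtain b where b: "b > t" "\<And>s. t < s \<Longrightarrow> s < b \<Longrightarrow> x s = x t"
    by (auto simp: eventually_at_right[of t "t + 1"])
  have "x s = x t" if "t \<le> s" "s < t + (b - t)" for s
    using b(2)[of s] that by (cases "s = t") auto
  moreover have "b - t > 0" using b(1) by simp
  ultimately show ?thesis by blast
qed

lemma step_path_left:
  assumes "step_path x" "0 < t"
  shows "\<exists>d>0. \<exists>j. \<forall>s. t - d < s \<longrightarrow> s < t \<longrightarrow> x s = j"
proof -
  obtain j where "eventually (\<lambda>s. x s = j) (at_left t)"
    using assms by (auto simp: step_path_def)
  then obtain b where b: "b < t" "\<And>s. b < s \<Longrightarrow> s < t \<Longrightarrow> x s = j"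
    by (auto simp: eventually_at_left[of "t - 1" t])
  have "t - b > 0" "\<forall>s. t - (t - b) < s \<longrightarrow> s < t \<longrightarrow> x s = j"
    using b by auto
  then show ?thesis by blast
qed

text \<open>Right-constancy provides a rational time just after \<open>t\<close> with the same
  state. All countable descriptions of path events, and so their measurability, rest on
  this.\<close>

lemma step_path_rational:
  assumes "step_path x" "0 \<le> t" "t < c"
  obtains r where "r \<in> \<rat>" "t < r" "r < c" "x r = x t"
proof -
  obtain d where d: "d > 0" "\<And>s. t \<le> s \<Longrightarrow> s < t + d \<Longrightarrow> x s = x t"
    using step_path_right[OF assms(1,2)] by blast
  obtain r where "r \<in> \<rat>" "t < r" "r < min c (t + d)"
    using Rats_dense_in_real[of t "min c (t + d)"] assms d by auto
  with d(2)[of r] that show ?thesis by auto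
qed

lemma step_path_shift:
  assumes "step_path x" "0 \<le> s"
  shows "step_path (shift s x)"
proof -
  have "eventually (\<lambda>r. x (s + r) = x (s + t)) (at_right t)" if "0 \<le> t" for t
  proof -
    have "0 \<le> s + t" using assms that by simp
    then obtain d where d: "d > 0" "\<And>r. s + t \<le> r \<Longrightarrow> r < s + t + d \<Longrightarrow> x r = x (s + t)"
      using step_path_right[OF assms(1)] by blast
    have "x (s + r) = x (s + t)" if "t < r" "r < t + d" for r
      by (rule d(2)) (use that in auto)
    moreover have "t < t + d" using d(1) by simp
    ultimately show ?thesis
      unfolding eventually_at_right[OF \<open>t < t + d\<close>] by blast
  qed
  moreover have "\<exists>j. eventually (\<lambda>r. x (s + r) = j) (at_left t)" if "0 < t" for t
  proof -
    have "0 < s + t" using assms that by simp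
    then obtain d j where d: "d > 0" "\<And>r. s + t - d < r \<Longrightarrow> r < s + t \<Longrightarrow> x r = j"
      using step_path_left[OF assms(1)] by blast
    have "x (s + r) = j" if "t - d < r" "r < t" for r
      by (rule d(2)) (use that in auto)
    moreover have "t - d < t" using d(1) by simp
    ultimately show ?thesis
      unfolding eventually_at_left[OF \<open>t - d < t\<close>] by blast
  qed
  ultimately show ?thesis unfolding step_path_def shift_def by blast
qed

text \<open>The right end \<open>b\<close> is tested separately, because the rational substitute for
  a time lies strictly after it.\<close>

lemma zero_on_iff_rational:
  assumes "step_path x" "0 \<le> a" "a \<le> b"
  shows "zero_on x a b \<longleftrightarrow> x a = 0 \<and> x b = 0 \<and> (\<forall>r\<in>\<rat>. a \<le> r \<and> r \<le> b \<longrightarrow> x r = 0)"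
proof
  assume R: "x a = 0 \<and> x b = 0 \<and> (\<forall>r\<in>\<rat>. a \<le> r \<and> r \<le> b \<longrightarrow> x r = 0)"
  show "zero_on x a b"
    unfolding zero_on_def
  proof
    fix t assume t: "t \<in> {a..b}"
    show "x t = 0"
    proof (cases "t = b")
      case False
      with t assms obtain r where "r \<in> \<rat>" "t < r" "r < b" "x r = x t"
        using step_path_rational[OF assms(1), of t b] by auto
      with R t show ?thesis by auto
    qed (use R in simp)
  qed
qed (use assms in \<open>auto simp: zero_on_def\<close>)

text \<open>The infimum is attained: if \<open>Q\<close> failed at \<open>w\<close>, right-constancy
  would extend the failure beyond \<open>w\<close>.\<close>

lemma step_path_Inf:
  assumes "step_path x" "0 \<le> l" "Inf {ereal t | t. l \<le> t \<and> Q (x t)} = ereal w"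
  shows "l \<le> w" "Q (x w)" "\<And>t. l \<le> t \<Longrightarrow> t < w \<Longrightarrow> \<not> Q (x t)"
proof -
  show lw: "l \<le> w"
  proof -
    have "ereal l \<le> Inf {ereal t | t. l \<le> t \<and> Q (x t)}" by (intro Inf_greatest) auto
    then show ?thesis using assms by simp
  qed
  show nQ: "\<not> Q (x t)" if "l \<le> t" "t < w" for t
  proof
    assume "Q (x t)"
    then have "Inf {ereal t | t. l \<le> t \<and> Q (x t)} \<le> ereal t" using that by (intro Inf_lower) auto
    then show False using assms that by simp
  qed
  obtain d where d: "d > 0" "\<And>s. w \<le> s \<Longrightarrow> s < w + d \<Longrightarrow> x s = x w"
    using step_path_right[OF assms(1), of w] assms lw by auto
  have "Inf {ereal t | t. l \<le> t \<and> Q (x t)} < ereal (w + d)"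
    using assms(3) d(1) by simp
  then obtain t where "l \<le> t" "Q (x t)" "t < w + d"
    by (auto simp: Inf_less_iff)
  then show "Q (x w)" using nQ[of t] d(2)[of t] by (cases "t < w") auto
qed

section \<open>Hitting, holding, return and killing times in terms of countably many
  coordinates\<close>

lemma hit_time_less_iff:
  assumes "step_path x"
  shows "hit_time x < ereal c \<longleftrightarrow> (\<exists>r\<in>\<rat>. 0 \<le> r \<and> r < c \<and> x r = 0)"
proof
  assume "hit_time x < ereal c"
  then obtain t where "0 \<le> t" "x t = 0" "t < c"
    by (auto simp: hit_time_def Inf_less_iff)
  then show "\<exists>r\<in>\<rat>. 0 \<le> r \<and> r < c \<and> x r = 0"
    using step_path_rational[OF assms, of t c] by (metis less_eq_real_def less_trans)
qed (auto simp: hit_time_def Inf_less_iff)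

lemma hold_time_less_iff:
  assumes "step_path x"
  shows "hold_time x < ereal c \<longleftrightarrow> (\<exists>r\<in>\<rat>. 0 \<le> r \<and> r < c \<and> x r \<noteq> 0)"
proof
  assume "hold_time x < ereal c"
  then obtain t where "0 \<le> t" "x t \<noteq> 0" "t < c"
    by (auto simp: hold_time_def Inf_less_iff)
  then show "\<exists>r\<in>\<rat>. 0 \<le> r \<and> r < c \<and> x r \<noteq> 0"
    using step_path_rational[OF assms, of t c] by (metis less_eq_real_def less_trans)
qed (auto simp: hold_time_def Inf_less_iff)

lemma hold_time_nonneg: "0 \<le> hold_time x"
  unfolding hold_time_def by (intro Inf_greatest) auto

lemma hold_time_le: "0 \<le> t \<Longrightarrow> x t \<noteq> 0 \<Longrightarrow> hold_time x \<le> ereal t"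
  unfolding hold_time_def by (intro Inf_lower) auto

lemma hold_time_attained:
  assumes "step_path x" "hold_time x = ereal h"
  shows "0 \<le> h" "x h \<noteq> 0" "\<And>t. 0 \<le> t \<Longrightarrow> t < h \<Longrightarrow> x t = 0"
  using step_path_Inf[OF assms(1) order_refl, of "\<lambda>j. j \<noteq> 0" h] assms(2)
  by (auto simp: hold_time_def)

lemma hit_time_nonneg: "0 \<le> hit_time x"
  unfolding hit_time_def by (intro Inf_greatest) auto

lemma hit_time_attained:
  assumes "step_path x" "hit_time x = ereal h"
  shows "0 \<le> h" "x h = 0" "\<And>t. 0 \<le> t \<Longrightarrow> t < h \<Longrightarrow> x t \<noteq> 0"
  using step_path_Inf[OF assms(1) order_refl, of "\<lambda>j. j = 0" h] assms(2)
  by (auto simp: hit_time_def)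

lemma return_time_ge_hold: "hold_time x \<le> return_time x"
  unfolding return_time_def by (intro Inf_greatest) auto

lemma return_time_attained:
  assumes "step_path x" "return_time x = ereal w"
  obtains h where "hold_time x = ereal h" "0 \<le> h" "h < w" "x h \<noteq> 0" "x w = 0"
    "\<And>t. 0 \<le> t \<Longrightarrow> t < h \<Longrightarrow> x t = 0" "\<And>t. h \<le> t \<Longrightarrow> t < w \<Longrightarrow> x t \<noteq> 0"
proof -
  obtain h where h: "hold_time x = ereal h"
    using return_time_ge_hold[of x] hold_time_nonneg[of x] assms(2) by (cases "hold_time x") auto
  note hold = hold_time_attained[OF assms(1) h]
  have "Inf {ereal t | t. h \<le> t \<and> x t = 0} = ereal w"
    using assms(2) by (simp add: return_time_def h)
  note ret = step_path_Inf[OF assms(1) hold(1), of "\<lambda>j. j = 0", OF this]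
  have "h < w" using ret hold by (metis less_eq_real_def)
  with h hold ret that show ?thesis by blast
qed

lemma return_time_less_iff:
  assumes "step_path x"
  shows "return_time x < ereal c \<longleftrightarrow>
    (\<exists>r\<in>\<rat>. \<exists>r'\<in>\<rat>. 0 \<le> r \<and> r < r' \<and> r' < c \<and> x r \<noteq> 0 \<and> x r' = 0)"
proof
  assume "return_time x < ereal c"
  then obtain t where t: "hold_time x \<le> ereal t" "x t = 0" "t < c"
    by (auto simp: return_time_def Inf_less_iff)
  then obtain h where h: "hold_time x = ereal h" using hold_time_nonneg[of x] by (cases "hold_time x") auto
  note hold = hold_time_attained[OF assms h]
  have "h < t" using t h hold by (cases "h = t") auto
  obtain r where r: "r \<in> \<rat>" "h < r" "r < t" "x r = x h"
    using step_path_rational[OF assms hold(1) \<open>h < t\<close>] .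
  obtain r' where r': "r' \<in> \<rat>" "t < r'" "r' < c" "x r' = x t"
    using step_path_rational[OF assms _ t(3)] hold \<open>h < t\<close> by auto
  have "0 \<le> r" "r < r'" "x r \<noteq> 0" "x r' = 0" using r r' t hold by auto
  with r(1) r'(1,3) show "\<exists>r\<in>\<rat>. \<exists>r'\<in>\<rat>. 0 \<le> r \<and> r < r' \<and> r' < c \<and> x r \<noteq> 0 \<and> x r' = 0" by blast
next
  assume "\<exists>r\<in>\<rat>. \<exists>r'\<in>\<rat>. 0 \<le> r \<and> r < r' \<and> r' < c \<and> x r \<noteq> 0 \<and> x r' = 0"
  then obtain r r' where r: "0 \<le> r" "r < r'" "r' < c" "x r \<noteq> 0" "x r' = 0" by blast
  have "hold_time x \<le> ereal r'" using hold_time_le[of r x] r by (auto intro: order_trans)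
  then have "return_time x \<le> ereal r'" unfolding return_time_def using r by (intro Inf_lower) auto
  then show "return_time x < ereal c" using r by (auto intro: le_less_trans)
qed

text \<open>The clock can reach one in two ways: by staying at 0 from time 0 on with
  \<open>u\<close> already counted, or by being at 0 throughout the last unit of time.\<close>

lemma current_hold_ge_1_iff:
  assumes x: "step_path x" and t: "0 \<le> t" and u: "0 \<le> u"
  shows "(\<exists>h. current_hold u x t = Some h \<and> 1 \<le> h) \<longleftrightarrow>
    (1 - u \<le> t \<and> zero_on x 0 t) \<or> (1 \<le> t \<and> zero_on x (t - 1) t)"
proof -
  consider "x t \<noteq> 0" | "zero_on x 0 t" | "x t = 0" "\<not> zero_on x 0 t" by blast
  then show ?thesis
  proof cases
    case 1
    then show ?thesis using t by (auto simp: current_hold_def zero_on_def)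
  next
    case 2
    then have "current_hold u x t = Some (u + t)"
      using t by (auto simp: current_hold_def zero_on_def)
    then show ?thesis using 2 u by auto
  next
    case 3
    define E where "E = {s. 0 \<le> s \<and> s \<le> t \<and> zero_on x s t}"
    have E: "t \<in> E" "bdd_below E"
      using 3 t by (auto simp: E_def zero_on_def intro: bdd_belowI[of _ 0])
    have "current_hold u x t = Some (t - Inf E)"
      using 3 t by (auto simp: current_hold_def zero_on_def E_def)
    then have "(\<exists>h. current_hold u x t = Some h \<and> 1 \<le> h) \<longleftrightarrow> Inf E \<le> t - 1"
      by auto
    also have "\<dots> \<longleftrightarrow> 1 \<le> t \<and> zero_on x (t - 1) t"
    proof
      assume "1 \<le> t \<and> zero_on x (t - 1) t"
      then have "t - 1 \<in> E" by (auto simp: E_def)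
      then show "Inf E \<le> t - 1" using E by (intro cInf_lower)
    next
      assume I: "Inf E \<le> t - 1"
      have "0 \<le> Inf E" using E by (intro cInf_greatest) (auto simp: E_def)
      then have t1: "1 \<le> t" using I by simp
      have z: "x s = 0" if "t - 1 < s" "s \<le> t" for s
      proof -
        have "Inf E < s" "E \<noteq> {}" using I that E by auto
        from cInf_lessD[OF this(2,1)] obtain e where "e \<in> E" "e < s" by blast
        then show ?thesis using that by (auto simp: E_def zero_on_def)
      qed
      \<comment> \<open>So far the path is known to be 0 only after \<open>t - 1\<close>.
        Right-constancy adds the left end itself.\<close>
      obtain r where "t - 1 < r" "r < t" "x r = x (t - 1)"
        using step_path_rational[OF x, of "t - 1" t] t1 by auto
      then have "x (t - 1) = 0" using z[of r] by simp
      then show "1 \<le> t \<and> zero_on x (t - 1) t"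
        using t1 z by (auto simp: zero_on_def) (metis less_eq_real_def)
    qed
    finally show ?thesis using 3 by simp
  qed
qed

text \<open>The infimum is attained by right-constancy, so \<open>\<le>\<close> becomes the
  existence of a time up to \<open>t\<close> in the defining set.\<close>

lemma kill_time_le_iff:
  assumes x: "step_path x" and u: "0 \<le> u" "u < 1"
  shows "kill_time u x \<le> ereal t \<longleftrightarrow> (1 - u \<le> t \<and> zero_on x 0 (1 - u)) \<or> unit_hold 0 t x"
proof -
  define T where "T = {t. 0 \<le> t \<and> ((1 - u \<le> t \<and> zero_on x 0 t) \<or> (1 \<le> t \<and> zero_on x (t - 1) t))}"
  have kT: "kill_time u x = Inf (ereal ` T)"
    unfolding kill_time_def T_def
    by (rule arg_cong[where f = Inf]) (use current_hold_ge_1_iff[OF x _ u(1)] in blast)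
  have "Inf (ereal ` T) \<le> ereal t \<longleftrightarrow> (\<exists>t'\<in>T. t' \<le> t)"
  proof
    assume le: "Inf (ereal ` T) \<le> ereal t"
    show "\<exists>t'\<in>T. t' \<le> t"
    proof (rule ccontr)
      assume none: "\<not> ?thesis"
      have close: "\<exists>t'\<in>T. t < t' \<and> t' < t + d" if "d > 0" for d
      proof -
        have "Inf (ereal ` T) < ereal (t + d)" using le that by (auto intro: le_less_trans)
        then show ?thesis using none by (auto simp: Inf_less_iff not_le)
      qed
      have "0 \<le> t"
      proof (rule ccontr)
        assume "\<not> 0 \<le> t"
        then obtain t' where "t' \<in> T" "t' < t + (- t)" using close[of "-t"] by auto
        then show False by (auto simp: T_def)
      qed
      \<comment> \<open>\<open>d1\<close> stops a time shortly after \<open>t\<close> from jumping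
        over \<open>1 - u\<close>. Likewise \<open>d2\<close> stops it from jumping over 1 or, once
        \<open>t \<ge> 1\<close>, keeps the path constant where the unit window begins. Killing
        within this distance after \<open>t\<close> is then killing at \<open>t\<close>.\<close>
      define d1 where "d1 = (if t < 1 - u then 1 - u - t else 1)"
      have d1: "d1 > 0" by (simp add: d1_def)
      obtain d2 where d2: "d2 > 0" "t < 1 \<Longrightarrow> t + d2 \<le> 1"
        "1 \<le> t \<Longrightarrow> \<forall>s. t - 1 \<le> s \<longrightarrow> s < t - 1 + d2 \<longrightarrow> x s = x (t - 1)"
      proof (cases "t < 1")
        case True
        then show ?thesis by (intro that[of "1 - t"]) auto
      next
        case False
        then have "0 \<le> t - 1" by simp
        from step_path_right[OF x this] False that show ?thesis by (metis not_less)
      qed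
      obtain t' where t': "t' \<in> T" "t < t'" "t' < t + min d1 d2" using close[of "min d1 d2"] d1 d2 by auto
      have "t \<in> T"
      proof (cases "1 - u \<le> t' \<and> zero_on x 0 t'")
        case True
        then have "1 - u \<le> t" using t' by (auto simp: d1_def split: if_splits)
        then show ?thesis using True t' \<open>0 \<le> t\<close> by (auto simp: T_def zero_on_def)
      next
        case False
        then have z: "1 \<le> t'" "zero_on x (t' - 1) t'" using t'(1) by (auto simp: T_def)
        have t1: "1 \<le> t" using z t' d2 by (cases "t < 1") auto
        have "x (t' - 1) = 0" using z by (auto simp: zero_on_def)
        then have "x (t - 1) = 0" using d2(3)[OF t1, rule_format, of "t' - 1"] t' by simp
        then have "x s = 0" if "t - 1 \<le> s" "s \<le> t" for s
          using d2(3)[OF t1, rule_format, of s] t' z that by (cases "s < t' - 1") (auto simp: zero_on_def)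
        then show ?thesis using t1 by (auto simp: T_def zero_on_def)
      qed
      then show False using none by blast
    qed
  qed (auto intro: Inf_lower2)
  also have "\<dots> \<longleftrightarrow> (1 - u \<le> t \<and> zero_on x 0 (1 - u)) \<or> unit_hold 0 t x"
  proof
    assume "\<exists>t'\<in>T. t' \<le> t"
    then obtain t' where t': "t' \<in> T" "t' \<le> t" by blast
    then consider "1 - u \<le> t'" "zero_on x 0 t'" | "1 \<le> t'" "zero_on x (t' - 1) t'" by (auto simp: T_def)
    then show "(1 - u \<le> t \<and> zero_on x 0 (1 - u)) \<or> unit_hold 0 t x"
    proof cases
      case 1
      then show ?thesis using t' by (auto simp: zero_on_def)
    next
      case 2
      then show ?thesis using t' by (auto simp: unit_hold_def intro!: bexI[of _ "t' - 1"])
    qed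
  next
    assume "(1 - u \<le> t \<and> zero_on x 0 (1 - u)) \<or> unit_hold 0 t x"
    then show "\<exists>t'\<in>T. t' \<le> t"
    proof
      assume "1 - u \<le> t \<and> zero_on x 0 (1 - u)"
      then show ?thesis using u by (intro bexI[of _ "1 - u"]) (auto simp: T_def)
    next
      assume "unit_hold 0 t x"
      then obtain a where "0 \<le> a" "a \<le> t - 1" "zero_on x a (a + 1)" by (auto simp: unit_hold_def)
      then show ?thesis by (intro bexI[of _ "a + 1"]) (auto simp: T_def)
    qed
  qed
  finally show ?thesis by (simp add: kT)
qed

text \<open>A unit stretch with start \<open>a < t - 1\<close> can be started a little later,
  because the path remains at 0 shortly after \<open>a + 1\<close>. Only the start
  \<open>t - 1\<close> leaves no room, and it is added to the rationals.\<close>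

lemma unit_hold_iff_rational:
  assumes x: "step_path x" and b: "0 \<le> b"
  shows "unit_hold b t x \<longleftrightarrow> (\<exists>a\<in>insert (t - 1) \<rat>. b \<le> a \<and> a \<le> t - 1 \<and> zero_on x a (a + 1))"
proof
  assume "unit_hold b t x"
  then obtain a where a: "b \<le> a" "a \<le> t - 1" "zero_on x a (a + 1)" by (auto simp: unit_hold_def)
  show "\<exists>a\<in>insert (t - 1) \<rat>. b \<le> a \<and> a \<le> t - 1 \<and> zero_on x a (a + 1)"
  proof (cases "a = t - 1")
    case False
    obtain d where d: "d > 0" "\<And>s. a + 1 \<le> s \<Longrightarrow> s < a + 1 + d \<Longrightarrow> x s = x (a + 1)"
      using step_path_right[OF x, of "a + 1"] a b by auto
    obtain r where r: "r \<in> \<rat>" "a < r" "r < min (t - 1) (a + d)"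
      using Rats_dense_in_real[of a "min (t - 1) (a + d)"] False a d by auto
    have "x s = 0" if "r \<le> s" "s \<le> r + 1" for s
      using d(2)[of s] a(3) that r by (cases "s \<le> a + 1") (auto simp: zero_on_def)
    then have "zero_on x r (r + 1)" by (auto simp: zero_on_def)
    then show ?thesis using r a by (intro bexI[of _ r]) auto
  qed (use a in blast)
next
  assume "\<exists>a\<in>insert (t - 1) \<rat>. b \<le> a \<and> a \<le> t - 1 \<and> zero_on x a (a + 1)"
  then show "unit_hold b t x"
    unfolding unit_hold_def by (metis atLeastAtMost_iff)
qed

lemma zero_on_shift: "zero_on (shift b x) a c \<longleftrightarrow> zero_on x (b + a) (b + c)"
proof
  assume *: "zero_on (shift b x) a c"
  show "zero_on x (b + a) (b + c)"
    unfolding zero_on_def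
  proof
    fix r assume "r \<in> {b + a..b + c}"
    then show "x r = 0" using zero_onD[OF *, of "r - b"] by (simp add: shift_def)
  qed
qed (auto simp: zero_on_def shift_def)

lemma unit_hold_shift: "unit_hold 0 (t - b) (shift b x) \<longleftrightarrow> unit_hold b t x"
proof
  assume "unit_hold 0 (t - b) (shift b x)"
  then obtain a where "0 \<le> a" "a \<le> t - b - 1" "zero_on x (b + a) (b + a + 1)"
    by (auto simp: unit_hold_def zero_on_shift add.assoc)
  then show "unit_hold b t x"
    unfolding unit_hold_def by (intro bexI[of _ "b + a"]) auto
next
  assume "unit_hold b t x"
  then obtain a where "b \<le> a" "a \<le> t - 1" "zero_on x a (a + 1)" by (auto simp: unit_hold_def)
  then show "unit_hold 0 (t - b) (shift b x)"
    unfolding unit_hold_def by (intro bexI[of _ "a - b"]) (auto simp: zero_on_shift)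
qed

text \<open>
  The exceptional time \<open>T + 1\<close> is where a unit holding time begun at \<open>T\<close> is completed.
\<close>

lemma unit_hold_start_from_right:
  assumes x: "step_path x" and T: "0 \<le> T" "t \<noteq> T + 1" and lim: "N \<longlonglongrightarrow> T" "\<And>n::nat. T \<le> N n"
  shows "eventually (\<lambda>n. unit_hold (N n) t x \<longleftrightarrow> unit_hold T t x) sequentially"
proof (cases "unit_hold T t x")
  case False
  then have "\<not> unit_hold (N n) t x" for n
    using lim(2)[of n] by (auto simp: unit_hold_def)
  then show ?thesis using False by simp
next
  case True
  then obtain a where a: "T \<le> a" "a \<le> t - 1" "zero_on x a (a + 1)" by (auto simp: unit_hold_def)
  \<comment> \<open>A stretch starting exactly at \<open>T\<close> is moved to a later start;
    \<open>t \<noteq> T + 1\<close> leaves room for this.\<close>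
  have "\<exists>a'>T. a' \<le> t - 1 \<and> zero_on x a' (a' + 1)"
  proof (cases "a = T")
    case True
    obtain d where d: "d > 0" "\<And>s. a + 1 \<le> s \<Longrightarrow> s < a + 1 + d \<Longrightarrow> x s = x (a + 1)"
      using step_path_right[OF x, of "a + 1"] a T by auto
    define a' where "a' = a + min (d / 2) (t - 1 - T)"
    have a': "a < a'" "a' < a + d" "a' \<le> t - 1" using d a T True by (auto simp: a'_def min_def)
    have "x s = 0" if "a' \<le> s" "s \<le> a' + 1" for s
      using d(2)[of s] a(3) that a' by (cases "s \<le> a + 1") (auto simp: zero_on_def)
    then show ?thesis using a' True by (intro exI[of _ a']) (auto simp: zero_on_def)
  qed (use a in \<open>auto intro!: exI[of _ a]\<close>)
  then obtain a' where a': "T < a'" "a' \<le> t - 1" "zero_on x a' (a' + 1)" by blast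
  have "eventually (\<lambda>n. N n < a') sequentially"
    using order_tendstoD(2)[OF lim(1) a'(1)] .
  then show ?thesis
    by eventually_elim (use a' True in \<open>auto simp: unit_hold_def intro!: bexI[of _ a']\<close>)
qed

section \<open>The Markov property on path space\<close>

definition step_paths :: "nat set \<Rightarrow> (real \<Rightarrow> nat) set" where
  "step_paths S = {x. (\<forall>t\<ge>0. x t \<in> S) \<and> step_path x}"

definition cyl :: "nat set \<Rightarrow> (real \<times> nat) set \<Rightarrow> (real \<Rightarrow> nat) set" where
  "cyl S L = {x \<in> step_paths S. \<forall>p\<in>L. x (fst p) = snd p}"

definition cyls :: "nat set \<Rightarrow> real set \<Rightarrow> (real \<Rightarrow> nat) set set" where
  "cyls S A = {cyl S L | L. finite L \<and> fst ` L \<subseteq> A}"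

text \<open>The full sigma-algebra and the past up to \<open>s\<close> live on the same set of
  complete paths. Being determined by time \<open>s\<close> is thus membership in a smaller family
  of sets, with no projection involved.\<close>

definition paths :: "nat set \<Rightarrow> real set \<Rightarrow> (real \<Rightarrow> nat) measure" where
  "paths S A = sigma (step_paths S) (cyls S A)"

abbreviation path_space :: "nat set \<Rightarrow> (real \<Rightarrow> nat) measure" where
  "path_space S \<equiv> paths S {0..}"

abbreviation past :: "nat set \<Rightarrow> real \<Rightarrow> (real \<Rightarrow> nat) measure" where
  "past S s \<equiv> paths S {0..s}"

lemma step_pathsD: "x \<in> step_paths S \<Longrightarrow> step_path x"
  by (simp add: step_paths_def)

lemma cyls_Pow: "cyls S A \<subseteq> Pow (step_paths S)"
  by (auto simp: cyls_def cyl_def)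

lemma Int_stable_cyls: "Int_stable (cyls S A)"
proof (rule Int_stableI)
  fix a b assume "a \<in> cyls S A" "b \<in> cyls S A"
  then obtain L M where "a = cyl S L" "b = cyl S M" "finite L" "finite M" "fst ` L \<subseteq> A" "fst ` M \<subseteq> A"
    by (auto simp: cyls_def)
  then show "a \<inter> b \<in> cyls S A"
    unfolding cyls_def by (intro CollectI exI[of _ "L \<union> M"]) (auto simp: cyl_def)
qed

lemma space_paths [simp]: "space (paths S A) = step_paths S"
  unfolding paths_def using cyls_Pow by (rule space_measure_of)

lemma sets_paths: "sets (paths S A) = sigma_sets (step_paths S) (cyls S A)"
  unfolding paths_def using cyls_Pow by (rule sets_measure_of)

lemma cyl_in_paths: "finite L \<Longrightarrow> fst ` L \<subseteq> A \<Longrightarrow> cyl S L \<in> sets (paths S A)"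
  unfolding sets_paths by (intro sigma_sets.Basic) (auto simp: cyls_def)

lemma sets_paths_mono: "A \<subseteq> B \<Longrightarrow> sets (paths S A) \<subseteq> sets (paths S B)"
  unfolding sets_paths by (rule sigma_sets_mono') (auto simp: cyls_def)

lemma measurable_coord:
  assumes "t \<in> A"
  shows "(\<lambda>x. x t) \<in> measurable (paths S A) (count_space UNIV)"
proof (subst measurable_count_space_eq2_countable, intro conjI ballI)
  fix j :: nat
  have "(\<lambda>x. x t) -` {j} \<inter> space (paths S A) = cyl S {(t, j)}"
    by (auto simp: cyl_def)
  then show "(\<lambda>x. x t) -` {j} \<inter> space (paths S A) \<in> sets (paths S A)"
    using assms by (auto intro: cyl_in_paths)
qed auto

lemma measurable_paths_I:
  assumes "\<And>\<omega>. \<omega> \<in> space M \<Longrightarrow> f \<omega> \<in> step_paths S"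
    and "\<And>t. t \<in> A \<Longrightarrow> (\<lambda>\<omega>. f \<omega> t) \<in> measurable M (count_space UNIV)"
  shows "f \<in> measurable M (paths S A)"
  unfolding paths_def
proof (rule measurable_measure_of[OF cyls_Pow])
  fix y assume "y \<in> cyls S A"
  then obtain L where L: "y = cyl S L" "finite L" "fst ` L \<subseteq> A" by (auto simp: cyls_def)
  have "f -` y \<inter> space M = {\<omega> \<in> space M. \<forall>p\<in>L. f \<omega> (fst p) = snd p}"
    using assms(1) by (auto simp: L cyl_def)
  also have "\<dots> \<in> sets M"
  proof (rule sets.sets_Collect_finite_All[OF _ L(2)])
    fix p assume "p \<in> L"
    then have [measurable]: "(\<lambda>\<omega>. f \<omega> (fst p)) \<in> measurable M (count_space UNIV)"
      using L by (intro assms(2)) auto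
    show "{\<omega> \<in> space M. f \<omega> (fst p) = snd p} \<in> sets M" by measurable
  qed
  finally show "f -` y \<inter> space M \<in> sets M" .
qed (use assms in auto)

lemma shift_in_step_paths: "x \<in> step_paths S \<Longrightarrow> 0 \<le> s \<Longrightarrow> shift s x \<in> step_paths S"
  using step_path_shift[of x s] by (auto simp: step_paths_def) (auto simp: shift_def)

lemma measurable_shift:
  assumes "0 \<le> s"
  shows "shift s \<in> measurable (path_space S) (path_space S)"
proof (rule measurable_paths_I)
  fix t :: real assume "t \<in> {0..}"
  then show "(\<lambda>x. shift s x t) \<in> measurable (path_space S) (count_space UNIV)"
    unfolding shift_def using assms by (intro measurable_coord) auto
qed (use assms shift_in_step_paths in auto)

lemma coord_event:
  assumes "t \<in> A"
  shows "{x \<in> step_paths S. R (x t)} \<in> sets (paths S A)"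
proof -
  have [measurable]: "(\<lambda>x. x t) \<in> measurable (paths S A) (count_space UNIV)"
    using assms by (rule measurable_coord)
  have "{x \<in> space (paths S A). R (x t)} \<in> sets (paths S A)" by measurable
  then show ?thesis by simp
qed

lemma zero_on_event:
  assumes "0 \<le> a" "{a..b} \<subseteq> A"
  shows "{x \<in> step_paths S. zero_on x a b} \<in> sets (paths S A)"
proof (cases "a \<le> b")
  case True
  have "{x \<in> step_paths S. zero_on x a b} = {x \<in> step_paths S. x a = 0} \<inter> {x \<in> step_paths S. x b = 0} \<inter>
      {x \<in> space (paths S A). \<forall>r\<in>\<rat> \<inter> {a..b}. x r = 0}"
    using zero_on_iff_rational[OF step_pathsD assms(1) True] by auto
  also have "\<dots> \<in> sets (paths S A)"
  proof (intro sets.Int coord_event sets.sets_Collect_countable_All')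
    fix r assume "r \<in> \<rat> \<inter> {a..b}"
    then show "{x \<in> space (paths S A). x r = 0} \<in> sets (paths S A)"
      using assms coord_event[of r A S "\<lambda>j. j = 0"] by auto
  qed (use assms True countable_rat in auto)
  finally show ?thesis .
next
  case False
  then have "{x \<in> step_paths S. zero_on x a b} = space (paths S A)"
    by (auto simp: zero_on_def)
  then show ?thesis by (metis sets.top)
qed

lemma unit_hold_event:
  assumes "0 \<le> b"
  shows "{x \<in> step_paths S. unit_hold b t x} \<in> sets (path_space S)"
proof -
  have "{x \<in> step_paths S. unit_hold b t x} =
      (\<Union>a\<in>insert (t - 1) \<rat> \<inter> {b..t - 1}. {x \<in> step_paths S. zero_on x a (a + 1)})"
    using unit_hold_iff_rational[OF step_pathsD assms] by auto
  also have "\<dots> \<in> sets (path_space S)"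
  proof (intro sets.countable_UN'')
    fix a assume "a \<in> insert (t - 1) \<rat> \<inter> {b..t - 1}"
    then have "0 \<le> a" using assms by auto
    then show "{x \<in> step_paths S. zero_on x a (a + 1)} \<in> sets (path_space S)"
      by (intro zero_on_event) auto
  qed (use countable_rat in auto)
  finally show ?thesis .
qed

text \<open>Because the inequality is strict, coordinates before \<open>c\<close> decide the event.
  This is the stopping property that the strong Markov property asks for.\<close>

lemma hit_time_event:
  assumes "{0..<c} \<subseteq> A"
  shows "{x \<in> step_paths S. hit_time x < ereal c} \<in> sets (paths S A)"
proof -
  have "{x \<in> step_paths S. hit_time x < ereal c} =
      (\<Union>r\<in>\<rat> \<inter> {0..<c}. {x \<in> step_paths S. x r = 0})"
    by (auto simp: hit_time_less_iff[OF step_pathsD, of _ S c] Bex_def)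
  also have "\<dots> \<in> sets (paths S A)"
    using assms countable_rat
    by (intro sets.countable_UN'' coord_event) (auto simp: subset_iff)
  finally show ?thesis .
qed

lemma hold_time_event:
  assumes "{0..<c} \<subseteq> A"
  shows "{x \<in> step_paths S. hold_time x < ereal c} \<in> sets (paths S A)"
proof -
  have "{x \<in> step_paths S. hold_time x < ereal c} =
      (\<Union>r\<in>\<rat> \<inter> {0..<c}. {x \<in> step_paths S. x r \<noteq> 0})"
    by (auto simp: hold_time_less_iff[OF step_pathsD, of _ S c] Bex_def)
  also have "\<dots> \<in> sets (paths S A)"
    using assms countable_rat
    by (intro sets.countable_UN'' coord_event) (auto simp: subset_iff)
  finally show ?thesis .
qed

lemma return_time_event:
  assumes "{0..<c} \<subseteq> A"
  shows "{x \<in> step_paths S. return_time x < ereal c} \<in> sets (paths S A)"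
proof -
  have "{x \<in> step_paths S. return_time x < ereal c} =
      (\<Union>r\<in>\<rat> \<inter> {0..<c}. \<Union>r'\<in>\<rat> \<inter> {r<..<c}. {x \<in> step_paths S. x r \<noteq> 0} \<inter> {x \<in> step_paths S. x r' = 0})"
  proof (intro set_eqI iffI)
    fix x assume "x \<in> {x \<in> step_paths S. return_time x < ereal c}"
    then show "x \<in> (\<Union>r\<in>\<rat> \<inter> {0..<c}. \<Union>r'\<in>\<rat> \<inter> {r<..<c}.
        {x \<in> step_paths S. x r \<noteq> 0} \<inter> {x \<in> step_paths S. x r' = 0})"
      using return_time_less_iff[OF step_pathsD, of x S c] by fastforce
  next
    fix x assume "x \<in> (\<Union>r\<in>\<rat> \<inter> {0..<c}. \<Union>r'\<in>\<rat> \<inter> {r<..<c}.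
        {x \<in> step_paths S. x r \<noteq> 0} \<inter> {x \<in> step_paths S. x r' = 0})"
    then show "x \<in> {x \<in> step_paths S. return_time x < ereal c}"
      using return_time_less_iff[OF step_pathsD, of x S c] by fastforce
  qed
  also have "\<dots> \<in> sets (paths S A)"
  proof (intro sets.countable_UN'')
    fix r r' assume "r \<in> \<rat> \<inter> {0..<c}" "r' \<in> \<rat> \<inter> {r<..<c}"
    then have "r \<in> A" "r' \<in> A" using assms by auto
    then show "{x \<in> step_paths S. x r \<noteq> 0} \<inter> {x \<in> step_paths S. x r' = 0} \<in> sets (paths S A)"
      by (intro sets.Int coord_event)
  qed (use countable_rat in auto)
  finally show ?thesis .
qed

lemma measurable_ereal_less:
  fixes f :: "'a \<Rightarrow> ereal"
  assumes "\<And>c. {x \<in> space M. f x < ereal c} \<in> sets M"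
  shows "f \<in> borel_measurable M"
proof -
  have "f -` {..<a} \<inter> space M \<in> sets M" for a
  proof (cases a)
    case (real c)
    have "f -` {..<a} \<inter> space M = {x \<in> space M. f x < ereal c}" by (auto simp: real)
    then show ?thesis using assms by simp
  next
    case PInf
    have "f x < \<infinity> \<longleftrightarrow> (\<exists>n. f x < ereal (real n))" for x
      by (simp add: less_PInf_Ex_of_nat[symmetric])
    then have "f -` {..<a} \<inter> space M = (\<Union>n. {x \<in> space M. f x < ereal (real n)})"
      by (auto simp: PInf)
    then show ?thesis using assms by auto
  next
    case MInf
    then have "f -` {..<a} \<inter> space M = {}" by auto
    then show ?thesis by simp
  qed
  then show ?thesis by (simp add: borel_measurable_ereal_iff_Iio)
qed

lemma hit_time_measurable: "hit_time \<in> borel_measurable (path_space S)"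
  by (rule measurable_ereal_less) (auto intro!: hit_time_event)

lemma hold_time_measurable: "hold_time \<in> borel_measurable (path_space S)"
  by (rule measurable_ereal_less) (auto intro!: hold_time_event)

lemma return_time_measurable: "return_time \<in> borel_measurable (path_space S)"
  by (rule measurable_ereal_less) (auto intro!: return_time_event)

text \<open>Both sides are finite and additive in \<open>A\<close>, and they agree on the whole
  space and on an intersection-stable generator. For the Markov property \<open>f\<close> is once
  the shift, to reach general future events, and once the identity, to reach general past
  events.\<close>

lemma Dynkin_product:
  assumes "finite_measure M" "finite_measure N" "Int_stable G" "G \<subseteq> Pow \<Omega>"
    and f: "f \<in> space M \<rightarrow> \<Omega>" "\<And>A. A \<in> sigma_sets \<Omega> G \<Longrightarrow> f -` A \<inter> space M \<in> sets M"
    and sub: "sigma_sets \<Omega> G \<subseteq> sets N" and T: "T \<in> sets M" and U: "U \<in> sets N" "U \<subseteq> \<Omega>"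
    and whole: "measure M T = c * measure N U"
    and basic: "\<And>A. A \<in> G \<Longrightarrow> measure M (T \<inter> (f -` A \<inter> space M)) = c * measure N (U \<inter> A)"
    and A: "A \<in> sigma_sets \<Omega> G"
  shows "measure M (T \<inter> (f -` A \<inter> space M)) = c * measure N (U \<inter> A)"
  using assms(3,4) A
proof (induction rule: sigma_sets_induct_disjoint)
  case (compl A)
  interpret M: finite_measure M by fact
  interpret N: finite_measure N by fact
  have [simp]: "T \<subseteq> space M" using T by (rule sets.sets_into_space)
  have "T \<inter> (f -` (\<Omega> - A) \<inter> space M) = T - (T \<inter> (f -` A \<inter> space M))"
    using f(1) \<open>T \<subseteq> space M\<close> by (auto simp: Pi_iff subset_iff)
  then have "measure M (T \<inter> (f -` (\<Omega> - A) \<inter> space M)) = measure M T - measure M (T \<inter> (f -` A \<inter> space M))"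
    using M.finite_measure_Diff[OF T, of "T \<inter> (f -` A \<inter> space M)"] f(2)[OF compl(1)] T by auto
  moreover have "U \<inter> (\<Omega> - A) = U - (U \<inter> A)" using U by auto
  then have "measure N (U \<inter> (\<Omega> - A)) = measure N U - measure N (U \<inter> A)"
    using N.finite_measure_Diff[OF U(1), of "U \<inter> A"] compl(1) sub U by auto
  ultimately show ?case by (simp add: compl whole right_diff_distrib)
next
  case (union A)
  interpret M: finite_measure M by fact
  interpret N: finite_measure N by fact
  have Ai: "A i \<in> sigma_sets \<Omega> G" "A i \<in> sets N" for i using union(2) sub by auto
  have 1: "(\<lambda>i. measure M (T \<inter> (f -` A i \<inter> space M))) sums measure M (\<Union>i. T \<inter> (f -` A i \<inter> space M))"
    using union(1) f(2)[OF Ai(1)] T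
    by (intro M.finite_measure_UNION) (auto simp: disjoint_family_on_def)
  have 2: "(\<lambda>i. measure N (U \<inter> A i)) sums measure N (\<Union>i. U \<inter> A i)"
    using union(1) Ai(2) U
    by (intro N.finite_measure_UNION) (auto simp: disjoint_family_on_def)
  have "measure M (\<Union>i. T \<inter> (f -` A i \<inter> space M)) = c * measure N (\<Union>i. U \<inter> A i)"
    using sums_unique2[OF 1[unfolded union(3)] sums_mult[OF 2, of c]] .
  moreover have "(\<Union>i. T \<inter> (f -` A i \<inter> space M)) = T \<inter> (f -` (\<Union>i. A i) \<inter> space M)"
    "(\<Union>i. U \<inter> A i) = U \<inter> (\<Union>i. A i)" by auto
  ultimately show ?case by simp
qed (use basic in auto)

section \<open>The Markov property at fixed times for general past and future events\<close>

locale path_chain =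
  fixes S :: "nat set" and Q :: "nat \<Rightarrow> (real \<Rightarrow> nat) measure"
  assumes zero_state: "0 \<in> S"
    and prob: "\<And>i. i \<in> S \<Longrightarrow> prob_space (Q i)"
    and sets_Q: "\<And>i. i \<in> S \<Longrightarrow> sets (Q i) = sets (path_space S)"
    and start: "\<And>i. i \<in> S \<Longrightarrow> AE x in Q i. x 0 = i"
    and markov_cyl: "\<And>i j l s h L. i \<in> S \<Longrightarrow> l \<in> S \<Longrightarrow> finite L \<Longrightarrow> fst ` L \<subseteq> {0..s} \<Longrightarrow> (s, j) \<in> L \<Longrightarrow> 0 \<le> h \<Longrightarrow>
      measure (Q i) (cyl S (insert (s + h, l) L)) = measure (Q i) (cyl S L) * measure (Q j) (cyl S {(h, l)})"
begin

lemma space_Q: "i \<in> S \<Longrightarrow> space (Q i) = step_paths S"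
  using sets_eq_imp_space_eq[OF sets_Q] by simp

lemma finite_Q: "i \<in> S \<Longrightarrow> finite_measure (Q i)"
  using prob prob_space.finite_measure by blast

lemma measurable_Q: "i \<in> S \<Longrightarrow> measurable (Q i) N = measurable (path_space S) N"
  by (rule measurable_cong_sets[OF sets_Q refl])

lemma past_sub: "i \<in> S \<Longrightarrow> sets (past S s) \<subseteq> sets (Q i)"
  unfolding sets_Q by (rule sets_paths_mono) auto

lemma event_Q: "i \<in> S \<Longrightarrow> A \<in> sets (path_space S) \<Longrightarrow> A \<in> sets (Q i)"
  using sets_Q by simp

text \<open>Induction over the future constraints in increasing order of time: the latest one is
  split off by \<open>markov_cyl\<close> under \<open>Q i\<close> and under \<open>Q j\<close>, with
  the same one-step factor.\<close>

lemma markov_cyl_future: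
  assumes i: "i \<in> S" and j: "j \<in> S" and L: "finite L" "fst ` L \<subseteq> {0..s}" "(s, j) \<in> L"
    and M: "finite M" "fst ` M \<subseteq> {0..}"
  shows "measure (Q i) (cyl S (L \<union> (\<lambda>p. (s + fst p, snd p)) ` M)) = measure (Q i) (cyl S L) * measure (Q j) (cyl S M)"
  using M
proof (induction M rule: finite_ranking_induct[where f = fst])
  case empty
  interpret prob_space "Q j" by (rule prob[OF j])
  have "measure (Q j) (cyl S {}) = 1"
    using prob_space space_Q[OF j] by (simp add: cyl_def)
  then show ?case by simp
next
  case (insert p M)
  obtain r l where p: "p = (r, l)" by force
  let ?sh = "\<lambda>p::real \<times> nat. (s + fst p, snd p)"
  have r: "0 \<le> r" and M: "fst ` M \<subseteq> {0..}" using insert.prems p by auto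
  have s0: "0 \<le> s" using L by auto
  note IH = insert.IH[OF M]
  show ?case
  proof (cases "l \<in> S")
    case False
    have e: "cyl S K = {}" if "(r', l) \<in> K" "0 \<le> r'" for r' K
      using that False by (fastforce simp: cyl_def step_paths_def)
    have "cyl S (insert p M) = {}" using p r by (intro e[of r]) auto
    moreover have "cyl S (L \<union> ?sh ` insert p M) = {}"
      using p r s0 by (intro e[of "s + r"]) auto
    ultimately show ?thesis by simp
  next
    case l: True
    show ?thesis
    proof (cases "M = {}")
      case True
      then show ?thesis using markov_cyl[OF i l L r] by (simp add: p)
    next
      case False
      \<comment> \<open>\<open>q\<close> is a latest one of the earlier constraints. Its state is
        where the final step starts, both in the original and in the shifted time scale.\<close>
      obtain q where q: "q \<in> M" "\<And>y. y \<in> M \<Longrightarrow> fst y \<le> fst q"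
      proof -
        have "finite (fst ` M)" "fst ` M \<noteq> {}" using insert.hyps False by auto
        from Max_in[OF this] obtain q where "q \<in> M" "fst q = Max (fst ` M)" by auto
        then show ?thesis using that[of q] \<open>finite (fst ` M)\<close> by auto
      qed
      obtain m k where mk: "q = (m, k)" by force
      have m: "0 \<le> m" using q M mk by force
      have mr: "m \<le> r" using insert.hyps(2)[OF q(1)] mk p by simp
      have Mm: "fst ` M \<subseteq> {0..m}" using q(2) M mk by auto
      have "measure (Q j) (cyl S (insert (m + (r - m), l) M)) =
          measure (Q j) (cyl S M) * measure (Q k) (cyl S {(r - m, l)})"
        using q mk mr by (intro markov_cyl j l insert.hyps Mm) auto
      moreover have "measure (Q i) (cyl S (insert ((s + m) + (r - m), l) (L \<union> ?sh ` M))) =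
          measure (Q i) (cyl S (L \<union> ?sh ` M)) * measure (Q k) (cyl S {(r - m, l)})"
      proof (rule markov_cyl[OF i l])
        show "finite (L \<union> ?sh ` M)" using L insert.hyps by simp
        show "fst ` (L \<union> ?sh ` M) \<subseteq> {0..s + m}" using L Mm m s0 by force
        show "(s + m, k) \<in> L \<union> ?sh ` M" using q mk by force
      qed (use mr in simp)
      ultimately show ?thesis by (simp add: p IH mult.assoc)
    qed
  qed
qed

text \<open>Two monotone class arguments: with a cylinder past containing \<open>(s, j)\<close> the
  future is extended to all events, then with that future fixed the past is extended. Adding
  \<open>(s, j)\<close> to a past cylinder brings it into the form covered by the first
  step.\<close>

theorem markov:
  assumes i: "i \<in> S" and j: "j \<in> S" and s: "0 \<le> s" and E: "E \<in> sets (past S s)" and G: "G \<in> sets (path_space S)"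
  shows "measure (Q i) ((E \<inter> {x \<in> step_paths S. x s = j}) \<inter> {x \<in> step_paths S. shift s x \<in> G}) =
    measure (Q i) (E \<inter> {x \<in> step_paths S. x s = j}) * measure (Q j) G"
proof -
  interpret j: prob_space "Q j" by (rule prob[OF j])
  have sh: "shift s -` A \<inter> step_paths S \<in> sets (path_space S)" if "A \<in> sets (path_space S)" for A
    using measurable_sets[OF measurable_shift[OF s] that] by simp
  have top: "step_paths S \<in> sets (path_space S)" using sets.top[of "path_space S"] by simp
  have future: "measure (Q i) (cyl S L \<inter> (shift s -` G \<inter> space (Q i))) = measure (Q i) (cyl S L) * measure (Q j) (step_paths S \<inter> G)"
    if L: "finite L" "fst ` L \<subseteq> {0..s}" "(s, j) \<in> L" for L
  proof (rule Dynkin_product[where \<Omega> = "step_paths S" and G = "cyls S {0..}"])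
    show "measure (Q i) (cyl S L) = measure (Q i) (cyl S L) * measure (Q j) (step_paths S)"
      using j.prob_space space_Q[OF j] by simp
    show "cyl S L \<in> sets (Q i)"
      using L past_sub[OF i] cyl_in_paths[of L "{0..s}" S] by auto
    show "G \<in> sigma_sets (step_paths S) (cyls S {0..})" using G by (simp add: sets_paths)
    fix A assume "A \<in> cyls S {0..}"
    then obtain M where M: "A = cyl S M" "finite M" "fst ` M \<subseteq> {0..}" by (auto simp: cyls_def)
    have "cyl S L \<inter> (shift s -` A \<inter> space (Q i)) = cyl S (L \<union> (\<lambda>p. (s + fst p, snd p)) ` M)"
      using shift_in_step_paths[OF _ s] by (auto simp: M cyl_def space_Q[OF i] ball_Un shift_def)
    moreover have "step_paths S \<inter> A = cyl S M" by (auto simp: M cyl_def)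
    ultimately show "measure (Q i) (cyl S L \<inter> (shift s -` A \<inter> space (Q i))) = measure (Q i) (cyl S L) * measure (Q j) (step_paths S \<inter> A)"
      using markov_cyl_future[OF i j L M(2,3)] by simp
  qed (use finite_Q i j shift_in_step_paths s sh top sets_Q cyls_Pow Int_stable_cyls in \<open>auto simp: space_Q sets_paths[symmetric]\<close>)
  define T where "T = {x \<in> step_paths S. x s = j} \<inter> (shift s -` G \<inter> step_paths S)"
  have js: "{x \<in> step_paths S. x s = j} \<in> sets (path_space S)" using s by (intro coord_event) auto
  have T: "T \<in> sets (path_space S)" unfolding T_def by (intro sets.Int js sh G)
  have G': "step_paths S \<inter> G = G" using sets.sets_into_space[OF G] by auto
  have past: "measure (Q i) (T \<inter> ((\<lambda>x. x) -` A \<inter> space (Q i))) = measure (Q j) G * measure (Q i) ({x \<in> step_paths S. x s = j} \<inter> A)"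
    if "A = cyl S L" "finite L" "fst ` L \<subseteq> {0..s}" for A L
  proof -
    have "T \<inter> ((\<lambda>x. x) -` A \<inter> space (Q i)) = cyl S (insert (s, j) L) \<inter> (shift s -` G \<inter> space (Q i))"
      "{x \<in> step_paths S. x s = j} \<inter> A = cyl S (insert (s, j) L)"
      by (auto simp: T_def that cyl_def space_Q[OF i])
    then show ?thesis using future[of "insert (s, j) L"] that s by (simp add: G')
  qed
  have "measure (Q i) (T \<inter> ((\<lambda>x. x) -` E \<inter> space (Q i))) = measure (Q j) G * measure (Q i) ({x \<in> step_paths S. x s = j} \<inter> E)"
  proof (rule Dynkin_product[where \<Omega> = "step_paths S" and G = "cyls S {0..s}"])
    show "measure (Q i) T = measure (Q j) G * measure (Q i) {x \<in> step_paths S. x s = j}"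
      using past[of "cyl S {}" "{}"] by (simp add: T_def cyl_def space_Q[OF i] Int_assoc Int_absorb2)
    show "E \<in> sigma_sets (step_paths S) (cyls S {0..s})" using E by (simp add: sets_paths)
    fix A assume "A \<in> cyls S {0..s}"
    then show "measure (Q i) (T \<inter> ((\<lambda>x. x) -` A \<inter> space (Q i))) = measure (Q j) G * measure (Q i) ({x \<in> step_paths S. x s = j} \<inter> A)"
      using past by (auto simp: cyls_def)
  next
    fix A assume "A \<in> sigma_sets (step_paths S) (cyls S {0..s})"
    then have "A \<in> sets (past S s)" by (simp add: sets_paths)
    then have "A \<in> sets (Q i)" using past_sub[OF i] by auto
    then show "(\<lambda>x. x) -` A \<inter> space (Q i) \<in> sets (Q i)" by auto
  next
    show "sigma_sets (step_paths S) (cyls S {0..s}) \<subseteq> sets (Q i)"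
      using past_sub[OF i] by (simp add: sets_paths)
  qed (use finite_Q i T js sets_Q cyls_Pow Int_stable_cyls in \<open>auto simp: space_Q\<close>)
  moreover have "T \<inter> ((\<lambda>x. x) -` E \<inter> space (Q i)) = (E \<inter> {x \<in> step_paths S. x s = j}) \<inter> {x \<in> step_paths S. shift s x \<in> G}"
    by (auto simp: T_def space_Q[OF i])
  ultimately show ?thesis by (simp add: Int_commute mult.commute)
qed

text \<open>On the event \<open>B\<close>, the shifted path has as image law the probability of
  \<open>B\<close> times \<open>Q j\<close>. Equality of these measures carries
  \<open>markov\<close> from events to nonnegative functions.\<close>

lemma markov_nn_integral:
  assumes i: "i \<in> S" and j: "j \<in> S" and s: "0 \<le> s" and E: "E \<in> sets (past S s)"
    and h: "h \<in> borel_measurable (path_space S)"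
  shows "(\<integral>\<^sup>+x. indicator (E \<inter> {x \<in> step_paths S. x s = j}) x * h (shift s x) \<partial>Q i) =
    emeasure (Q i) (E \<inter> {x \<in> step_paths S. x s = j}) * (\<integral>\<^sup>+x. h x \<partial>Q j)"
proof -
  interpret I: prob_space "Q i" by (rule prob[OF i])
  interpret J: prob_space "Q j" by (rule prob[OF j])
  define B where "B = E \<inter> {x \<in> step_paths S. x s = j}"
  have B: "B \<in> sets (Q i)"
    unfolding B_def
  proof (rule sets.Int)
    show "E \<in> sets (Q i)" using E past_sub[OF i] by blast
    show "{x \<in> step_paths S. x s = j} \<in> sets (Q i)" using s by (intro event_Q[OF i] coord_event) auto
  qed
  have sh: "shift s \<in> measurable (Q i) (path_space S)"
    unfolding measurable_Q[OF i] by (rule measurable_shift[OF s])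
  have eq: "distr (density (Q i) (indicator B)) (path_space S) (shift s) = scale_measure (emeasure (Q i) B) (Q j)"
  proof (rule measure_eqI)
    fix A assume "A \<in> sets (distr (density (Q i) (indicator B)) (path_space S) (shift s))"
    then have A: "A \<in> sets (path_space S)" by simp
    have pre: "shift s -` A \<inter> space (Q i) \<in> sets (Q i)" using sh A by (rule measurable_sets)
    have "emeasure (distr (density (Q i) (indicator B)) (path_space S) (shift s)) A =
        emeasure (Q i) (B \<inter> (shift s -` A \<inter> space (Q i)))"
    proof -
      have "emeasure (distr (density (Q i) (indicator B)) (path_space S) (shift s)) A =
          emeasure (density (Q i) (indicator B)) (shift s -` A \<inter> space (Q i))"
        using sh A by (subst emeasure_distr) auto
      also have "\<dots> = (\<integral>\<^sup>+x. indicator (B \<inter> (shift s -` A \<inter> space (Q i))) x \<partial>Q i)"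
        unfolding indicator_inter_arith[of B] using pre B by (intro emeasure_density) auto
      also have "\<dots> = emeasure (Q i) (B \<inter> (shift s -` A \<inter> space (Q i)))"
        using sets.Int[OF B pre] by (rule nn_integral_indicator)
      finally show ?thesis .
    qed
    also have "B \<inter> (shift s -` A \<inter> space (Q i)) = B \<inter> {x \<in> step_paths S. shift s x \<in> A}"
      by (auto simp: space_Q[OF i])
    also have "emeasure (Q i) \<dots> = emeasure (Q i) B * emeasure (Q j) A"
      using markov[OF i j s E A]
      by (simp add: B_def[symmetric] I.emeasure_eq_measure J.emeasure_eq_measure ennreal_mult')
    finally show "emeasure (distr (density (Q i) (indicator B)) (path_space S) (shift s)) A =
        emeasure (scale_measure (emeasure (Q i) B) (Q j)) A" by simp
  qed (simp add: sets_Q[OF j])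
  have hs: "(\<lambda>x. h (shift s x)) \<in> borel_measurable (Q i)" using sh h by (rule measurable_compose)
  have "(\<integral>\<^sup>+x. indicator B x * h (shift s x) \<partial>Q i) = (\<integral>\<^sup>+x. h (shift s x) \<partial>density (Q i) (indicator B))"
    using B hs by (subst nn_integral_density) auto
  also have "\<dots> = (\<integral>\<^sup>+x. h x \<partial>distr (density (Q i) (indicator B)) (path_space S) (shift s))"
    using sh h by (subst nn_integral_distr) auto
  also have "\<dots> = emeasure (Q i) B * (\<integral>\<^sup>+x. h x \<partial>Q j)"
    unfolding eq using h by (intro nn_integral_scale_measure) (simp add: measurable_Q[OF j])
  finally show ?thesis by (simp add: B_def)
qed

end

section \<open>Holding times and the strong Markov property\<close>

lemma return_time_eqI:
  assumes "0 \<le> h" "h < w" "x h \<noteq> 0" "x w = 0"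
    and "\<And>t. 0 \<le> t \<Longrightarrow> t < h \<Longrightarrow> x t = 0" "\<And>t. h \<le> t \<Longrightarrow> t < w \<Longrightarrow> x t \<noteq> 0"
  shows "hold_time x = ereal h" "return_time x = ereal w"
proof -
  show h: "hold_time x = ereal h"
    unfolding hold_time_def
  proof (rule antisym)
    show "Inf {ereal t | t. 0 \<le> t \<and> x t \<noteq> 0} \<le> ereal h" using assms by (intro Inf_lower) auto
    have "h \<le> t" if "0 \<le> t" "x t \<noteq> 0" for t using assms(5)[of t] that by (cases "t < h") auto
    then show "ereal h \<le> Inf {ereal t | t. 0 \<le> t \<and> x t \<noteq> 0}" by (intro Inf_greatest) auto
  qed
  show "return_time x = ereal w"
    unfolding return_time_def h
  proof (rule antisym)
    show "Inf {ereal t | t. ereal h \<le> ereal t \<and> x t = 0} \<le> ereal w" using assms by (intro Inf_lower) auto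
    have "w \<le> t" if "h \<le> t" "x t = 0" for t using assms(6)[of t] that by (cases "t < w") auto
    then show "ereal w \<le> Inf {ereal t | t. ereal h \<le> ereal t \<and> x t = 0}" by (intro Inf_greatest) auto
  qed
qed

lemma return_time_shift:
  assumes x: "step_path x" and c: "0 \<le> c" "zero_on x 0 c" and w: "return_time x = ereal w"
  shows "c < w" "return_time (shift c x) = ereal (w - c)"
proof -
  obtain h where h: "0 \<le> h" "h < w" "x h \<noteq> 0" "x w = 0"
    "\<And>t. 0 \<le> t \<Longrightarrow> t < h \<Longrightarrow> x t = 0" "\<And>t. h \<le> t \<Longrightarrow> t < w \<Longrightarrow> x t \<noteq> 0"
    by (rule return_time_attained[OF x w]) (rule that)
  have ch: "c < h" using h(1,3) zero_onD[OF c(2), of h] by (cases "c < h") auto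
  then show "c < w" using h by simp
  show "return_time (shift c x) = ereal (w - c)"
    using h c ch by (intro return_time_eqI(2)[of "h - c"]) (auto simp: shift_def)
qed

lemma return_time_before_shift:
  assumes x: "step_path x" and s: "0 \<le> r" "r \<le> s" "x r \<noteq> 0" "x s \<noteq> 0"
    and nr: "\<not> return_time x < ereal s" and w: "return_time x = ereal w"
  shows "hit_time (shift s x) = ereal (w - s)" "s < w"
proof -
  obtain h where h: "0 \<le> h" "h < w" "x h \<noteq> 0" "x w = 0"
    "\<And>t. 0 \<le> t \<Longrightarrow> t < h \<Longrightarrow> x t = 0" "\<And>t. h \<le> t \<Longrightarrow> t < w \<Longrightarrow> x t \<noteq> 0"
    by (rule return_time_attained[OF x w]) (rule that)
  have hr: "h \<le> r" using h(5)[of r] s by (cases "r < h") auto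
  show sw: "s < w" using nr w h(4) s(4) by (cases "s = w") auto
  show "hit_time (shift s x) = ereal (w - s)"
    unfolding hit_time_def
  proof (rule antisym)
    show "Inf {ereal t | t. 0 \<le> t \<and> shift s x t = 0} \<le> ereal (w - s)"
      using h sw by (intro Inf_lower) (auto simp: shift_def)
    show "ereal (w - s) \<le> Inf {ereal t | t. 0 \<le> t \<and> shift s x t = 0}"
    proof (intro Inf_greatest, clarify)
      fix t :: real assume "0 \<le> t" "shift s x t = 0"
      then show "ereal (w - s) \<le> ereal t" using h(6)[of "s + t"] hr s by (cases "s + t < w") (auto simp: shift_def)
    qed
  qed
qed

text \<open>A unit stretch starting no later than the departure time \<open>h\<close> would contain
  \<open>h\<close>, because \<open>h \<le> c \<le> 1\<close>; one starting between \<open>h\<close>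
  and \<open>w\<close> would start away from 0. So every unit stretch starts at \<open>w\<close> or
  later.\<close>

lemma unit_hold_after_return:
  assumes x: "step_path x" and c: "c \<le> 1" "\<not> zero_on x 0 c" and w: "return_time x = ereal w"
  shows "unit_hold w t x \<longleftrightarrow> unit_hold 0 t x"
proof -
  obtain h where h: "0 \<le> h" "h < w" "x h \<noteq> 0" "x w = 0"
    "\<And>t. 0 \<le> t \<Longrightarrow> t < h \<Longrightarrow> x t = 0" "\<And>t. h \<le> t \<Longrightarrow> t < w \<Longrightarrow> x t \<noteq> 0"
    by (rule return_time_attained[OF x w]) (rule that)
  have "h \<le> c"
  proof (rule ccontr)
    assume "\<not> h \<le> c"
    then have "zero_on x 0 c" using h(5) by (auto simp: zero_on_def)
    then show False using c by simp
  qed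
  have "w \<le> a" if "0 \<le> a" "zero_on x a (a + 1)" for a
  proof (rule ccontr)
    assume "\<not> w \<le> a"
    moreover have "h < a" using zero_onD[OF that(2), of h] h(3) that \<open>h \<le> c\<close> c(1) by (cases "h < a") auto
    ultimately show False using h(6)[of a] zero_onD[OF that(2), of a] by auto
  qed
  then show ?thesis using h by (fastforce simp: unit_hold_def)
qed

lemma unit_hold_after_hit:
  assumes x: "step_path x" and w: "hit_time x = ereal w"
  shows "unit_hold w t x \<longleftrightarrow> unit_hold 0 t x"
proof -
  note h = hit_time_attained[OF x w]
  have "w \<le> a" if "0 \<le> a" "zero_on x a (a + 1)" for a
    using h(3)[of a] zero_onD[OF that(2), of a] that by (cases "w \<le> a") auto
  then show ?thesis using h(1) by (fastforce simp: unit_hold_def)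
qed

text \<open>A nonzero state persists on an interval to the right, and a fine enough grid meets that
  interval. The exception is the end \<open>t\<close>, which is itself a grid point.\<close>

lemma grid_zero_iff:
  assumes x: "step_path x" and t: "0 \<le> t"
  shows "eventually (\<lambda>n. (\<forall>k\<le>Suc n. x (t * real k / real (Suc n)) = 0) \<longleftrightarrow> zero_on x 0 t) sequentially"
proof (cases "zero_on x 0 t")
  case True
  have "x (t * real k / real (Suc n)) = 0" if "k \<le> Suc n" for k n
  proof (rule zero_onD[OF True])
    have "t * real k \<le> t * real (Suc n)" using that t by (intro mult_left_mono) auto
    then show "t * real k / real (Suc n) \<le> t" by (simp add: divide_le_eq)
  qed (use t in simp)
  then show ?thesis using True by simp
next
  case False
  then obtain r where r: "0 \<le> r" "r \<le> t" "x r \<noteq> 0" by (auto simp: zero_on_def)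
  have "eventually (\<lambda>n. \<exists>k\<le>Suc n. x (t * real k / real (Suc n)) \<noteq> 0) sequentially"
  proof (cases "r = t")
    case True
    then have "x (t * real (Suc n) / real (Suc n)) \<noteq> 0" for n using r by simp
    then show ?thesis by (intro always_eventually allI) blast
  next
    case False
    then have t0: "0 < t" using r by simp
    obtain d where d: "d > 0" "\<And>s. r \<le> s \<Longrightarrow> s < r + d \<Longrightarrow> x s = x r"
      using step_path_right[OF x r(1)] by blast
    define e where "e = min d (t - r)"
    have e: "e > 0" using d(1) False r by (simp add: e_def)
    obtain m :: nat where m: "t / e < real m" using reals_Archimedean2 by blast
    show ?thesis
    proof (rule eventually_sequentiallyI[of m])
      fix n assume "m \<le> n"
      define N where "N = real (Suc n)"
      have N: "N > 0" "t / e < N" using m \<open>m \<le> n\<close> by (auto simp: N_def)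
      define k where "k = nat \<lceil>r * N / t\<rceil>"
      have "0 \<le> r * N / t" using r t0 N by simp
      then have k: "r * N / t \<le> real k" "real k < r * N / t + 1"
        unfolding k_def by linarith+
      have 1: "r \<le> t * real k / N"
        using k(1) t0 N by (simp add: field_simps)
      have "t * real k < r * N + t"
        using k(2) t0 by (simp add: field_simps)
      then have "t * real k / N < r + t / N"
        using N by (simp add: field_simps)
      moreover have "t / N < e" using N e by (simp add: field_simps)
      ultimately have 2: "t * real k / N < r + e" by simp
      then have "t * real k / N < t" by (simp add: e_def)
      then have "real k < N" using t0 N by (simp add: field_simps)
      then have "k \<le> Suc n" by (simp add: N_def)
      moreover have "x (t * real k / real (Suc n)) = x r"
        by (rule d(2)) (use 1 2 in \<open>auto simp: e_def N_def\<close>)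
      ultimately show "\<exists>k\<le>Suc n. x (t * real k / real (Suc n)) \<noteq> 0" using r by auto
    qed
  qed
  then show ?thesis by (rule eventually_mono) (use False in auto)
qed

lemma late_zero_event:
  assumes "0 \<le> t"
  shows "{x \<in> step_paths S. \<exists>s\<ge>t. x s = 0} \<in> sets (path_space S)"
proof -
  have "{x \<in> step_paths S. \<exists>s\<ge>t. x s = 0} = (\<Union>r\<in>{r \<in> \<rat>. t \<le> r}. {x \<in> step_paths S. x r = 0})"
  proof (intro set_eqI iffI)
    fix x assume "x \<in> {x \<in> step_paths S. \<exists>s\<ge>t. x s = 0}"
    then obtain s where s: "x \<in> step_paths S" "t \<le> s" "x s = 0" by blast
    obtain r where "r \<in> \<rat>" "s < r" "r < s + 1" "x r = x s"
      using step_path_rational[OF step_pathsD[OF s(1)], of s "s + 1"] s assms by auto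
    then show "x \<in> (\<Union>r\<in>{r \<in> \<rat>. t \<le> r}. {x \<in> step_paths S. x r = 0})" using s by force
  qed auto
  also have "\<dots> \<in> sets (path_space S)"
  proof (intro sets.countable_UN'')
    fix r assume "r \<in> {r \<in> \<rat>. t \<le> r}"
    then show "{x \<in> step_paths S. x r = 0} \<in> sets (path_space S)" using assms by (intro coord_event) auto
  qed (use countable_rat in \<open>auto intro: countable_subset[of _ "\<rat>"]\<close>)
  finally show ?thesis .
qed

section \<open>The exponential holding time at 0\<close>

locale killed_chain = path_chain +
  fixes q0 :: real
  assumes deriv: "((\<lambda>t. measure (Q 0) (cyl S {(t, 0)})) has_real_derivative - q0) (at_right 0)"
    and irreducible: "\<And>i. i \<in> S \<Longrightarrow> \<exists>t\<ge>0. measure (Q 0) (cyl S {(t, i)}) > 0"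
    and recurrent: "\<And>t. 0 \<le> t \<Longrightarrow> AE x in Q 0. \<exists>s\<ge>t. x s = 0"
begin

sublocale Q0: prob_space "Q 0"
  by (rule prob[OF zero_state])

lemma AE_step_path: "i \<in> S \<Longrightarrow> AE x in Q i. x \<in> step_paths S"
  using AE_space[of "Q i"] by (simp add: space_Q)

lemma measure_grid:
  assumes "0 \<le> t"
  shows "measure (Q 0) (cyl S ((\<lambda>k. (t * real k, 0)) ` {..n})) = measure (Q 0) (cyl S {(t, 0)}) ^ n"
proof (induction n)
  case 0
  have "cyl S {(0, 0)} = {x \<in> space (Q 0). x 0 = 0}" by (auto simp: cyl_def space_Q[OF zero_state])
  moreover have "{x \<in> space (Q 0). x 0 = 0} \<in> sets (Q 0)"
    unfolding space_Q[OF zero_state] by (intro event_Q zero_state coord_event) simp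
  then have "Q0.prob {x \<in> space (Q 0). x 0 = 0} = 1"
    using start[OF zero_state] by (subst Q0.prob_Collect_eq_1)
  ultimately show ?case by (simp add: atMost_0)
next
  case (Suc n)
  have "measure (Q 0) (cyl S (insert (t * real n + t, 0) ((\<lambda>k. (t * real k, 0)) ` {..n}))) =
      measure (Q 0) (cyl S ((\<lambda>k. (t * real k, 0)) ` {..n})) * measure (Q 0) (cyl S {(t, 0)})"
    using assms by (intro markov_cyl zero_state) (auto intro!: mult_left_mono)
  then show ?case using Suc by (simp add: atMost_Suc algebra_simps)
qed

text \<open>Being at 0 on the grid of mesh \<open>t / n\<close> has probability
  \<open>p (t / n) ^ n\<close>. The logarithm of \<open>p\<close> has right derivative
  \<open>- q0\<close> at 0, so these powers tend to the exponential, while the grid events converge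
  to the event of staying.\<close>

lemma zero_on_prob:
  assumes t: "0 \<le> t"
  shows "measure (Q 0) {x \<in> step_paths S. zero_on x 0 t} = exp (- q0 * t)"
proof (cases "t = 0")
  case True
  have "{x \<in> step_paths S. zero_on x 0 0} = cyl S ((\<lambda>k. (0 * real k, 0)) ` {..0})"
    by (auto simp: zero_on_def cyl_def)
  then show ?thesis using measure_grid[of 0 0] True by simp
next
  case False
  then have t0: "0 < t" using t by simp
  define p where "p h = measure (Q 0) (cyl S {(h, 0)})" for h
  have p0: "p 0 = 1" using measure_grid[of 0 1] measure_grid[of 0 0] by (simp add: p_def image_constant_conv)
  define h where "h n = t / real (Suc n)" for n
  have h: "filterlim h (at_right 0) sequentially"
    unfolding filterlim_at
  proof
    show "eventually (\<lambda>n. h n \<in> {0<..} \<and> h n \<noteq> 0) sequentially" using t0 by (simp add: h_def)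
    have "(\<lambda>n. t * inverse (real (Suc n))) \<longlonglongrightarrow> t * 0"
      by (intro tendsto_intros LIMSEQ_inverse_real_of_nat)
    then show "h \<longlonglongrightarrow> 0" by (simp add: h_def[abs_def] divide_inverse)
  qed
  have "((\<lambda>t. ln (p t)) has_real_derivative (1 / p 0) * - q0) (at_right 0)"
    by (rule DERIV_chain2[OF DERIV_ln_divide]) (use deriv p0 in \<open>simp_all add: p_def[symmetric]\<close>)
  then have "((\<lambda>y. ln (p y) / y) \<longlongrightarrow> - q0) (at_right 0)"
    by (simp add: has_field_derivative_iff p0)
  from filterlim_compose[OF this h] have "(\<lambda>n. ln (p (h n)) / h n) \<longlonglongrightarrow> - q0" .
  then have "(\<lambda>n. exp (ln (p (h n)) / h n * t)) \<longlonglongrightarrow> exp (- q0 * t)"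
    by (intro tendsto_intros)
  moreover have "(p \<longlongrightarrow> 1) (at_right 0)"
    using DERIV_continuous[OF deriv] p0 by (simp add: continuous_within p_def[abs_def])
  then have "eventually (\<lambda>n. 0 < p (h n)) sequentially"
    using filterlim_compose[OF _ h, of p "nhds 1"] order_tendstoD(1)[of "\<lambda>n. p (h n)" 1 _ 0] by auto
  then have "eventually (\<lambda>n. exp (ln (p (h n)) / h n * t) = p (h n) ^ Suc n) sequentially"
  proof eventually_elim
    case (elim n)
    have "exp (ln (p (h n)) / h n * t) = exp (real (Suc n) * ln (p (h n)))"
      using t0 by (simp add: h_def field_simps)
    also have "\<dots> = exp (ln (p (h n))) ^ Suc n" by (rule exp_of_nat_mult)
    finally show ?case using elim by simp
  qed
  ultimately have lim1: "(\<lambda>n. p (h n) ^ Suc n) \<longlonglongrightarrow> exp (- q0 * t)"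
    by (rule Lim_transform_eventually)
  define G where "G n = cyl S ((\<lambda>k. (h n * real k, 0)) ` {..Suc n})" for n
  define Z where "Z = {x \<in> step_paths S. zero_on x 0 t}"
  have G: "G n \<in> sets (Q 0)" for n
    unfolding G_def using t0 by (intro event_Q zero_state cyl_in_paths) (auto simp: h_def)
  have Z: "Z \<in> sets (Q 0)"
    unfolding Z_def by (intro event_Q zero_state zero_on_event) auto
  have "(\<lambda>n. \<integral>x. indicator (G n) x \<partial>Q 0) \<longlonglongrightarrow> (\<integral>x. indicator Z x \<partial>Q 0 :: real)"
  proof (rule integral_dominated_convergence[where w = "\<lambda>_. 1"])
    show "AE x in Q 0. (\<lambda>n. indicator (G n) x) \<longlonglongrightarrow> (indicator Z x :: real)"
      using AE_step_path[OF zero_state]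
    proof eventually_elim
      case (elim x)
      have "eventually (\<lambda>n. indicator Z x = (indicator (G n) x :: real)) sequentially"
        using grid_zero_iff[OF step_pathsD[OF elim] t]
      proof eventually_elim
        case (elim n)
        have "x \<in> G n \<longleftrightarrow> x \<in> Z"
          unfolding G_def Z_def cyl_def h_def using elim \<open>x \<in> step_paths S\<close>
          by (auto simp: mult.commute)
        then show ?case by (simp add: indicator_def)
      qed
      then show ?case by (rule Lim_transform_eventually[OF tendsto_const])
    qed
  qed (use G Z in auto)
  moreover have "(\<integral>x. indicator (G n) x \<partial>Q 0) = p (h n) ^ Suc n" for n
    using measure_grid[of "h n" "Suc n"] t0 G[of n] by (simp add: G_def p_def h_def)
  ultimately have "(\<lambda>n. p (h n) ^ Suc n) \<longlonglongrightarrow> measure (Q 0) Z" using Z by simp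
  from LIMSEQ_unique[OF this lim1] show ?thesis by (simp add: Z_def)
qed

lemma leave_prob:
  assumes "0 \<le> c"
  shows "measure (Q 0) {x \<in> step_paths S. \<not> zero_on x 0 c} = 1 - exp (- q0 * c)"
proof -
  have "{x \<in> step_paths S. zero_on x 0 c} \<in> sets (Q 0)"
    by (intro event_Q zero_state zero_on_event) auto
  from Q0.prob_compl[OF this] show ?thesis
    using zero_on_prob[OF assms] by (simp add: space_Q[OF zero_state] set_diff_eq)
      (metis (mono_tags, lifting) Collect_cong)
qed

text \<open>The two events differ by a departure exactly at time \<open>c\<close>. A departure not
  before \<open>c\<close> entails staying through every earlier \<open>c'\<close>, so its
  probability is at most the limit of \<open>exp (- q0 * c')\<close>, which already is the
  probability of staying through \<open>c\<close>.\<close>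

lemma AE_hold_time_less:
  assumes "0 < c"
  shows "AE x in Q 0. hold_time x < ereal c \<longleftrightarrow> \<not> zero_on x 0 c"
proof -
  define N where "N = {x \<in> step_paths S. \<not> hold_time x < ereal c} - {x \<in> step_paths S. zero_on x 0 c}"
  define L where "L = {x \<in> step_paths S. \<not> hold_time x < ereal c}"
  define Z where "Z c = {x \<in> step_paths S. zero_on x 0 c}" for c
  have Z: "Z c \<in> sets (Q 0)" for c
    unfolding Z_def by (intro event_Q zero_state zero_on_event) auto
  have "{x \<in> step_paths S. hold_time x < ereal c} \<in> sets (Q 0)"
    by (intro event_Q zero_state hold_time_event) auto
  then have "space (Q 0) - {x \<in> step_paths S. hold_time x < ereal c} \<in> sets (Q 0)" by auto
  moreover have "space (Q 0) - {x \<in> step_paths S. hold_time x < ereal c} = L"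
    by (auto simp: L_def space_Q[OF zero_state])
  ultimately have L: "L \<in> sets (Q 0)" by simp
  have ZL: "Z c \<subseteq> L"
  proof
    fix x assume x: "x \<in> Z c"
    show "x \<in> L"
    proof (rule ccontr)
      assume "x \<notin> L"
      then have "hold_time x < ereal c" using x by (auto simp: L_def Z_def)
      then obtain r where "0 \<le> r" "r < c" "x r \<noteq> 0"
        using x hold_time_less_iff[OF step_pathsD, of x S c] by (auto simp: Z_def)
      then show False using x by (auto simp: Z_def zero_on_def)
    qed
  qed
  have LZ: "L \<subseteq> Z c'" if "0 \<le> c'" "c' < c" for c'
  proof
    fix x assume x: "x \<in> L"
    have "x r = 0" if "0 \<le> r" "r \<le> c'" for r
    proof (rule ccontr)
      assume "x r \<noteq> 0"
      then have "hold_time x \<le> ereal r" using that by (intro hold_time_le)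
      then have "hold_time x < ereal c" using that \<open>c' < c\<close> by (auto intro: le_less_trans)
      then show False using x by (simp add: L_def)
    qed
    then show "x \<in> Z c'" using x by (auto simp: L_def Z_def zero_on_def)
  qed
  have "measure (Q 0) L \<le> exp (- q0 * c)"
  proof (rule tendsto_lowerbound)
    have "isCont (\<lambda>y. exp (- q0 * y)) c" by (intro continuous_intros)
    then show "((\<lambda>y. exp (- q0 * y)) \<longlongrightarrow> exp (- q0 * c)) (at_left c)"
      by (auto simp: isCont_def intro: tendsto_within_subset)
    show "eventually (\<lambda>y. measure (Q 0) L \<le> exp (- q0 * y)) (at_left c)"
      unfolding eventually_at_left[OF assms]
    proof (intro exI[of _ 0] conjI allI impI assms)
      fix y assume y: "0 < y" "y < c"
      have "measure (Q 0) L \<le> measure (Q 0) (Z y)"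
        using LZ y Z by (intro Q0.finite_measure_mono) auto
      then show "measure (Q 0) L \<le> exp (- q0 * y)"
        using zero_on_prob[of y] y by (simp add: Z_def)
    qed
  qed simp
  then have "measure (Q 0) (L - Z c) = 0"
    using Q0.finite_measure_Diff[OF L Z ZL] zero_on_prob[of c] assms measure_nonneg[of "Q 0" "L - Z c"]
    by (simp add: Z_def)
  then have "AE x in Q 0. x \<notin> L - Z c"
    using L Z by (intro AE_not_in) (auto simp: null_sets_def Q0.emeasure_eq_measure)
  with AE_step_path[OF zero_state] show ?thesis
    by eventually_elim (use ZL in \<open>auto simp: L_def Z_def\<close>)
qed

end

section \<open>Survival from 0 and regeneration at random times\<close>

context killed_chain
begin

text \<open>Expressed by \<open>unit_hold\<close>, the function has the value 1 for all
  \<open>t < 1\<close>, negative times included, as the renewal equation on the whole line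
  demands.\<close>

definition s0 :: "real \<Rightarrow> real" where
  "s0 t = measure (Q 0) {x \<in> step_paths S. \<not> unit_hold 0 t x}"

lemma alive_event: "{x \<in> step_paths S. \<not> unit_hold 0 t x} \<in> sets (path_space S)"
proof -
  have "space (path_space S) - {x \<in> step_paths S. unit_hold 0 t x} \<in> sets (path_space S)"
    by (intro sets.compl_sets unit_hold_event) auto
  moreover have "space (path_space S) - {x \<in> step_paths S. unit_hold 0 t x} = {x \<in> step_paths S. \<not> unit_hold 0 t x}"
    by auto
  ultimately show ?thesis by simp
qed

lemma unit_hold_mono: "t \<le> t' \<Longrightarrow> unit_hold b t x \<Longrightarrow> unit_hold b t' x"
  unfolding unit_hold_def by (meson atLeastAtMost_iff diff_right_mono order_trans)

lemma unit_hold_iff_kill: "step_path x \<Longrightarrow> unit_hold 0 t x \<longleftrightarrow> kill_time 0 x \<le> ereal t"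
  by (subst kill_time_le_iff) (force simp: unit_hold_def)+

lemma s0_antimono: "x \<le> y \<Longrightarrow> s0 y \<le> s0 x"
  unfolding s0_def using unit_hold_mono
  by (intro Q0.finite_measure_mono event_Q zero_state alive_event) auto

lemma s0_nonneg: "0 \<le> s0 x" and s0_le_1: "s0 x \<le> 1"
  by (simp_all add: s0_def)

lemma s0_measurable [measurable]: "s0 \<in> borel_measurable borel"
  by (rule borel_measurable_antimono_real) (rule s0_antimono)

lemma s0_rcont: "continuous (at_right t) s0"
proof -
  define A where "A y = {x \<in> step_paths S. \<not> unit_hold 0 y x}" for y
  have "(s0 \<longlongrightarrow> s0 t) (at_right t)"
  proof (rule tendsto_at_right_sequentially[of t "t + 1"])
    fix y assume y: "\<And>n. t < y n" "decseq y" "y \<longlonglongrightarrow> t"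
    have "(\<lambda>n. measure (Q 0) (A (y n))) \<longlonglongrightarrow> measure (Q 0) (\<Union>n. A (y n))"
    proof (rule Q0.finite_Lim_measure_incseq)
      show "range (\<lambda>n. A (y n)) \<subseteq> sets (Q 0)"
        unfolding A_def by (auto intro: event_Q zero_state alive_event)
      show "incseq (\<lambda>n. A (y n))"
        using y(2) unit_hold_mono by (fastforce simp: incseq_def decseq_def A_def)
    qed
    moreover have "(\<Union>n. A (y n)) = A t"
    proof (intro equalityI subsetI)
      fix x assume "x \<in> (\<Union>n. A (y n))"
      then obtain n where "x \<in> A (y n)" by blast
      then show "x \<in> A t" using y(1)[of n] unit_hold_mono[of t "y n" 0 x] by (auto simp: A_def)
    next
      fix x assume x: "x \<in> A t"
      then have k: "unit_hold 0 z x \<longleftrightarrow> kill_time 0 x \<le> ereal z" for z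
        by (intro unit_hold_iff_kill) (auto simp: A_def step_pathsD)
      show "x \<in> (\<Union>n. A (y n))"
      proof (rule ccontr)
        assume "x \<notin> (\<Union>n. A (y n))"
        then have "kill_time 0 x \<le> ereal (y n)" for n using x k by (auto simp: A_def)
        moreover have "(\<lambda>n. ereal (y n)) \<longlonglongrightarrow> ereal t" using y(3) by simp
        ultimately have "kill_time 0 x \<le> ereal t"
          by (intro LIMSEQ_le_const[of "\<lambda>n. ereal (y n)"]) auto
        then show False using x k by (auto simp: A_def)
      qed
    qed
    ultimately show "(\<lambda>n. s0 (y n)) \<longlonglongrightarrow> s0 t" by (simp add: s0_def A_def)
  qed simp
  then show ?thesis by (simp add: continuous_within)
qed

text \<open>The monotone function \<open>s0\<close> has countably many discontinuities, and a time
  without atoms avoids each of the corresponding values almost surely.\<close>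

lemma AE_s0_continuous:
  assumes "\<And>r. AE x in Q i. x \<in> A \<longrightarrow> T x \<noteq> ereal r"
  shows "AE x in Q i. x \<in> A \<longrightarrow> T x = ereal (\<tau> x) \<longrightarrow> isCont s0 (t - \<tau> x)"
proof -
  have "mono (\<lambda>x. - s0 x)" using s0_antimono by (simp add: mono_def)
  from mono_ctble_discont[OF this]
  have "countable {a. \<not> isCont (\<lambda>x. - s0 x) a}" .
  moreover have "{a. \<not> isCont s0 a} \<subseteq> {a. \<not> isCont (\<lambda>x. - s0 x) a}"
    using continuous_minus[of _ "\<lambda>x. - s0 x"] by auto
  ultimately have "countable {a. \<not> isCont s0 a}" by (rule countable_subset[rotated])
  then have "AE x in Q i. \<forall>a\<in>{a. \<not> isCont s0 a}. x \<in> A \<longrightarrow> T x \<noteq> ereal (t - a)"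
    using assms by (subst AE_ball_countable) auto
  then show ?thesis
  proof eventually_elim
    case (elim x)
    show ?case
    proof (intro impI)
      assume x: "x \<in> A" "T x = ereal (\<tau> x)"
      show "isCont s0 (t - \<tau> x)"
      proof (rule ccontr)
        assume "\<not> isCont s0 (t - \<tau> x)"
        with elim x(1) have "T x \<noteq> ereal (t - (t - \<tau> x))" by blast
        then show False using x by simp
      qed
    qed
  qed
qed

lemma nat_floor_cell:
  assumes "0 \<le> r" "0 < n"
  shows "real k / n \<le> r \<and> r < real (Suc k) / n \<longleftrightarrow> k = nat \<lfloor>n * r\<rfloor>"
proof -
  have "real k / n \<le> r \<and> r < real (Suc k) / n \<longleftrightarrow> real k \<le> n * r \<and> n * r < real k + 1"
    using assms by (simp add: field_simps)
  also have "\<dots> \<longleftrightarrow> \<lfloor>n * r\<rfloor> = int k" by (simp add: floor_eq_iff)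
  also have "\<dots> \<longleftrightarrow> k = nat \<lfloor>n * r\<rfloor>" using assms by auto
  finally show ?thesis .
qed

text \<open>
  The random time is approximated from the right by the grid points \<open>(k + 1) / n\<close>, at which
  the Markov property at fixed times applies.
\<close>

theorem strong_markov:
  fixes T :: "(real \<Rightarrow> nat) \<Rightarrow> ereal"
  assumes i: "i \<in> S" and A: "A \<in> sets (path_space S)" and T: "T \<in> borel_measurable (path_space S)"
    and stop: "\<And>b. 0 \<le> b \<Longrightarrow> {x \<in> A. T x < ereal b} \<in> sets (past S b)"
    and fin: "AE x in Q i. x \<in> A \<longrightarrow> 0 \<le> T x \<and> T x < \<infinity> \<and> x (real_of_ereal (T x)) = 0"
    and atomless: "\<And>r. AE x in Q i. x \<in> A \<longrightarrow> T x \<noteq> ereal r"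
    and regen: "AE x in Q i. x \<in> A \<longrightarrow> (unit_hold (real_of_ereal (T x)) t x \<longleftrightarrow> unit_hold 0 t x)"
  shows "emeasure (Q i) {x \<in> A. \<not> unit_hold 0 t x} =
    (\<integral>\<^sup>+x. indicator A x * ennreal (s0 (t - real_of_ereal (T x))) \<partial>Q i)"
proof -
  interpret I: prob_space "Q i" by (rule prob[OF i])
  define \<tau> where "\<tau> x = real_of_ereal (T x)" for x
  define n where "n m = real (Suc m)" for m :: nat
  \<comment> \<open>The cells have mesh \<open>1 / (m + 1)\<close>, and the random time is replaced
    by the right end \<open>b m k\<close> of its cell. That end lies strictly after the time, so by
    \<open>stop\<close> the event \<open>E m k\<close> belongs to the past of
    \<open>b m k\<close>.\<close>
  define b where "b m k = real (Suc k) / n m" for m k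
  define E where "E m k = {x \<in> A. real k / n m \<le> T x \<and> T x < ereal (b m k)}" for m k
  \<comment> \<open>The Markov property restarts from a known state, so the path must be at 0 at the
    right end of the cell. As it is at 0 at time \<open>T\<close>, right-constancy gives this for
    all fine meshes.\<close>
  define z where "z m k = E m k \<inter> {x \<in> step_paths S. x (b m k) = 0}" for m k
  define al where "al m k = {x \<in> step_paths S. shift (b m k) x \<in> {x \<in> step_paths S. \<not> unit_hold 0 (t - b m k) x}}" for m k
  define u where "u m x = (\<Sum>k. indicator (z m k \<inter> al m k) x :: ennreal)" for m x
  define v where "v m x = (\<Sum>k. indicator (z m k) x * ennreal (s0 (t - b m k)))" for m x
  have A_sub: "A \<subseteq> step_paths S" using sets.sets_into_space[OF A] by simp
  have n0: "0 < n m" for m by (simp add: n_def)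
  have b0: "0 \<le> b m k" for m k by (simp add: b_def n_def)
  have E: "E m k \<in> sets (past S (b m k))" for m k
  proof -
    have "{x \<in> A. T x < ereal (real k / n m)} \<in> sets (past S (real k / n m))"
      by (rule stop) (simp add: n_def)
    moreover have "sets (past S (real k / n m)) \<subseteq> sets (past S (b m k))"
      by (intro sets_paths_mono) (auto simp: b_def n_def divide_right_mono intro: order_trans)
    ultimately have "{x \<in> A. T x < ereal (b m k)} - {x \<in> A. T x < ereal (real k / n m)} \<in> sets (past S (b m k))"
      using stop[OF b0] by blast
    moreover have "{x \<in> A. T x < ereal (b m k)} - {x \<in> A. T x < ereal (real k / n m)} = E m k"
      by (auto simp: E_def)
    ultimately show ?thesis by simp
  qed
  have z: "z m k \<in> sets (Q i)" for m k
    unfolding z_def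
  proof (rule sets.Int)
    show "E m k \<in> sets (Q i)" using E past_sub[OF i] by blast
    show "{x \<in> step_paths S. x (b m k) = 0} \<in> sets (Q i)" using b0 by (intro event_Q i coord_event) simp
  qed
  have al: "al m k \<in> sets (Q i)" for m k
  proof -
    have "shift (b m k) -` {x \<in> step_paths S. \<not> unit_hold 0 (t - b m k) x} \<inter> space (path_space S) \<in> sets (path_space S)"
      by (intro measurable_sets[OF measurable_shift] b0 alive_event)
    moreover have "shift (b m k) -` {x \<in> step_paths S. \<not> unit_hold 0 (t - b m k) x} \<inter> space (path_space S) = al m k"
      unfolding al_def vimage_def space_paths by blast
    ultimately show ?thesis by (intro event_Q[OF i]) (simp only:)
  qed
  have uv: "(\<integral>\<^sup>+x. u m x \<partial>Q i) = (\<integral>\<^sup>+x. v m x \<partial>Q i)" for m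
  proof -
    have "(\<integral>\<^sup>+x. u m x \<partial>Q i) = (\<Sum>k. emeasure (Q i) (z m k \<inter> al m k))"
      unfolding u_def using z al by (subst nn_integral_suminf) auto
    also have "\<dots> = (\<Sum>k. emeasure (Q i) (z m k) * ennreal (s0 (t - b m k)))"
      using markov[OF i zero_state b0 E alive_event]
      by (intro suminf_cong) (simp add: z_def al_def s0_def I.emeasure_eq_measure ennreal_mult')
    also have "\<dots> = (\<integral>\<^sup>+x. v m x \<partial>Q i)"
      unfolding v_def using z by (subst nn_integral_suminf) (auto simp: nn_integral_multc)
    finally show ?thesis .
  qed
  define k where "k m x = nat \<lfloor>n m * \<tau> x\<rfloor>" for m x
  define B where "B m x = b m (k m x)" for m x
  \<comment> \<open>\<open>\<tau> x \<noteq> t - 1\<close> excludes the exceptional time of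
    \<open>unit_hold_start_from_right\<close>. Continuity of \<open>s0\<close> is required because
    grid points above \<open>\<tau> x\<close> make \<open>t - B m x\<close> approach from the left,
    where right-continuity says nothing.\<close>
  have good: "AE x in Q i. x \<in> A \<longrightarrow> T x = ereal (\<tau> x) \<and> 0 \<le> \<tau> x \<and> x (\<tau> x) = 0 \<and>
      \<tau> x \<noteq> t - 1 \<and> isCont s0 (t - \<tau> x) \<and> (unit_hold (\<tau> x) t x \<longleftrightarrow> unit_hold 0 t x)"
    using fin atomless[of "t - 1"] regen AE_s0_continuous[OF atomless, of \<tau> t]
  proof eventually_elim
    case (elim x)
    show ?case
    proof
      assume x: "x \<in> A"
      with elim have "T x = ereal (\<tau> x)" by (cases "T x") (auto simp: \<tau>_def)
      with elim x show "T x = ereal (\<tau> x) \<and> 0 \<le> \<tau> x \<and> x (\<tau> x) = 0 \<and>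
        \<tau> x \<noteq> t - 1 \<and> isCont s0 (t - \<tau> x) \<and> (unit_hold (\<tau> x) t x \<longleftrightarrow> unit_hold 0 t x)"
        by auto
    qed
  qed
  have cell: "x \<in> E m j \<longleftrightarrow> j = k m x" if "x \<in> A" "T x = ereal (\<tau> x)" "0 \<le> \<tau> x" for x m j
    using nat_floor_cell[OF that(3) n0, of j m] that by (simp add: E_def b_def k_def)
  have B_bounds: "\<tau> x < B m x" "B m x \<le> \<tau> x + 1 / n m" if "x \<in> A" "T x = ereal (\<tau> x)" "0 \<le> \<tau> x" for x m
  proof -
    have "real (k m x) / n m \<le> \<tau> x \<and> \<tau> x < real (Suc (k m x)) / n m"
      using nat_floor_cell[OF that(3) n0, of "k m x" m] by (simp add: k_def)
    then show "\<tau> x < B m x" "B m x \<le> \<tau> x + 1 / n m"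
      by (auto simp: B_def b_def add_divide_distrib)
  qed
  have suminf_at: "(\<Sum>j. f j) = f (k m x)" if "\<And>j. j \<noteq> k m x \<Longrightarrow> f j = 0" for f :: "nat \<Rightarrow> ennreal" and m x
    using suminf_finite[of "{k m x}" f] that by simp
  have u_eq: "u m x = (if x (B m x) = 0 \<and> \<not> unit_hold (B m x) t x then 1 else 0)"
    and v_eq: "v m x = (if x (B m x) = 0 then ennreal (s0 (t - B m x)) else 0)"
    if x: "x \<in> A" "T x = ereal (\<tau> x)" "0 \<le> \<tau> x" for x m
  proof -
    have xs: "x \<in> step_paths S" using x A_sub by auto
    have "u m x = indicator (z m (k m x) \<inter> al m (k m x)) x"
      unfolding u_def by (rule suminf_at) (auto simp: z_def cell[OF x] indicator_def)
    also have "\<dots> = (if x (B m x) = 0 \<and> \<not> unit_hold (B m x) t x then 1 else 0)"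
      using xs shift_in_step_paths[OF xs b0]
      by (auto simp: z_def al_def cell[OF x] B_def unit_hold_shift indicator_def)
    finally show "u m x = (if x (B m x) = 0 \<and> \<not> unit_hold (B m x) t x then 1 else 0)" .
    have "v m x = indicator (z m (k m x)) x * ennreal (s0 (t - b m (k m x)))"
      unfolding v_def by (rule suminf_at) (auto simp: z_def cell[OF x] indicator_def)
    also have "\<dots> = (if x (B m x) = 0 then ennreal (s0 (t - B m x)) else 0)"
      using xs by (auto simp: z_def cell[OF x] B_def indicator_def)
    finally show "v m x = (if x (B m x) = 0 then ennreal (s0 (t - B m x)) else 0)" .
  qed
  have off: "u m x = 0" "v m x = 0" if "x \<notin> A" for m x
    using that by (simp_all add: u_def v_def z_def E_def)
  have B_lim: "(\<lambda>m. B m x) \<longlonglongrightarrow> \<tau> x" and B_zero: "eventually (\<lambda>m. x (B m x) = 0) sequentially"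
    if x: "x \<in> A" "T x = ereal (\<tau> x)" "0 \<le> \<tau> x" and x0: "x (\<tau> x) = 0" for x
  proof -
    have "(\<lambda>m. \<tau> x + 1 / n m) \<longlonglongrightarrow> \<tau> x + 0"
      using LIMSEQ_inverse_real_of_nat by (intro tendsto_add tendsto_const) (simp add: n_def inverse_eq_divide)
    then have up: "(\<lambda>m. \<tau> x + 1 / n m) \<longlonglongrightarrow> \<tau> x" by simp
    show lim: "(\<lambda>m. B m x) \<longlonglongrightarrow> \<tau> x"
    proof (rule tendsto_sandwich[OF _ _ tendsto_const up])
      show "eventually (\<lambda>m. \<tau> x \<le> B m x) sequentially"
        using B_bounds(1)[OF x] less_imp_le by (intro always_eventually allI) blast
      show "eventually (\<lambda>m. B m x \<le> \<tau> x + 1 / n m) sequentially"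
        using B_bounds(2)[OF x] by (intro always_eventually allI) blast
    qed
    have sp: "step_path x" using x A_sub step_pathsD by blast
    obtain d where d: "d > 0" "\<And>s. \<tau> x \<le> s \<Longrightarrow> s < \<tau> x + d \<Longrightarrow> x s = x (\<tau> x)"
      using step_path_right[OF sp x(3)] by blast
    have "eventually (\<lambda>m. B m x < \<tau> x + d) sequentially"
      using order_tendstoD(2)[OF lim, of "\<tau> x + d"] d(1) by simp
    then show "eventually (\<lambda>m. x (B m x) = 0) sequentially"
    proof eventually_elim
      case (elim m)
      then show ?case using d(2)[of "B m x"] B_bounds(1)[OF x, of m] x0 by simp
    qed
  qed
  have le1: "AE x in Q i. u m x \<le> 1" "AE x in Q i. v m x \<le> 1" for m
  proof -
    show "AE x in Q i. u m x \<le> 1"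
      using good
    proof eventually_elim
      case (elim x)
      then show ?case by (cases "x \<in> A") (simp_all add: u_eq off)
    qed
    show "AE x in Q i. v m x \<le> 1"
      using good
    proof eventually_elim
      case (elim x)
      then show ?case using s0_le_1 by (cases "x \<in> A") (simp_all add: v_eq off)
    qed
  qed
  have top: "(\<integral>\<^sup>+x. 1 \<partial>Q i) < \<infinity>" using I.emeasure_space_1 by simp
  have um: "u m \<in> borel_measurable (Q i)" and vm: "v m \<in> borel_measurable (Q i)" for m
    unfolding u_def v_def using z al by (auto intro!: borel_measurable_suminf borel_measurable_times borel_measurable_indicator)
  have \<tau>m: "\<tau> \<in> borel_measurable (Q i)"
    unfolding \<tau>_def measurable_Q[OF i] using T by measurable
  have AQ: "A \<in> sets (Q i)" using event_Q[OF i A] .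
  have limA: "{x \<in> A. \<not> unit_hold 0 t x} \<in> sets (Q i)"
  proof -
    have "{x \<in> A. \<not> unit_hold 0 t x} = A \<inter> {x \<in> step_paths S. \<not> unit_hold 0 t x}" using A_sub by auto
    then show ?thesis using event_Q[OF i sets.Int[OF A alive_event]] by simp
  qed
  have "(\<lambda>m. \<integral>\<^sup>+x. u m x \<partial>Q i) \<longlonglongrightarrow> (\<integral>\<^sup>+x. indicator {x \<in> A. \<not> unit_hold 0 t x} x \<partial>Q i)"
  proof (rule nn_integral_dominated_convergence[where w = "\<lambda>_. 1"])
    show "AE x in Q i. (\<lambda>m. u m x) \<longlonglongrightarrow> indicator {x \<in> A. \<not> unit_hold 0 t x} x"
      using good
    proof eventually_elim
      case (elim x)
      show ?case
      proof (cases "x \<in> A")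
        case True
        with elim have x: "x \<in> A" "T x = ereal (\<tau> x)" "0 \<le> \<tau> x" "x (\<tau> x) = 0" "t \<noteq> \<tau> x + 1"
          "unit_hold (\<tau> x) t x \<longleftrightarrow> unit_hold 0 t x" by auto
        have sp: "step_path x" using x A_sub step_pathsD by blast
        have "eventually (\<lambda>m. unit_hold (B m x) t x \<longleftrightarrow> unit_hold (\<tau> x) t x) sequentially"
          using B_bounds(1)[OF x(1-3)] less_imp_le
          by (intro unit_hold_start_from_right[OF sp x(3,5) B_lim[OF x(1-4)]]) blast
        with B_zero[OF x(1-4)]
        have "eventually (\<lambda>m. indicator {x \<in> A. \<not> unit_hold 0 t x} x = u m x) sequentially"
          by eventually_elim (use x in \<open>auto simp: u_eq[OF x(1-3)] indicator_def\<close>)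
        then show ?thesis by (rule Lim_transform_eventually[OF tendsto_const])
      qed (simp add: off)
    qed
  qed (use um limA le1 top in auto)
  then have l1: "(\<lambda>m. \<integral>\<^sup>+x. u m x \<partial>Q i) \<longlonglongrightarrow> emeasure (Q i) {x \<in> A. \<not> unit_hold 0 t x}"
    using limA by simp
  have l2: "(\<lambda>m. \<integral>\<^sup>+x. v m x \<partial>Q i) \<longlonglongrightarrow> (\<integral>\<^sup>+x. indicator A x * ennreal (s0 (t - \<tau> x)) \<partial>Q i)"
  proof (rule nn_integral_dominated_convergence[where w = "\<lambda>_. 1"])
    show "AE x in Q i. (\<lambda>m. v m x) \<longlonglongrightarrow> indicator A x * ennreal (s0 (t - \<tau> x))"
      using good
    proof eventually_elim
      case (elim x)
      show ?case
      proof (cases "x \<in> A")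
        case True
        with elim have x: "x \<in> A" "T x = ereal (\<tau> x)" "0 \<le> \<tau> x" "x (\<tau> x) = 0"
          and c: "isCont s0 (t - \<tau> x)" by auto
        have "(\<lambda>m. s0 (t - B m x)) \<longlonglongrightarrow> s0 (t - \<tau> x)"
          by (rule isCont_tendsto_compose[OF c]) (intro tendsto_intros B_lim[OF x])
        then have "(\<lambda>m. ennreal (s0 (t - B m x))) \<longlonglongrightarrow> indicator A x * ennreal (s0 (t - \<tau> x))"
          using True by (simp add: tendsto_ennrealI)
        moreover have "eventually (\<lambda>m. ennreal (s0 (t - B m x)) = v m x) sequentially"
          using B_zero[OF x] by eventually_elim (simp add: v_eq[OF x(1-3)])
        ultimately show ?thesis by (rule Lim_transform_eventually)
      qed (simp add: off)
    qed
    show "(\<lambda>x. indicator A x * ennreal (s0 (t - \<tau> x))) \<in> borel_measurable (Q i)"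
      using \<tau>m AQ by measurable
  qed (use vm le1 top in auto)
  show ?thesis
    using LIMSEQ_unique[OF l1 l2[folded uv]] by (simp add: \<tau>_def)
qed

end

text \<open>Let \<sigma> be the supremum of the zeros before \<open>s\<close>. By right-constancy
  the path is away from 0 at \<sigma>, and it is constantly 0 shortly before. A rational time less
  than one unit before \<sigma> then sees a short holding followed by an excursion still running at
  \<open>s\<close>. Rationality leaves only countably many candidates.\<close>

lemma last_zero:
  assumes x: "step_path x" and s: "0 \<le> s" "x 0 = 0" "x s \<noteq> 0"
  obtains r where "r \<in> \<rat>" "0 \<le> r" "r < s" "x r = 0" "hold_time (shift r x) < 1"
    "\<not> return_time (shift r x) < ereal (s - r)"
proof -
  define Z where "Z = {u \<in> {0..s}. x u = 0}"
  define \<sigma> where "\<sigma> = Sup Z"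
  have Z: "0 \<in> Z" "bdd_above Z" using s by (auto simp: Z_def)
  have upper: "u \<le> \<sigma>" if "u \<in> Z" for u
    unfolding \<sigma>_def using that Z by (intro cSup_upper)
  have \<sigma>: "0 \<le> \<sigma>" "\<sigma> \<le> s"
    using upper[OF Z(1)] Z unfolding \<sigma>_def by (auto intro!: cSup_least simp: Z_def)
  have after: "x u \<noteq> 0" if "\<sigma> < u" "u \<le> s" for u
    using upper[of u] that \<sigma> by (auto simp: Z_def)
  have x\<sigma>: "x \<sigma> \<noteq> 0"
  proof
    assume 0: "x \<sigma> = 0"
    then have "\<sigma> < s" using s \<sigma> by (cases "\<sigma> = s") auto
    then obtain r where "\<sigma> < r" "r < s" "x r = x \<sigma>"
      using step_path_rational[OF x \<sigma>(1)] by blast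
    then show False using after[of r] 0 by simp
  qed
  have "0 < \<sigma>" using \<sigma> x\<sigma> s by (cases "\<sigma> = 0") auto
  then obtain d j where d: "d > 0" "\<And>u. \<sigma> - d < u \<Longrightarrow> u < \<sigma> \<Longrightarrow> x u = j"
    using step_path_left[OF x] by blast
  have "\<sigma> - d < Sup Z" using d(1) by (simp add: \<sigma>_def)
  then obtain u where u: "u \<in> Z" "\<sigma> - d < u" using less_cSup_iff[of Z "\<sigma> - d"] Z by auto
  have "u < \<sigma>" using upper[OF u(1)] u(1) x\<sigma> by (cases "u = \<sigma>") (auto simp: Z_def)
  then have j: "j = 0" using d(2)[OF u(2)] u(1) by (simp add: Z_def)
  have "max 0 (max (\<sigma> - d) (\<sigma> - 1)) < \<sigma>" using d(1) \<open>0 < \<sigma>\<close> by simp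
  then obtain r where r: "r \<in> \<rat>" "max 0 (max (\<sigma> - d) (\<sigma> - 1)) < r" "r < \<sigma>"
    using Rats_dense_in_real by blast
  have sh: "step_path (shift r x)" using r x by (intro step_path_shift) auto
  have zero: "x u = 0" if "r \<le> u" "u < \<sigma>" for u
    using d(2)[of u] j that r by simp
  show ?thesis
  proof (rule that[OF r(1)])
    show "0 \<le> r" "r < s" using r \<sigma> by auto
    show "x r = 0" using zero[of r] r by simp
    have "hold_time (shift r x) \<le> ereal (\<sigma> - r)"
      using r x\<sigma> by (intro hold_time_le) (auto simp: shift_def)
    also have "\<dots> < 1" using r by simp
    finally show "hold_time (shift r x) < 1" .
    show "\<not> return_time (shift r x) < ereal (s - r)"
    proof
      assume "return_time (shift r x) < ereal (s - r)"
      then obtain a b where ab: "0 \<le> a" "a < b" "b < s - r" "x (r + a) \<noteq> 0" "x (r + b) = 0"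
        unfolding return_time_less_iff[OF sh] by (auto simp: shift_def)
      have "\<sigma> \<le> r + a" using zero[of "r + a"] ab by (cases "r + a < \<sigma>") auto
      then show False using after[of "r + b"] ab by auto
    qed
  qed
qed

text \<open>Measurability of \<open>N\<close> need not be checked: outside the sigma-algebra
  \<open>measure\<close> has the default value 0.\<close>

lemma measure_eq_0_of_AE:
  assumes "AE x in M. x \<notin> N"
  shows "measure M N = 0"
proof (cases "N \<in> sets M")
  case True
  then have "N = {x \<in> space M. x \<in> N}" using sets.sets_into_space by auto
  then have "emeasure M N = 0" using assms emeasure_eq_0_AE[of "\<lambda>x. x \<in> N" M] by simp
  then show ?thesis by (simp add: measure_def)
qed (simp add: measure_notin_sets)

section \<open>Return and hitting times under the laws of the chain\<close>

context killed_chain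
begin

text \<open>For \<open>c > 0\<close> almost surely the event \<open>hold_time x < c\<close>. In this
  form it is the exact complement of a \<open>zero_on\<close> event, whose probability is known and
  which behaves well under shifts.\<close>

definition leave :: "real \<Rightarrow> (real \<Rightarrow> nat) set" where
  "leave c = {x \<in> step_paths S. \<not> zero_on x 0 c}"

text \<open>An infinite return time is sent to 0. \<open>AE_return_finite\<close> excludes that case
  almost surely on \<open>leave c\<close>, as \<open>AE_hits\<close> does for the hitting time
  \<open>R\<close>.\<close>

definition W :: "(real \<Rightarrow> nat) \<Rightarrow> real" where
  "W x = real_of_ereal (return_time x)"

definition R :: "(real \<Rightarrow> nat) \<Rightarrow> real" where
  "R x = real_of_ereal (hit_time x)"

text \<open>At \<open>c = 1\<close> this becomes the function \<open>I\<close> of the theorem. The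
  left derivative varies \<theta>, the cocycle identity varies \<open>c\<close>.\<close>

definition leave_moment :: "real \<Rightarrow> real \<Rightarrow> ennreal" where
  "leave_moment \<theta> c = (\<integral>\<^sup>+x. indicator (leave c) x * ennreal (exp (\<theta> * W x)) \<partial>Q 0)"

lemma leave_event:
  assumes "{0..c} \<subseteq> A"
  shows "leave c \<in> sets (paths S A)"
proof -
  have "space (paths S A) - {x \<in> step_paths S. zero_on x 0 c} \<in> sets (paths S A)"
    using assms by (intro sets.compl_sets zero_on_event) auto
  moreover have "space (paths S A) - {x \<in> step_paths S. zero_on x 0 c} = leave c"
    by (auto simp: leave_def)
  ultimately show ?thesis by simp
qed

lemma leave_path_space: "leave c \<in> sets (path_space S)"
  by (rule leave_event) auto

lemma leave_Q [measurable]: "leave c \<in> sets (Q 0)"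
  by (intro event_Q zero_state leave_path_space)

lemma leave_mono: "c \<le> c' \<Longrightarrow> leave c \<subseteq> leave c'"
  by (auto simp: leave_def zero_on_def)

lemma W_measurable [measurable]: "i \<in> S \<Longrightarrow> W \<in> borel_measurable (Q i)"
  unfolding W_def measurable_Q using return_time_measurable by measurable

lemma R_path_space [measurable]: "R \<in> borel_measurable (path_space S)"
  unfolding R_def using hit_time_measurable by measurable

lemma R_measurable [measurable]: "i \<in> S \<Longrightarrow> R \<in> borel_measurable (Q i)"
  by (simp add: measurable_Q)

lemma AE_return_finite:
  assumes "0 \<le> c"
  shows "AE x in Q 0. x \<in> leave c \<longrightarrow> return_time x = ereal (W x)"
  using recurrent[OF assms]
proof eventually_elim
  case (elim x)
  show ?case
  proof
    assume x: "x \<in> leave c"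
    then obtain r where r: "0 \<le> r" "r \<le> c" "x r \<noteq> 0" by (auto simp: leave_def zero_on_def)
    obtain s where s: "c \<le> s" "x s = 0" using elim by blast
    have "hold_time x \<le> ereal s" using hold_time_le[of r x] r s by (auto intro: order_trans)
    then have "return_time x \<le> ereal s" unfolding return_time_def using s by (intro Inf_lower) auto
    moreover have "0 \<le> return_time x" using hold_time_nonneg return_time_ge_hold order_trans by blast
    ultimately show "return_time x = ereal (W x)" by (cases "return_time x") (auto simp: W_def)
  qed
qed

lemma return_finiteD:
  assumes "x \<in> step_paths S" "return_time x = ereal (W x)"
  shows "0 < W x" "x (W x) = 0"
  using return_time_attained[OF step_pathsD[OF assms(1)] assms(2)] by fastforce+

text \<open>Recurrence is assumed here under \<open>Q 0\<close>. The state \<open>i\<close> is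
  reached from 0 at some time \<open>t\<close> with positive probability, so by the Markov property
  a positive chance of never hitting 0 from \<open>i\<close> would give, under \<open>Q 0\<close>, a
  positive chance of no zero after \<open>t\<close>.\<close>

lemma AE_hits:
  assumes i: "i \<in> S"
  shows "AE x in Q i. hit_time x = ereal (R x)"
proof -
  interpret I: prob_space "Q i" by (rule prob[OF i])
  obtain t where t: "0 \<le> t" "measure (Q 0) (cyl S {(t, i)}) > 0" using irreducible[OF i] by blast
  define G where "G = {x \<in> step_paths S. \<not> (\<exists>s\<ge>0. x s = 0)}"
  have "space (path_space S) - {x \<in> step_paths S. \<exists>s\<ge>0. x s = 0} \<in> sets (path_space S)"
    by (intro sets.compl_sets late_zero_event) auto
  moreover have "space (path_space S) - {x \<in> step_paths S. \<exists>s\<ge>0. x s = 0} = G"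
    by (auto simp: G_def)
  ultimately have G: "G \<in> sets (path_space S)" by simp
  have top: "step_paths S \<in> sets (past S t)" using sets.top[of "past S t"] by simp
  have "measure (Q 0) (step_paths S \<inter> {x \<in> step_paths S. x t = i} \<inter> {x \<in> step_paths S. shift t x \<in> G}) =
      measure (Q 0) (step_paths S \<inter> {x \<in> step_paths S. x t = i}) * measure (Q i) G"
    by (rule markov[OF zero_state i t(1) top G])
  moreover have "step_paths S \<inter> {x \<in> step_paths S. x t = i} = cyl S {(t, i)}" by (auto simp: cyl_def)
  moreover have "measure (Q 0) (step_paths S \<inter> {x \<in> step_paths S. x t = i} \<inter> {x \<in> step_paths S. shift t x \<in> G}) = 0"
  proof -
    have "AE x in Q 0. x \<notin> step_paths S \<inter> {x \<in> step_paths S. x t = i} \<inter> {x \<in> step_paths S. shift t x \<in> G}"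
      using recurrent[OF t(1)]
    proof eventually_elim
      case (elim x)
      then obtain s where "t \<le> s" "x s = 0" by blast
      then have "\<exists>r\<ge>0. shift t x r = 0" by (intro exI[of _ "s - t"]) (simp add: shift_def)
      then show ?case by (auto simp: G_def)
    qed
    then show ?thesis
      by (rule measure_eq_0_of_AE)
  qed
  ultimately have "measure (Q i) G = 0" using t(2) by auto
  then have "AE x in Q i. x \<notin> G"
    using event_Q[OF i G] by (intro AE_not_in) (auto simp: null_sets_def I.emeasure_eq_measure)
  with AE_step_path[OF i] show ?thesis
  proof eventually_elim
    case (elim x)
    then obtain s where "0 \<le> s" "x s = 0" by (auto simp: G_def)
    then have "hit_time x \<le> ereal s" unfolding hit_time_def by (intro Inf_lower) auto
    then show ?case using hit_time_nonneg[of x] by (cases "hit_time x") (auto simp: R_def)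
  qed
qed

text \<open>For \<open>b < c\<close> the set \<open>leave c\<close> is not an event of the past of
  \<open>b\<close>. But a return before \<open>b\<close> includes a departure before
  \<open>b\<close>, so membership in \<open>leave c\<close> is then implied.\<close>

lemma return_stop:
  assumes "0 \<le> b"
  shows "{x \<in> leave c. return_time x < ereal b} \<in> sets (past S b)"
proof (cases "c \<le> b")
  case True
  have "{x \<in> leave c. return_time x < ereal b} = leave c \<inter> {x \<in> step_paths S. return_time x < ereal b}"
    by (auto simp: leave_def)
  also have "\<dots> \<in> sets (past S b)"
    using True by (intro sets.Int leave_event return_time_event) auto
  finally show ?thesis .
next
  case False
  have "x \<in> leave c" if x: "x \<in> step_paths S" "return_time x < ereal b" for x
  proof -
    obtain r where "0 \<le> r" "r < b" "x r \<noteq> 0"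
      using x return_time_less_iff[OF step_pathsD[OF x(1)], of b] by auto
    then show ?thesis using x False by (auto simp: leave_def zero_on_def)
  qed
  then have "{x \<in> leave c. return_time x < ereal b} = {x \<in> step_paths S. return_time x < ereal b}"
    by (auto simp: leave_def)
  also have "\<dots> \<in> sets (past S b)" by (intro return_time_event) auto
  finally show ?thesis .
qed

lemma alive_measurable:
  assumes "0 \<le> u" "u < 1"
  shows "{x \<in> step_paths S. ereal t < kill_time u x} \<in> sets (path_space S)"
proof -
  have "{x \<in> step_paths S. ereal t < kill_time u x} = {x \<in> step_paths S. \<not> unit_hold 0 t x} \<inter>
      (if 1 - u \<le> t then leave (1 - u) else step_paths S)"
    using kill_time_le_iff[OF step_pathsD assms] by (auto simp: leave_def not_le[symmetric])
  also have "\<dots> \<in> sets (path_space S)"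
    using alive_event leave_path_space sets.top[of "path_space S"] by (auto intro!: sets.Int)
  finally show ?thesis .
qed

text \<open>With \<open>1 - u\<close> left on the clock, the path either stays at 0 that long and is
  killed exactly then, or leaves first. In the second case no unit stretch can begin before the
  return, and the strong Markov property at \<open>W\<close> restarts the clock at 0.\<close>

lemma survival_from_zero:
  assumes atomless: "\<And>r. AE x in Q 0. x \<in> leave 1 \<longrightarrow> return_time x \<noteq> ereal r"
    and u: "0 \<le> u" "u < 1"
  shows "ennreal (measure (Q 0) {x \<in> step_paths S. ereal t < kill_time u x}) =
    ennreal (if t < 1 - u then exp (- q0 * (1 - u)) else 0) +
    (\<integral>\<^sup>+x. indicator (leave (1 - u)) x * ennreal (s0 (t - W x)) \<partial>Q 0)"
proof -
  define c where "c = 1 - u"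
  have c: "0 < c" "c \<le> 1" using u by (auto simp: c_def)
  define A where "A = {x \<in> step_paths S. ereal t < kill_time u x}"
  define Z where "Z = {x \<in> step_paths S. zero_on x 0 c \<and> t < c}"
  have A: "A \<in> sets (Q 0)"
    unfolding A_def by (intro event_Q zero_state alive_measurable u)
  have ZA: "A = Z \<union> {x \<in> leave c. \<not> unit_hold 0 t x}"
  proof (intro set_eqI)
    fix x
    have "\<not> unit_hold 0 t x" if "t < c" using that c by (auto simp: unit_hold_def)
    then show "x \<in> A \<longleftrightarrow> x \<in> Z \<union> {x \<in> leave c. \<not> unit_hold 0 t x}"
      using kill_time_le_iff[OF step_pathsD u, of x S t]
      by (auto simp: A_def Z_def leave_def c_def[symmetric] not_le[symmetric])
  qed
  have L: "{x \<in> leave c. \<not> unit_hold 0 t x} \<in> sets (Q 0)"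
  proof -
    have "{x \<in> leave c. \<not> unit_hold 0 t x} = leave c \<inter> {x \<in> step_paths S. \<not> unit_hold 0 t x}"
      by (auto simp: leave_def)
    then show ?thesis using event_Q[OF zero_state sets.Int[OF leave_path_space alive_event]] by simp
  qed
  have Z: "Z \<in> sets (Q 0)"
  proof (cases "t < c")
    case True
    then have "Z = {x \<in> step_paths S. zero_on x 0 c}" by (auto simp: Z_def)
    then show ?thesis using event_Q[OF zero_state zero_on_event[of 0 c "{0..}" S]] by auto
  qed (simp add: Z_def)
  have "emeasure (Q 0) A = emeasure (Q 0) Z + emeasure (Q 0) {x \<in> leave c. \<not> unit_hold 0 t x}"
    unfolding ZA using Z L by (intro plus_emeasure[symmetric]) (auto simp: Z_def leave_def)
  also have "emeasure (Q 0) Z = ennreal (if t < c then exp (- q0 * c) else 0)"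
    using zero_on_prob[of c] c by (simp add: Z_def Q0.emeasure_eq_measure)
  also have "emeasure (Q 0) {x \<in> leave c. \<not> unit_hold 0 t x} =
      (\<integral>\<^sup>+x. indicator (leave c) x * ennreal (s0 (t - real_of_ereal (return_time x))) \<partial>Q 0)"
  proof (rule strong_markov[OF zero_state leave_path_space return_time_measurable return_stop])
    have fin: "AE x in Q 0. x \<in> leave c \<longrightarrow> return_time x = ereal (W x)"
      using c by (intro AE_return_finite) simp
    then show "AE x in Q 0. x \<in> leave c \<longrightarrow> 0 \<le> return_time x \<and> return_time x < \<infinity> \<and> x (real_of_ereal (return_time x)) = 0"
      by eventually_elim (use return_finiteD in \<open>force simp: leave_def\<close>)
    show "AE x in Q 0. x \<in> leave c \<longrightarrow> return_time x \<noteq> ereal r" for r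
      using atomless[of r] by eventually_elim (use leave_mono[OF c(2)] in auto)
    show "AE x in Q 0. x \<in> leave c \<longrightarrow> unit_hold (real_of_ereal (return_time x)) t x = unit_hold 0 t x"
      using fin
    proof eventually_elim
      case (elim x)
      show ?case
      proof
        assume x: "x \<in> leave c"
        then show "unit_hold (real_of_ereal (return_time x)) t x = unit_hold 0 t x"
          using unit_hold_after_return[OF _ c(2), of x "W x" t] elim
          by (auto simp: leave_def step_pathsD W_def[symmetric])
      qed
    qed
  qed
  finally show ?thesis
    by (simp add: A_def c_def[symmetric] Q0.emeasure_eq_measure W_def)
qed

lemma survival_from_away:
  assumes i: "i \<in> S" "i \<noteq> 0"
    and atomless: "\<And>r. AE x in Q i. hit_time x \<noteq> ereal r"
  shows "ennreal (measure (Q i) {x \<in> step_paths S. ereal t < kill_time 0 x}) =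
    (\<integral>\<^sup>+x. ennreal (s0 (t - R x)) \<partial>Q i)"
proof -
  interpret I: prob_space "Q i" by (rule prob[OF i(1)])
  have top: "step_paths S \<in> sets (path_space S)" using sets.top[of "path_space S"] by simp
  have fin: "AE x in Q i. x \<in> step_paths S \<and> hit_time x = ereal (R x)"
    using AE_step_path[OF i(1)] AE_hits[OF i(1)] by eventually_elim auto
  have "{x \<in> step_paths S. ereal t < kill_time 0 x} = {x \<in> step_paths S. \<not> unit_hold 0 t x}"
    using unit_hold_iff_kill[OF step_pathsD] by (auto simp: not_le[symmetric])
  then have "ennreal (measure (Q i) {x \<in> step_paths S. ereal t < kill_time 0 x}) =
      emeasure (Q i) {x \<in> step_paths S. \<not> unit_hold 0 t x}"
    by (simp add: I.emeasure_eq_measure)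
  also have "\<dots> = (\<integral>\<^sup>+x. indicator (step_paths S) x * ennreal (s0 (t - real_of_ereal (hit_time x))) \<partial>Q i)"
  proof (rule strong_markov[OF i(1) top hit_time_measurable])
    show "{x \<in> step_paths S. hit_time x < ereal b} \<in> sets (past S b)" for b
      by (intro hit_time_event) auto
    show "AE x in Q i. x \<in> step_paths S \<longrightarrow> 0 \<le> hit_time x \<and> hit_time x < \<infinity> \<and> x (real_of_ereal (hit_time x)) = 0"
      using fin
    proof eventually_elim
      case (elim x)
      then show ?case using hit_time_attained[OF step_pathsD, of x S "R x"] by auto
    qed
    show "AE x in Q i. x \<in> step_paths S \<longrightarrow> hit_time x \<noteq> ereal r" for r
      using atomless[of r] by eventually_elim auto
    show "AE x in Q i. x \<in> step_paths S \<longrightarrow> unit_hold (real_of_ereal (hit_time x)) t x = unit_hold 0 t x"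
      using fin
    proof eventually_elim
      case (elim x)
      then show ?case using unit_hold_after_hit[OF step_pathsD, of x S "R x" t] by auto
    qed
  qed
  also have "\<dots> = (\<integral>\<^sup>+x. ennreal (s0 (t - R x)) \<partial>Q i)"
    using AE_step_path[OF i(1)] by (intro nn_integral_cong_AE) (auto elim!: AE_mp simp: R_def)
  finally show ?thesis .
qed

text \<open>Split according to whether 0 has been left by time \<open>c\<close>. If not, the Markov
  property at \<open>c\<close> starts the path afresh with the return time reduced by
  \<open>c\<close>; the factor combines \<open>exp (\<theta> * c)\<close> with the probability
  \<open>exp (- q0 * c)\<close> of not having left.\<close>

lemma leave_moment_add:
  assumes c: "0 \<le> c" "0 \<le> d"
  shows "leave_moment \<theta> (c + d) = leave_moment \<theta> c + ennreal (exp ((\<theta> - q0) * c)) * leave_moment \<theta> d"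
proof -
  define E where "E = {x \<in> step_paths S. zero_on x 0 c}"
  have E: "E \<in> sets (past S c)" unfolding E_def by (intro zero_on_event) auto
  have E0: "E \<inter> {x \<in> step_paths S. x c = 0} = E" using c by (auto simp: E_def zero_on_def)
  define h where "h x = indicator (leave d) x * ennreal (exp (\<theta> * W x))" for x
  have h: "h \<in> borel_measurable (path_space S)"
    unfolding h_def W_def using return_time_measurable leave_path_space by measurable
  have hs: "(\<lambda>x. h (shift c x)) \<in> borel_measurable (Q 0)"
    unfolding measurable_Q[OF zero_state] using measurable_shift[OF c(1)] h by (rule measurable_compose)
  have EQ: "E \<in> sets (Q 0)" using E past_sub[OF zero_state] by blast
  have "leave_moment \<theta> (c + d) = (\<integral>\<^sup>+x. indicator (leave c) x * ennreal (exp (\<theta> * W x)) +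
      ennreal (exp (\<theta> * c)) * (indicator E x * h (shift c x)) \<partial>Q 0)"
    unfolding leave_moment_def
  proof (rule nn_integral_cong_AE)
    have "0 \<le> c + d" using c by simp
    from AE_return_finite[OF this] AE_step_path[OF zero_state]
    show "AE x in Q 0. indicator (leave (c + d)) x * ennreal (exp (\<theta> * W x)) =
      indicator (leave c) x * ennreal (exp (\<theta> * W x)) + ennreal (exp (\<theta> * c)) * (indicator E x * h (shift c x))"
    proof eventually_elim
      case (elim x)
      show ?case
      proof (cases "x \<in> E")
        case False
        then have "x \<in> leave c" using elim by (auto simp: E_def leave_def)
        then show ?thesis using False leave_mono[of c "c + d"] c by (auto simp: indicator_def)
      next
        case True
        then have nl: "x \<notin> leave c" by (auto simp: E_def leave_def)
        have "zero_on x 0 (c + d) \<longleftrightarrow> zero_on x c (c + d)"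
          using True unfolding E_def zero_on_def by (metis (no_types, lifting) True E_def atLeastAtMost_iff c(1) linear mem_Collect_eq order_trans zero_onD)
        then have sh: "x \<in> leave (c + d) \<longleftrightarrow> shift c x \<in> leave d"
          using elim shift_in_step_paths[of x S c] c by (auto simp: leave_def zero_on_shift)
        show ?thesis
        proof (cases "x \<in> leave (c + d)")
          case l: True
          have "return_time (shift c x) = ereal (W x - c)"
            using True elim l by (intro return_time_shift(2)[OF step_pathsD[of x S] c(1)]) (auto simp: E_def)
          then have "W x = c + W (shift c x)" by (simp add: W_def[of "shift c x"])
          then show ?thesis using True l nl sh
            by (simp add: h_def ennreal_mult' exp_add distrib_left)
        qed (use sh nl in \<open>simp add: h_def\<close>)
      qed
    qed
  qed
  also have "\<dots> = leave_moment \<theta> c + ennreal (exp (\<theta> * c)) * (\<integral>\<^sup>+x. indicator E x * h (shift c x) \<partial>Q 0)"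
    unfolding leave_moment_def using EQ hs zero_state
    by (subst nn_integral_add) (auto intro!: nn_integral_cmult)
  also have "(\<integral>\<^sup>+x. indicator E x * h (shift c x) \<partial>Q 0) = emeasure (Q 0) E * leave_moment \<theta> d"
    using markov_nn_integral[OF zero_state zero_state c(1) E h] by (simp add: E0 leave_moment_def h_def)
  also have "emeasure (Q 0) E = ennreal (exp (- q0 * c))"
    using zero_on_prob[OF c(1)] by (simp add: E_def Q0.emeasure_eq_measure)
  also have "ennreal (exp (\<theta> * c)) * (ennreal (exp (- q0 * c)) * leave_moment \<theta> d) = ennreal (exp ((\<theta> - q0) * c)) * leave_moment \<theta> d"
    by (simp add: mult.assoc[symmetric] ennreal_mult'[symmetric] exp_add[symmetric] algebra_simps)
  finally show ?thesis .
qed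

text \<open>The first excursion from 0 is in \<open>i\<close> at time \<open>s\<close>, and
  \<open>H\<^sup>1 < 1\<close>. The second condition is known at time \<open>s\<close> only if
  \<open>s \<ge> 1\<close>; for \<open>s < 1\<close> and \<open>i \<noteq> 0\<close> it follows from
  being away from 0 at \<open>s\<close>.\<close>

definition away_at :: "real \<Rightarrow> nat \<Rightarrow> (real \<Rightarrow> nat) set" where
  "away_at s i = {x \<in> step_paths S. \<not> return_time x < ereal s \<and> (s < 1 \<or> hold_time x < 1)} \<inter> {x \<in> step_paths S. x s = i}"

lemma away_at_past:
  "{x \<in> step_paths S. \<not> return_time x < ereal s \<and> (s < 1 \<or> hold_time x < 1)} \<in> sets (past S s)"
proof -
  have "space (past S s) - {x \<in> step_paths S. return_time x < ereal s} \<in> sets (past S s)"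
    by (intro sets.compl_sets return_time_event) auto
  moreover have "{x \<in> step_paths S. hold_time x < 1} \<in> sets (past S s)" if "\<not> s < 1"
    unfolding one_ereal_def using that by (intro hold_time_event) auto
  ultimately have "(space (past S s) - {x \<in> step_paths S. return_time x < ereal s}) \<inter>
      (if s < 1 then space (past S s) else {x \<in> step_paths S. hold_time x < 1}) \<in> sets (past S s)"
    using sets.top[of "past S s"] by (intro sets.Int) auto
  moreover have "(space (past S s) - {x \<in> step_paths S. return_time x < ereal s}) \<inter>
      (if s < 1 then space (past S s) else {x \<in> step_paths S. hold_time x < 1}) =
      {x \<in> step_paths S. \<not> return_time x < ereal s \<and> (s < 1 \<or> hold_time x < 1)}"
    by auto
  ultimately show ?thesis by (simp only:)
qed

lemma away_at_event: "0 \<le> s \<Longrightarrow> away_at s i \<in> sets (path_space S)"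
  unfolding away_at_def using away_at_past[of s] sets_paths_mono[of "{0..s}" "{0..}" S]
  by (intro sets.Int coord_event) auto

text \<open>By \<open>last_zero\<close>, a path that is in \<open>i\<close> at time \<open>s\<close>
  lies, after a shift by some rational \<open>r\<close> with the path at 0, in
  \<open>away_at (s - r) i\<close>. If these events were all null, countably many null events would
  cover reaching \<open>i\<close>, against irreducibility.\<close>

lemma away_at_positive:
  assumes i: "i \<in> S" "i \<noteq> 0"
  obtains s where "0 \<le> s" "measure (Q 0) (away_at s i) > 0"
proof (rule ccontr)
  assume "\<not> thesis"
  with that have "\<not> 0 < measure (Q 0) (away_at s i)" if "0 \<le> s" for s
    using that by blast
  then have null: "measure (Q 0) (away_at s i) = 0" if "0 \<le> s" for s
    using that by (simp add: zero_less_measure_iff)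
  obtain s where s: "0 \<le> s" "measure (Q 0) (cyl S {(s, i)}) > 0" using irreducible[OF i(1)] by blast
  have top: "step_paths S \<in> sets (past S r)" for r using sets.top[of "past S r"] by simp
  define N where "N r = step_paths S \<inter> {x \<in> step_paths S. x r = 0} \<inter> {x \<in> step_paths S. shift r x \<in> away_at (s - r) i}" for r
  have "AE x in Q 0. \<forall>r\<in>{r \<in> \<rat>. 0 \<le> r \<and> r < s}. x \<notin> N r"
  proof (subst AE_ball_countable)
    show "countable {r \<in> \<rat>. 0 \<le> r \<and> r < s}"
      by (rule countable_subset[OF _ countable_rat]) auto
    show "\<forall>r\<in>{r \<in> \<rat>. 0 \<le> r \<and> r < s}. AE x in Q 0. x \<notin> N r"
    proof
      fix r assume "r \<in> {r \<in> \<rat>. 0 \<le> r \<and> r < s}"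
      then have r: "0 \<le> r" "0 \<le> s - r" by auto
      have "measure (Q 0) (N r) = 0"
        using markov[OF zero_state zero_state r(1) top away_at_event[OF r(2)]] null[OF r(2)]
        by (simp add: N_def)
      moreover have "N r \<in> sets (Q 0)"
      proof -
        have "shift r -` away_at (s - r) i \<inter> space (path_space S) \<in> sets (path_space S)"
          by (intro measurable_sets[OF measurable_shift[OF r(1)]] away_at_event r)
        then have "{x \<in> step_paths S. x r = 0} \<inter> (shift r -` away_at (s - r) i \<inter> space (path_space S)) \<in> sets (path_space S)"
          using r by (intro sets.Int[OF coord_event]) auto
        moreover have "{x \<in> step_paths S. x r = 0} \<inter> (shift r -` away_at (s - r) i \<inter> space (path_space S)) = N r"
          by (auto simp: N_def)
        ultimately show ?thesis by (intro event_Q zero_state) (simp only:)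
      qed
      ultimately show "AE x in Q 0. x \<notin> N r"
        by (intro AE_not_in) (auto simp: null_sets_def Q0.emeasure_eq_measure)
    qed
  qed
  with start[OF zero_state] AE_step_path[OF zero_state]
  have "AE x in Q 0. x \<notin> cyl S {(s, i)}"
  proof eventually_elim
    case (elim x)
    show ?case
    proof
      assume x: "x \<in> cyl S {(s, i)}"
      then have xs: "x s \<noteq> 0" "x s = i" using i by (auto simp: cyl_def)
      obtain r where r: "r \<in> \<rat>" "0 \<le> r" "r < s" "x r = 0" "hold_time (shift r x) < 1"
        "\<not> return_time (shift r x) < ereal (s - r)"
        by (rule last_zero[OF step_pathsD[OF elim(2)] s(1) elim(1) xs(1)]) (rule that)
      have "shift r x \<in> away_at (s - r) i"
        using r xs shift_in_step_paths[OF elim(2) r(2)] by (auto simp: away_at_def shift_def)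
      then have "x \<in> N r" using elim(2) r by (auto simp: N_def)
      then show False using elim(3) r by auto
    qed
  qed
  then have "measure (Q 0) (cyl S {(s, i)}) = 0"
    by (rule measure_eq_0_of_AE)
  then show False using s by simp
qed

text \<open>On \<open>away_at s i\<close> the return time is \<open>s\<close> plus the hitting time
  of the shifted path. By the Markov property a positive multiple of the hitting moment from
  \<open>i\<close> is therefore at most the finite return moment.\<close>

lemma hit_moment_finite:
  assumes i: "i \<in> S" "i \<noteq> 0" and fin: "leave_moment \<theta> 1 < \<infinity>"
  shows "(\<integral>\<^sup>+x. ennreal (exp (\<theta> * R x)) \<partial>Q i) < \<infinity>"
proof -
  obtain s where s: "0 \<le> s" "measure (Q 0) (away_at s i) > 0"
    by (rule away_at_positive[OF i]) (rule that)
  define F where "F = (\<integral>\<^sup>+x. ennreal (exp (\<theta> * R x)) \<partial>Q i)"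
  have m: "(\<lambda>x. ennreal (exp (\<theta> * R x))) \<in> borel_measurable (path_space S)" by measurable
  have "ennreal (exp (\<theta> * s)) * (emeasure (Q 0) (away_at s i) * F) =
      ennreal (exp (\<theta> * s)) * (\<integral>\<^sup>+x. indicator (away_at s i) x * ennreal (exp (\<theta> * R (shift s x))) \<partial>Q 0)"
    unfolding F_def away_at_def using markov_nn_integral[OF zero_state i(1) s(1) away_at_past m] by simp
  also have "\<dots> = (\<integral>\<^sup>+x. ennreal (exp (\<theta> * s)) * (indicator (away_at s i) x * ennreal (exp (\<theta> * R (shift s x)))) \<partial>Q 0)"
  proof (rule nn_integral_cmult[symmetric])
    have "(\<lambda>x. ennreal (exp (\<theta> * R (shift s x)))) \<in> borel_measurable (Q 0)"
      unfolding measurable_Q[OF zero_state] using measurable_shift[OF s(1)] m by (rule measurable_compose)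
    then show "(\<lambda>x. indicator (away_at s i) x * ennreal (exp (\<theta> * R (shift s x)))) \<in> borel_measurable (Q 0)"
      using event_Q[OF zero_state away_at_event[OF s(1)]] by measurable
  qed
  also have "\<dots> \<le> leave_moment \<theta> 1"
    unfolding leave_moment_def
  proof (rule nn_integral_mono_AE)
    show "AE x in Q 0. ennreal (exp (\<theta> * s)) * (indicator (away_at s i) x * ennreal (exp (\<theta> * R (shift s x))))
        \<le> indicator (leave 1) x * ennreal (exp (\<theta> * W x))"
      using AE_return_finite[of 1, simplified]
    proof eventually_elim
      case (elim x)
      show ?case
      proof (cases "x \<in> away_at s i")
        case True
        then have x: "x \<in> step_paths S" "x s \<noteq> 0" "\<not> return_time x < ereal s" "s < 1 \<or> hold_time x < 1"
          using i by (auto simp: away_at_def)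
        have "x \<in> leave 1"
        proof (cases "s < 1")
          case True
          then show ?thesis using x s by (auto simp: leave_def zero_on_def)
        next
          case False
          then have "hold_time x < ereal 1" using x by (simp add: one_ereal_def)
          then obtain r where "0 \<le> r" "r < 1" "x r \<noteq> 0"
            unfolding hold_time_less_iff[OF step_pathsD[OF x(1)]] by auto
          then show ?thesis using x by (auto simp: leave_def zero_on_def)
        qed
        then have "hit_time (shift s x) = ereal (W x - s)"
          using return_time_before_shift(1)[OF step_pathsD[OF x(1)] s(1) order_refl x(2,2,3)] elim by simp
        then have "W x = s + R (shift s x)" by (simp add: R_def)
        then show ?thesis
          using True \<open>x \<in> leave 1\<close> by (simp add: ennreal_mult' exp_add distrib_left)
      qed simp
    qed
  qed
  finally have "ennreal (exp (\<theta> * s)) * (emeasure (Q 0) (away_at s i) * F) < \<infinity>"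
    using fin by (rule le_less_trans)
  moreover have "emeasure (Q 0) (away_at s i) \<noteq> 0"
    using s by (simp add: Q0.emeasure_eq_measure)
  ultimately have "F \<noteq> \<infinity>"
    by (auto simp: ennreal_mult_top ennreal_top_mult)
  then show ?thesis
    by (simp add: F_def less_top)
qed

end

section \<open>Exponential tilting and the limit\<close>

text \<open>Cauchy's functional equation: additivity settles fractions and monotonicity squeezes the
  rest. It serves the degenerate case \<open>l = 0\<close> of
  \<open>exponential_cocycle\<close>.\<close>

lemma monotone_additive_on_unit:
  fixes a :: "real \<Rightarrow> real"
  assumes add: "\<And>x y. 0 \<le> x \<Longrightarrow> 0 \<le> y \<Longrightarrow> x + y \<le> 1 \<Longrightarrow> a (x + y) = a x + a y"
    and mono: "\<And>x y. 0 \<le> x \<Longrightarrow> x \<le> y \<Longrightarrow> y \<le> 1 \<Longrightarrow> a x \<le> a y"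
    and one: "a 1 = 1" and c: "0 \<le> c" "c \<le> 1"
  shows "a c = c"
proof -
  have a0: "a 0 = 0" using add[of 0 0] by simp
  have mult: "a (real k / real n) = real k * a (1 / real n)" if "0 < n" "k \<le> n" for k n :: nat
    using that(2)
  proof (induction k)
    case (Suc k)
    have "a (real k / real n + 1 / real n) = a (real k / real n) + a (1 / real n)"
      using Suc.prems that(1) by (intro add) (auto simp: field_simps)
    then show ?case using Suc by (simp add: add_divide_distrib algebra_simps)
  qed (simp add: a0)
  have rat: "a (real k / real n) = real k / real n" if "0 < n" "k \<le> n" for k n :: nat
  proof -
    have "real n * a (1 / real n) = 1" using mult[OF that(1) order_refl] that one by simp
    then have "a (1 / real n) = 1 / real n" using that by (simp add: field_simps)
    then show ?thesis using mult[OF that] by simp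
  qed
  have near: "\<bar>a c - c\<bar> \<le> 1 / real (Suc m)" for m
  proof (cases "c = 1")
    case False
    define n where "n = Suc m"
    define k where "k = nat \<lfloor>c * real n\<rfloor>"
    have "0 \<le> c * real n" using c by simp
    then have k: "real k \<le> c * real n" "c * real n < real k + 1"
      unfolding k_def by linarith+
    have "c * real n < 1 * real n" using c False by (intro mult_strict_right_mono) (auto simp: n_def)
    then have kn: "Suc k \<le> n" using k(1) by linarith
    have n: "0 < n" by (simp add: n_def)
    have l: "real k / real n \<le> c" and u: "c \<le> real (Suc k) / real n" "real (Suc k) / real n \<le> 1"
      using k kn n by (auto simp: field_simps)
    have "real k / real n \<le> a c" "a c \<le> real (Suc k) / real n"
      using mono[OF _ l c(2)] mono[OF c(1) u] rat[OF n, of k] rat[OF n kn] kn by auto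
    then have "\<bar>a c - c\<bar> \<le> real (Suc k) / real n - real k / real n" using l u(1) by linarith
    also have "\<dots> = 1 / real n" by (simp add: diff_divide_distrib[symmetric])
    finally show ?thesis by (simp add: n_def)
  qed (use one in simp)
  have "\<bar>a c - c\<bar> \<le> 0"
    by (rule LIMSEQ_le_const[OF LIMSEQ_inverse_real_of_nat]) (use near in \<open>auto simp: inverse_eq_divide\<close>)
  then show ?thesis by simp
qed

lemma integral_exp_linear:
  fixes l c :: real
  assumes "0 \<le> c"
  shows "integral {0..c} (\<lambda>s. exp (l * s)) = (if l = 0 then c else (exp (l * c) - 1) / l)"
proof (cases "l = 0")
  case False
  have "((\<lambda>s. exp (l * s)) has_integral (exp (l * c) / l - exp (l * 0) / l)) {0..c}"
    using assms False
    by (intro fundamental_theorem_of_calculus)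
       (auto intro!: derivative_eq_intros simp: has_real_derivative_iff_has_vector_derivative[symmetric])
  then show ?thesis using False by (simp add: integral_unique diff_divide_distrib)
qed (use assms in simp)

text \<open>Adding \<open>c\<close> and \<open>1 - c\<close> in both orders gives two linear
  equations for \<open>a c\<close> and \<open>a (1 - c)\<close>. They are independent for
  \<open>l \<noteq> 0\<close>; for \<open>l = 0\<close> they coincide, and monotonicity has to
  decide.\<close>

lemma exponential_cocycle:
  fixes a :: "real \<Rightarrow> real"
  assumes add: "\<And>x y. 0 \<le> x \<Longrightarrow> 0 \<le> y \<Longrightarrow> x + y \<le> 1 \<Longrightarrow> a (x + y) = a x + exp (l * x) * a y"
    and mono: "\<And>x y. 0 \<le> x \<Longrightarrow> x \<le> y \<Longrightarrow> y \<le> 1 \<Longrightarrow> a x \<le> a y"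
    and one: "a 1 = 1" and c: "0 \<le> c" "c \<le> 1"
  shows "a c = integral {0..c} (\<lambda>s. exp (l * s)) / integral {0..1} (\<lambda>s. exp (l * s))"
proof (cases "l = 0")
  case True
  then have "a c = c" using add by (intro monotone_additive_on_unit[of a c] mono one c) auto
  then show ?thesis using c True by simp
next
  case False
  have 1: "a c + exp (l * c) * a (1 - c) = 1" using add[of c "1 - c"] c one by simp
  have 2: "a (1 - c) + exp (l * (1 - c)) * a c = 1" using add[of "1 - c" c] c one by simp
  have "exp (l * c) * exp (l * (1 - c)) = exp l" by (simp add: exp_add[symmetric] algebra_simps)
  moreover have "a (1 - c) = 1 - exp (l * (1 - c)) * a c" using 2 by simp
  ultimately have "a c + exp (l * c) - exp l * a c = 1"
    using 1 by (simp add: right_diff_distrib mult.assoc[symmetric])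
  then have "a c * (exp l - 1) = exp (l * c) - 1" by (simp add: algebra_simps)
  moreover have "exp l \<noteq> 1" using False by simp
  ultimately have "a c = (exp (l * c) - 1) / (exp l - 1)" by (simp add: field_simps)
  then show ?thesis using False c by (simp add: integral_exp_linear)
qed

text \<open>The left difference quotients at \<phi> are the integrals of
  \<open>g n v = (1 - exp (- h n * v)) / h n\<close>, which are at most \<open>v\<close> and tend to
  \<open>v\<close>. The bound gives that \<open>D\<close> is at most the mean, and Fatou's lemma
  gives the converse.\<close>

lemma (in renewal_law) mean_eq_left_derivative:
  assumes deriv: "((\<lambda>x. enn2real (\<integral>\<^sup>+v. ennreal (exp ((x - \<phi>) * v)) \<partial>\<mu>)) has_real_derivative D) (at_left \<phi>)"
  shows "0 \<le> D" "(\<integral>\<^sup>+v. ennreal v \<partial>\<mu>) = ennreal D"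
proof -
  define L where "L x = enn2real (\<integral>\<^sup>+v. ennreal (exp ((x - \<phi>) * v)) \<partial>\<mu>)" for x
  define h where "h n = 1 / real (Suc n)" for n
  have h: "0 < h n" for n by (simp add: h_def)
  define g where "g n v = (1 - exp (- h n * v)) / h n" for n v
  have g_le: "g n v \<le> v" for n v
    using exp_ge_add_one_self[of "- h n * v"] h[of n] by (simp add: g_def field_simps)
  have g_nonneg: "AE v in \<mu>. 0 \<le> g n v" for n
    using law_pos by eventually_elim (use h[of n] in \<open>simp add: g_def\<close>)
  have h0: "h \<longlonglongrightarrow> 0"
    using LIMSEQ_inverse_real_of_nat by (simp add: h_def[abs_def] inverse_eq_divide)
  have "filterlim (\<lambda>n. \<phi> - h n) (at_left \<phi>) sequentially"
    unfolding filterlim_at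
  proof
    show "eventually (\<lambda>n. \<phi> - h n \<in> {..<\<phi>} \<and> \<phi> - h n \<noteq> \<phi>) sequentially"
      using h by (intro always_eventually) (auto simp: less_imp_neq)
    have "(\<lambda>n. \<phi> - h n) \<longlonglongrightarrow> \<phi> - 0" by (intro tendsto_intros h0)
    then show "(\<lambda>n. \<phi> - h n) \<longlonglongrightarrow> \<phi>" by simp
  qed
  moreover have "((\<lambda>y. (L y - L \<phi>) / (y - \<phi>)) \<longlongrightarrow> D) (at_left \<phi>)"
    using deriv by (simp add: has_field_derivative_iff L_def)
  ultimately have lim: "(\<lambda>n. (L (\<phi> - h n) - L \<phi>) / ((\<phi> - h n) - \<phi>)) \<longlonglongrightarrow> D"
    by (rule filterlim_compose[rotated])
  have int: "integrable \<mu> (\<lambda>v. exp (- h n * v))" for n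
  proof (rule integrable_const_bound[of _ 1])
    show "AE v in \<mu>. norm (exp (- h n * v)) \<le> 1"
      using law_pos by eventually_elim (use h[of n] in simp)
  qed measurable
  have quot: "(\<integral>\<^sup>+v. ennreal (g n v) \<partial>\<mu>) = ennreal ((L (\<phi> - h n) - L \<phi>) / ((\<phi> - h n) - \<phi>))" for n
  proof -
    have 1: "L \<phi> = 1" using emeasure_space_1 by (simp add: L_def)
    have 2: "L (\<phi> - h n) = (\<integral>v. exp (- h n * v) \<partial>\<mu>)"
      using nn_integral_eq_integral[OF int[of n]] by (simp add: L_def)
    have "(\<integral>v. g n v \<partial>\<mu>) = (\<integral>v. 1 - exp (- h n * v) \<partial>\<mu>) / h n"
      by (simp add: g_def)
    also have "(\<integral>v. 1 - exp (- h n * v) \<partial>\<mu>) = 1 - L (\<phi> - h n)"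
      unfolding 2 using prob_space by (subst Bochner_Integration.integral_diff[OF _ int]) simp_all
    finally have "(\<integral>v. g n v \<partial>\<mu>) = (L (\<phi> - h n) - L \<phi>) / ((\<phi> - h n) - \<phi>)"
      using h[of n] 1 by (simp add: field_simps)
    moreover have "integrable \<mu> (g n)"
      unfolding g_def using int[of n] by (intro integrable_divide Bochner_Integration.integrable_diff) auto
    ultimately show ?thesis
      using nn_integral_eq_integral[of \<mu> "g n"] g_nonneg by simp
  qed
  have limE: "(\<lambda>n. \<integral>\<^sup>+v. ennreal (g n v) \<partial>\<mu>) \<longlonglongrightarrow> ennreal D"
    unfolding quot by (intro tendsto_ennrealI lim)
  have "(\<integral>\<^sup>+v. ennreal v \<partial>\<mu>) = (\<integral>\<^sup>+v. liminf (\<lambda>n. ennreal (g n v)) \<partial>\<mu>)"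
  proof (rule nn_integral_cong)
    fix v
    have "((\<lambda>y. exp (- v * y)) has_real_derivative exp (- v * 0) * - v) (at 0)"
      by (auto intro!: derivative_eq_intros)
    then have "((\<lambda>y. (exp (- v * y) - 1) / y) \<longlongrightarrow> - v) (at 0)"
      by (simp add: has_field_derivative_iff)
    moreover have "filterlim h (at 0) sequentially"
      unfolding filterlim_at using h0 h by (auto simp: less_imp_neq[symmetric] intro!: always_eventually)
    ultimately have "(\<lambda>n. (exp (- v * h n) - 1) / h n) \<longlonglongrightarrow> - v"
      by (rule filterlim_compose)
    then have "(\<lambda>n. - ((exp (- v * h n) - 1) / h n)) \<longlonglongrightarrow> - (- v)" by (rule tendsto_minus)
    then have "(\<lambda>n. g n v) \<longlonglongrightarrow> v" by (simp add: g_def minus_divide_left mult.commute)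
    then have "(\<lambda>n. ennreal (g n v)) \<longlonglongrightarrow> ennreal v" by (rule tendsto_ennrealI)
    from lim_imp_Liminf[OF _ this] show "ennreal v = liminf (\<lambda>n. ennreal (g n v))" by simp
  qed
  also have "\<dots> \<le> liminf (\<lambda>n. \<integral>\<^sup>+v. ennreal (g n v) \<partial>\<mu>)"
    unfolding g_def by (intro nn_integral_liminf) measurable
  also have "\<dots> = ennreal D" using lim_imp_Liminf[OF _ limE] by simp
  finally have le: "(\<integral>\<^sup>+v. ennreal v \<partial>\<mu>) \<le> ennreal D" .
  moreover have "ennreal D \<le> (\<integral>\<^sup>+v. ennreal v \<partial>\<mu>)"
    by (rule LIMSEQ_le_const2[OF limE]) (auto intro!: nn_integral_mono ennreal_leI g_le)
  ultimately show "(\<integral>\<^sup>+v. ennreal v \<partial>\<mu>) = ennreal D" by (rule antisym)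
  show "0 \<le> D"
  proof (rule LIMSEQ_le_const[OF lim], intro exI allI impI)
    fix n :: nat
    have "L (\<phi> - h n) \<le> 1"
    proof -
      have "(\<integral>\<^sup>+v. ennreal (exp ((\<phi> - h n - \<phi>) * v)) \<partial>\<mu>) \<le> (\<integral>\<^sup>+v. 1 \<partial>\<mu>)"
        using law_pos
        by (intro nn_integral_mono_AE) (auto elim!: AE_mp simp: h less_imp_le)
      then show ?thesis unfolding L_def using emeasure_space_1 by (simp add: enn2real_leI)
    qed
    moreover have "L \<phi> = 1" using emeasure_space_1 by (simp add: L_def)
    ultimately show "0 \<le> (L (\<phi> - h n) - L \<phi>) / (\<phi> - h n - \<phi>)"
      using h[of n] by (simp add: divide_nonpos_pos)
  qed
qed

text \<open>Write \<open>exp (\<phi> * t)\<close> as \<open>exp (\<phi> * T x)\<close> times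
  \<open>exp (\<phi> * (t - T x))\<close>. The first factor has the finite integral \<open>m\<close>
  over \<open>A\<close>; the second, multiplied by \<open>s (t - T x)\<close>, is bounded and tends
  to \<kappa>. Dominated convergence concludes, for starts in \<open>(0,u)\<close> and away from 0
  alike.\<close>

lemma exponential_limit:
  fixes s :: "real \<Rightarrow> real"
  assumes A: "A \<in> sets M" and T [measurable]: "T \<in> borel_measurable M"
    and s [measurable]: "s \<in> borel_measurable borel" and s0: "\<And>t. 0 \<le> s t"
    and bnd: "\<And>t. exp (\<phi> * t) * s t \<le> B"
    and lim: "((\<lambda>t. exp (\<phi> * t) * s t) \<longlongrightarrow> \<kappa>) at_top"
    and m: "(\<integral>\<^sup>+x. indicator A x * ennreal (exp (\<phi> * T x)) \<partial>M) = ennreal m" "0 \<le> m"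
    and v: "\<And>t. 1 \<le> t \<Longrightarrow> ennreal (v t) = (\<integral>\<^sup>+x. indicator A x * ennreal (s (t - T x)) \<partial>M)" "\<And>t. 0 \<le> v t"
  shows "((\<lambda>t. exp (\<phi> * t) * v t) \<longlongrightarrow> m * \<kappa>) at_top"
proof -
  have [measurable]: "A \<in> sets M" by (rule A)
  have \<kappa>0: "0 \<le> \<kappa>"
    by (rule tendsto_lowerbound[OF lim]) (use s0 in auto)
  have eq: "ennreal (exp (\<phi> * t) * v t) =
      (\<integral>\<^sup>+x. (indicator A x * ennreal (exp (\<phi> * T x))) * ennreal (exp (\<phi> * (t - T x)) * s (t - T x)) \<partial>M)"
    if "1 \<le> t" for t
  proof -
    have "ennreal (exp (\<phi> * t) * v t) = ennreal (exp (\<phi> * t)) * (\<integral>\<^sup>+x. indicator A x * ennreal (s (t - T x)) \<partial>M)"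
      using v(1)[OF that] by (simp add: ennreal_mult')
    also have "\<dots> = (\<integral>\<^sup>+x. ennreal (exp (\<phi> * t)) * (indicator A x * ennreal (s (t - T x))) \<partial>M)"
      by (intro nn_integral_cmult[symmetric]) measurable
    also have "\<dots> = (\<integral>\<^sup>+x. (indicator A x * ennreal (exp (\<phi> * T x))) * ennreal (exp (\<phi> * (t - T x)) * s (t - T x)) \<partial>M)"
    proof (rule nn_integral_cong)
      fix x
      have "exp (\<phi> * t) = exp (\<phi> * T x) * exp (\<phi> * (t - T x))"
        by (simp add: exp_add[symmetric] algebra_simps)
      then show "ennreal (exp (\<phi> * t)) * (indicator A x * ennreal (s (t - T x))) =
          (indicator A x * ennreal (exp (\<phi> * T x))) * ennreal (exp (\<phi> * (t - T x)) * s (t - T x))"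
        by (simp add: ennreal_mult' s0 mult_ac)
    qed
    finally show ?thesis .
  qed
  show ?thesis
  proof (rule tendsto_at_topI_sequentially)
    fix X :: "nat \<Rightarrow> real" assume X: "filterlim X at_top sequentially"
    have B0: "0 \<le> B" using bnd[of 0] s0[of 0] by simp
    have "(\<lambda>n. \<integral>\<^sup>+x. (indicator A x * ennreal (exp (\<phi> * T x))) * ennreal (exp (\<phi> * (X n - T x)) * s (X n - T x)) \<partial>M)
        \<longlonglongrightarrow> (\<integral>\<^sup>+x. (indicator A x * ennreal (exp (\<phi> * T x))) * ennreal \<kappa> \<partial>M)"
    proof (rule nn_integral_dominated_convergence[where w = "\<lambda>x. (indicator A x * ennreal (exp (\<phi> * T x))) * ennreal B"])
      show "AE x in M. (indicator A x * ennreal (exp (\<phi> * T x))) * ennreal (exp (\<phi> * (X n - T x)) * s (X n - T x))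
          \<le> (indicator A x * ennreal (exp (\<phi> * T x))) * ennreal B" for n
        using bnd by (intro AE_I2 mult_left_mono ennreal_leI) auto
      show "(\<integral>\<^sup>+x. (indicator A x * ennreal (exp (\<phi> * T x))) * ennreal B \<partial>M) < \<infinity>"
        by (subst nn_integral_multc) (simp_all add: m ennreal_mult_less_top)
      show "AE x in M. (\<lambda>n. (indicator A x * ennreal (exp (\<phi> * T x))) * ennreal (exp (\<phi> * (X n - T x)) * s (X n - T x)))
          \<longlonglongrightarrow> (indicator A x * ennreal (exp (\<phi> * T x))) * ennreal \<kappa>"
      proof (rule AE_I2)
        fix x
        have "filterlim (\<lambda>n. X n - T x) at_top sequentially"
          using filterlim_tendsto_add_at_top[OF tendsto_const[of "- T x"] X] by simp
        from filterlim_compose[OF lim this]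
        have "(\<lambda>n. exp (\<phi> * (X n - T x)) * s (X n - T x)) \<longlonglongrightarrow> \<kappa>" .
        then show "(\<lambda>n. (indicator A x * ennreal (exp (\<phi> * T x))) * ennreal (exp (\<phi> * (X n - T x)) * s (X n - T x)))
          \<longlonglongrightarrow> (indicator A x * ennreal (exp (\<phi> * T x))) * ennreal \<kappa>"
          by (intro ennreal_tendsto_cmult tendsto_ennrealI) (auto simp: indicator_def)
      qed
    qed measurable
    also have "(\<integral>\<^sup>+x. (indicator A x * ennreal (exp (\<phi> * T x))) * ennreal \<kappa> \<partial>M) = ennreal (m * \<kappa>)"
      by (subst nn_integral_multc) (use m \<kappa>0 in \<open>simp_all add: ennreal_mult'\<close>)
    finally have "(\<lambda>n. \<integral>\<^sup>+x. (indicator A x * ennreal (exp (\<phi> * T x))) * ennreal (exp (\<phi> * (X n - T x)) * s (X n - T x)) \<partial>M)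
        \<longlonglongrightarrow> ennreal (m * \<kappa>)" .
    moreover have "eventually (\<lambda>n. 1 \<le> X n) sequentially"
      using X unfolding filterlim_at_top by blast
    then have "eventually (\<lambda>n. (\<integral>\<^sup>+x. (indicator A x * ennreal (exp (\<phi> * T x))) * ennreal (exp (\<phi> * (X n - T x)) * s (X n - T x)) \<partial>M)
        = ennreal (exp (\<phi> * X n) * v (X n))) sequentially"
      by eventually_elim (simp add: eq)
    ultimately have "(\<lambda>n. ennreal (exp (\<phi> * X n) * v (X n))) \<longlonglongrightarrow> ennreal (m * \<kappa>)"
      by (rule Lim_transform_eventually)
    then show "(\<lambda>n. exp (\<phi> * X n) * v (X n)) \<longlonglongrightarrow> m * \<kappa>"
      by (rule tendsto_ennrealD) (use v m \<kappa>0 in auto)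
  qed
qed

section \<open>The tilted return law, and the limits for all initial states\<close>

locale tilted_chain = killed_chain +
  fixes \<phi> D :: real
  assumes atomless_return: "\<And>r. AE x in Q 0. x \<in> leave 1 \<longrightarrow> return_time x \<noteq> ereal r"
    and tilt: "leave_moment \<phi> 1 = 1"
    and left_deriv: "((\<lambda>\<theta>. enn2real (leave_moment \<theta> 1)) has_real_derivative D) (at_left \<phi>)"
begin

definition \<mu> :: "real measure" where
  "\<mu> = distr (density (Q 0) (\<lambda>x. indicator (leave 1) x * ennreal (exp (\<phi> * W x)))) borel W"

lemma W_Q0 [measurable]: "W \<in> borel_measurable (Q 0)"
  by (rule W_measurable) (rule zero_state)

lemma nn_integral_\<mu>:
  assumes [measurable]: "f \<in> borel_measurable borel"
  shows "(\<integral>\<^sup>+v. f v \<partial>\<mu>) = (\<integral>\<^sup>+x. indicator (leave 1) x * ennreal (exp (\<phi> * W x)) * f (W x) \<partial>Q 0)"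
  unfolding \<mu>_def by (subst nn_integral_distr) (auto intro: nn_integral_density)

lemma AE_W: "AE x in Q 0. x \<in> leave 1 \<longrightarrow> 0 < W x \<and> return_time x = ereal (W x)"
  using AE_return_finite[of 1, simplified] AE_step_path[OF zero_state]
  by eventually_elim (use return_finiteD in auto)

sublocale \<mu>: renewal_law \<mu>
proof (intro renewal_law.intro renewal_law_axioms.intro)
  have sets: "sets \<mu> = sets borel" by (simp add: \<mu>_def)
  show "sets \<mu> = sets borel" by fact
  have em: "emeasure \<mu> A = (\<integral>\<^sup>+x. indicator (leave 1) x * ennreal (exp (\<phi> * W x)) * indicator A (W x) \<partial>Q 0)"
    if "A \<in> sets borel" for A
    using nn_integral_\<mu>[of "indicator A"] that sets by simp
  show "prob_space \<mu>"
  proof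
    have "space \<mu> = UNIV" using sets_eq_imp_space_eq[OF sets] by simp
    then show "emeasure \<mu> (space \<mu>) = 1" using tilt by (simp add: em leave_moment_def)
  qed
  show "emeasure \<mu> {r} = 0" for r
  proof -
    have "emeasure \<mu> {r} = (\<integral>\<^sup>+x. 0 \<partial>Q 0)"
      unfolding em[of "{r}", simplified]
    proof (rule nn_integral_cong_AE)
      show "AE x in Q 0. indicator (leave 1) x * ennreal (exp (\<phi> * W x)) * indicator {r} (W x) = 0"
        using AE_W atomless_return[of r] by eventually_elim (auto simp: indicator_def)
    qed
    then show ?thesis by simp
  qed
  show "AE v in \<mu>. 0 < v"
    unfolding \<mu>_def
  proof (subst AE_distr_iff)
    show "AE x in density (Q 0) (\<lambda>x. indicator (leave 1) x * ennreal (exp (\<phi> * W x))). 0 < W x"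
      by (subst AE_density) (use AE_W in \<open>auto elim!: AE_mp simp: indicator_def\<close>)
  qed auto
qed

lemma leave_moment_eq: "leave_moment \<theta> 1 = (\<integral>\<^sup>+v. ennreal (exp ((\<theta> - \<phi>) * v)) \<partial>\<mu>)"
  unfolding leave_moment_def
  by (subst nn_integral_\<mu>) (auto intro!: nn_integral_cong simp: mult.assoc ennreal_mult'[symmetric] exp_add[symmetric] algebra_simps)

lemma D_nonneg: "0 \<le> D" and mean_\<mu>: "(\<integral>\<^sup>+v. ennreal v \<partial>\<mu>) = ennreal D"
  using \<mu>.mean_eq_left_derivative[of \<phi> D] left_deriv unfolding leave_moment_eq by auto

text \<open>For \<open>\<phi> \<le> 0\<close> the moment would be at most the probability
  \<open>1 - exp (- q0)\<close> of leaving 0 within a unit of time, which is below 1.\<close>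

lemma \<phi>_pos: "0 < \<phi>"
proof (rule ccontr)
  assume "\<not> 0 < \<phi>"
  have "leave_moment \<phi> 1 \<le> (\<integral>\<^sup>+x. indicator (leave 1) x \<partial>Q 0)"
    unfolding leave_moment_def
  proof (rule nn_integral_mono_AE)
    show "AE x in Q 0. indicator (leave 1) x * ennreal (exp (\<phi> * W x)) \<le> indicator (leave 1) x"
      using AE_W
    proof eventually_elim
      case (elim x)
      then show ?case using \<open>\<not> 0 < \<phi>\<close> by (auto simp: indicator_def mult_nonpos_nonneg)
    qed
  qed
  also have "\<dots> = ennreal (1 - exp (- q0))"
    using leave_prob[of 1, folded leave_def] by (simp add: Q0.emeasure_eq_measure)
  finally have "1 \<le> ennreal (1 - exp (- q0))" using tilt by simp
  then show False by (simp add: ennreal_1[symmetric] ennreal_le_iff2 del: ennreal_1)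
qed

lemma survival_from_zero_start: "measure (Q 0) {x \<in> step_paths S. ereal t < kill_time 0 x} = s0 t"
  using unit_hold_iff_kill[OF step_pathsD]
  by (auto simp: s0_def not_le[symmetric] intro!: arg_cong[where f = "measure (Q 0)"])

text \<open>The start \<open>u = 0\<close> of \<open>survival_from_zero\<close>, multiplied by
  \<open>exp (\<phi> * t)\<close>: the weight \<open>exp (\<phi> * W x)\<close> is absorbed into
  \<mu>, and \<open>exp (\<phi> * (t - W x))\<close> completes \<open>s0\<close> to
  \<open>Z\<close>.\<close>

sublocale ren: survival_renewal \<mu> s0 \<phi> "exp (- q0)" D
proof
  show "0 < \<phi>" by (rule \<phi>_pos)
  show "0 \<le> D" by (rule D_nonneg)
  show "(\<integral>\<^sup>+v. ennreal v \<partial>\<mu>) = ennreal D" by (rule mean_\<mu>)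
  show "continuous (at_right x) s0" for x by (rule s0_rcont)
  show "0 \<le> s0 x" "s0 x \<le> 1" for x by (rule s0_nonneg, rule s0_le_1)
  show "s0 y \<le> s0 x" if "x \<le> y" for x y using that by (rule s0_antimono)
  fix t
  have "ennreal (exp (\<phi> * t) * s0 t) = ennreal (exp (\<phi> * t)) *
      (ennreal (if t < 1 then exp (- q0) else 0) + (\<integral>\<^sup>+x. indicator (leave 1) x * ennreal (s0 (t - W x)) \<partial>Q 0))"
    using survival_from_zero[OF atomless_return, of 0 t] by (simp add: ennreal_mult' survival_from_zero_start)
  also have "\<dots> = ennreal (exp (\<phi> * t)) * ennreal (if t < 1 then exp (- q0) else 0) +
      (\<integral>\<^sup>+x. ennreal (exp (\<phi> * t)) * (indicator (leave 1) x * ennreal (s0 (t - W x))) \<partial>Q 0)"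
    by (subst nn_integral_cmult) (simp_all add: distrib_left)
  also have "ennreal (exp (\<phi> * t)) * ennreal (if t < 1 then exp (- q0) else 0) =
      ennreal (if t < 1 then exp (- q0) * exp (\<phi> * t) else 0)"
    by (simp add: ennreal_mult' mult.commute)
  also have "(\<integral>\<^sup>+x. ennreal (exp (\<phi> * t)) * (indicator (leave 1) x * ennreal (s0 (t - W x))) \<partial>Q 0) =
      (\<integral>\<^sup>+v. ennreal (exp (\<phi> * (t - v)) * s0 (t - v)) \<partial>\<mu>)"
  proof (subst nn_integral_\<mu>, measurable, rule nn_integral_cong)
    fix x
    have "exp (\<phi> * t) = exp (\<phi> * W x) * exp (\<phi> * (t - W x))"
      by (simp add: exp_add[symmetric] algebra_simps)
    then show "ennreal (exp (\<phi> * t)) * (indicator (leave 1) x * ennreal (s0 (t - W x))) =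
        indicator (leave 1) x * ennreal (exp (\<phi> * W x)) * ennreal (exp (\<phi> * (t - W x)) * s0 (t - W x))"
      by (simp add: ennreal_mult' s0_nonneg mult_ac)
  qed
  finally show "ennreal (exp (\<phi> * t) * s0 t) = ennreal (if t < 1 then exp (- q0) * exp (\<phi> * t) else 0) +
      (\<integral>\<^sup>+v. ennreal (exp (\<phi> * (t - v)) * s0 (t - v)) \<partial>\<mu>)" .
qed simp

definition \<kappa> :: real where "\<kappa> = exp (\<phi> - q0) / (\<phi> * D)"

lemma \<kappa>_pos: "0 < \<kappa>"
  using \<phi>_pos ren.D_pos by (simp add: \<kappa>_def)

lemma s0_limit: "((\<lambda>t. exp (\<phi> * t) * s0 t) \<longlongrightarrow> \<kappa>) at_top"
  using ren.Z_tendsto by (simp add: ren.Z_def[abs_def] \<kappa>_def exp_diff exp_minus field_simps)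

text \<open>\<open>leave_moment_add\<close> at \<open>\<theta> = \<phi>\<close> is the cocycle
  identity with rate \<open>\<phi> - q0\<close>, and \<open>tilt\<close> normalises the value at
  1.\<close>

lemma leave_moment_ratio:
  assumes c: "0 \<le> c" "c \<le> 1"
  shows "leave_moment \<phi> c = ennreal (integral {0..c} (\<lambda>s. exp ((\<phi> - q0) * s)) / integral {0..1} (\<lambda>s. exp ((\<phi> - q0) * s)))"
proof -
  have mono: "leave_moment \<phi> x \<le> leave_moment \<phi> y" if "x \<le> y" for x y
    unfolding leave_moment_def using leave_mono[OF that]
    by (intro nn_integral_mono) (auto simp: indicator_def)
  have fin: "leave_moment \<phi> x < \<infinity>" if "x \<le> 1" for x
    using mono[OF that] tilt by (simp add: le_less_trans)
  define a where "a x = enn2real (leave_moment \<phi> x)" for x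
  have a: "leave_moment \<phi> x = ennreal (a x)" if "x \<le> 1" for x
    using fin[OF that] by (simp add: a_def ennreal_enn2real)
  have a0: "0 \<le> a x" for x by (simp add: a_def)
  have "a c = integral {0..c} (\<lambda>s. exp ((\<phi> - q0) * s)) / integral {0..1} (\<lambda>s. exp ((\<phi> - q0) * s))"
  proof (rule exponential_cocycle[OF _ _ _ c])
    fix x y :: real assume xy: "0 \<le> x" "0 \<le> y" "x + y \<le> 1"
    have "ennreal (a (x + y)) = ennreal (a x + exp ((\<phi> - q0) * x) * a y)"
      using leave_moment_add[OF xy(1,2), of \<phi>] xy a[of "x + y"] a[of x] a[of y] a0
      by (simp add: ennreal_mult'[symmetric] ennreal_plus[symmetric] del: ennreal_plus)
    then show "a (x + y) = a x + exp ((\<phi> - q0) * x) * a y"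
      using a0 by (subst (asm) ennreal_inj) auto
  next
    fix x y :: real assume xy: "0 \<le> x" "x \<le> y" "y \<le> 1"
    show "a x \<le> a y"
      unfolding a_def using mono[OF xy(2)] fin[OF xy(3)] by (intro enn2real_mono) auto
  qed (simp add: a_def tilt)
  then show ?thesis using a[OF c(2)] by simp
qed

theorem limit_from_zero:
  assumes u: "0 \<le> u" "u < 1"
  shows "((\<lambda>t. exp (\<phi> * t) * measure (Q 0) {x \<in> step_paths S. ereal t < kill_time u x}) \<longlongrightarrow>
    integral {0..1 - u} (\<lambda>s. exp ((\<phi> - q0) * s)) / integral {0..1} (\<lambda>s. exp ((\<phi> - q0) * s)) * \<kappa>) at_top"
proof -
  obtain B where B: "\<And>t. ren.Z t \<le> B" using ren.Z_bounded by blast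
  show ?thesis
  proof (rule exponential_limit[OF leave_Q W_Q0 s0_measurable s0_nonneg _ s0_limit])
    show "exp (\<phi> * t) * s0 t \<le> B" for t using B[of t] by (simp add: ren.Z_def)
    show "(\<integral>\<^sup>+x. indicator (leave (1 - u)) x * ennreal (exp (\<phi> * W x)) \<partial>Q 0) =
        ennreal (integral {0..1 - u} (\<lambda>s. exp ((\<phi> - q0) * s)) / integral {0..1} (\<lambda>s. exp ((\<phi> - q0) * s)))"
      using leave_moment_ratio[of "1 - u"] u by (simp add: leave_moment_def)
    show "0 \<le> integral {0..1 - u} (\<lambda>s. exp ((\<phi> - q0) * s)) / integral {0..1} (\<lambda>s. exp ((\<phi> - q0) * s))"
      by (intro divide_nonneg_nonneg Henstock_Kurzweil_Integration.integral_nonneg integrable_continuous_real continuous_intros) auto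
    show "ennreal (measure (Q 0) {x \<in> step_paths S. ereal t < kill_time u x}) =
        (\<integral>\<^sup>+x. indicator (leave (1 - u)) x * ennreal (s0 (t - W x)) \<partial>Q 0)" if "1 \<le> t" for t
      using survival_from_zero[OF atomless_return u, of t] that u by simp
  qed simp
qed

theorem limit_from_away:
  assumes i: "i \<in> S" "i \<noteq> 0" and atomless: "\<And>r. AE x in Q i. hit_time x \<noteq> ereal r"
  shows "(\<integral>\<^sup>+x. ennreal (exp (\<phi> * R x)) \<partial>Q i) < \<infinity>"
    and "((\<lambda>t. exp (\<phi> * t) * measure (Q i) {x \<in> step_paths S. ereal t < kill_time 0 x}) \<longlongrightarrow>
      enn2real (\<integral>\<^sup>+x. ennreal (exp (\<phi> * R x)) \<partial>Q i) * \<kappa>) at_top"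
    and "0 < enn2real (\<integral>\<^sup>+x. ennreal (exp (\<phi> * R x)) \<partial>Q i)"
proof -
  interpret I: prob_space "Q i" by (rule prob[OF i(1)])
  obtain B where B: "\<And>t. ren.Z t \<le> B" using ren.Z_bounded by blast
  show fin: "(\<integral>\<^sup>+x. ennreal (exp (\<phi> * R x)) \<partial>Q i) < \<infinity>"
    by (rule hit_moment_finite[OF i]) (simp add: tilt)
  have top: "step_paths S \<in> sets (Q i)" using sets.top[of "Q i"] by (simp add: space_Q[OF i(1)])
  have ind: "(\<integral>\<^sup>+x. indicator (step_paths S) x * f x \<partial>Q i) = (\<integral>\<^sup>+x. f x \<partial>Q i)" for f
    by (intro nn_integral_cong) (simp add: space_Q[OF i(1)])
  show "((\<lambda>t. exp (\<phi> * t) * measure (Q i) {x \<in> step_paths S. ereal t < kill_time 0 x}) \<longlongrightarrow>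
      enn2real (\<integral>\<^sup>+x. ennreal (exp (\<phi> * R x)) \<partial>Q i) * \<kappa>) at_top"
  proof (rule exponential_limit[OF top R_measurable[OF i(1)] s0_measurable s0_nonneg _ s0_limit])
    show "exp (\<phi> * t) * s0 t \<le> B" for t using B[of t] by (simp add: ren.Z_def)
    show "(\<integral>\<^sup>+x. indicator (step_paths S) x * ennreal (exp (\<phi> * R x)) \<partial>Q i) =
        ennreal (enn2real (\<integral>\<^sup>+x. ennreal (exp (\<phi> * R x)) \<partial>Q i))"
      unfolding ind using fin by (simp add: ennreal_enn2real)
    show "ennreal (measure (Q i) {x \<in> step_paths S. ereal t < kill_time 0 x}) =
        (\<integral>\<^sup>+x. indicator (step_paths S) x * ennreal (s0 (t - R x)) \<partial>Q i)" for t
      unfolding ind by (rule survival_from_away[OF i atomless])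
  qed simp_all
  have "ennreal 1 = (\<integral>\<^sup>+x. 1 \<partial>Q i)" using I.emeasure_space_1 by simp
  also have "\<dots> \<le> (\<integral>\<^sup>+x. ennreal (exp (\<phi> * R x)) \<partial>Q i)"
  proof (rule nn_integral_mono)
    fix x
    have "0 \<le> R x" using hit_time_nonneg[of x] by (simp add: R_def real_of_ereal_pos)
    then show "1 \<le> ennreal (exp (\<phi> * R x))" using \<phi>_pos by (simp add: one_le_exp_iff ennreal_1[symmetric] ennreal_le_iff del: ennreal_1)
  qed
  finally show "0 < enn2real (\<integral>\<^sup>+x. ennreal (exp (\<phi> * R x)) \<partial>Q i)"
    using fin by (auto simp: enn2real_positive_iff intro: less_le_trans[of 0 1])
qed

end

text \<open>A density on the event describes only sets of positive reals. By \<open>fin\<close> the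
  time almost surely takes such values on the event, so the description extends to an equality of
  measures on all Borel sets, and from there to integrals.\<close>

lemma density_nn_integral:
  fixes h :: "real \<Rightarrow> ennreal"
  assumes f: "density_on_event M T A f" and T: "T \<in> borel_measurable M"
    and A: "{\<omega> \<in> space M. A \<omega>} \<in> sets M"
    and fin: "AE \<omega> in M. A \<omega> \<longrightarrow> 0 < T \<omega> \<and> T \<omega> < \<infinity>"
    and h: "h \<in> borel_measurable borel"
  shows "(\<integral>\<^sup>+t. ennreal (f t) * indicator {0<..} t * h t \<partial>lborel) =
    (\<integral>\<^sup>+\<omega>. indicator {\<omega>. A \<omega>} \<omega> * h (real_of_ereal (T \<omega>)) \<partial>M)"
proof -
  define A' where "A' = {\<omega> \<in> space M. A \<omega>}"
  have [measurable]: "f \<in> borel_measurable borel" "T \<in> borel_measurable M" "A' \<in> sets M"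
    using f T A by (auto simp: density_on_event_def A'_def)
  have eq: "density lborel (\<lambda>t. ennreal (f t) * indicator {0<..} t) =
      distr (density M (indicator A')) borel (\<lambda>\<omega>. real_of_ereal (T \<omega>))"
  proof (rule measure_eqI)
    fix B assume "B \<in> sets (density lborel (\<lambda>t. ennreal (f t) * indicator {0<..} t))"
    then have [measurable]: "B \<in> sets borel" by simp
    have "emeasure (density lborel (\<lambda>t. ennreal (f t) * indicator {0<..} t)) B =
        (\<integral>\<^sup>+t\<in>B \<inter> {0<..}. ennreal (f t) \<partial>lborel)"
      by (subst emeasure_density) (auto intro!: nn_integral_cong simp: indicator_def)
    also have "\<dots> = emeasure M {\<omega> \<in> space M. T \<omega> \<in> ereal ` (B \<inter> {0<..}) \<and> A \<omega>}"
      using f by (simp add: density_on_event_def)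
    also have "\<dots> = emeasure M (A' \<inter> ((\<lambda>\<omega>. real_of_ereal (T \<omega>)) -` B \<inter> space M))"
    proof (rule emeasure_eq_AE)
      show "AE \<omega> in M. \<omega> \<in> {\<omega> \<in> space M. T \<omega> \<in> ereal ` (B \<inter> {0<..}) \<and> A \<omega>} \<longleftrightarrow>
          \<omega> \<in> A' \<inter> ((\<lambda>\<omega>. real_of_ereal (T \<omega>)) -` B \<inter> space M)"
        using fin
      proof eventually_elim
        case (elim \<omega>)
        then show ?case by (cases "T \<omega>") (auto simp: A'_def)
      qed
      have "T \<omega> \<in> ereal ` (B \<inter> {0<..}) \<longleftrightarrow> - \<infinity> < T \<omega> \<and> T \<omega> < \<infinity> \<and> real_of_ereal (T \<omega>) \<in> B \<inter> {0<..}" for \<omega>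
        by (cases "T \<omega>") auto
      then have "{\<omega> \<in> space M. T \<omega> \<in> ereal ` (B \<inter> {0<..}) \<and> A \<omega>} =
          A' \<inter> {\<omega> \<in> space M. - \<infinity> < T \<omega> \<and> T \<omega> < \<infinity> \<and> real_of_ereal (T \<omega>) \<in> B \<inter> {0<..}}"
        by (auto simp: A'_def)
      also have "\<dots> \<in> sets M" by measurable
      finally show "{\<omega> \<in> space M. T \<omega> \<in> ereal ` (B \<inter> {0<..}) \<and> A \<omega>} \<in> sets M" .
    qed measurable
    also have "\<dots> = emeasure (distr (density M (indicator A')) borel (\<lambda>\<omega>. real_of_ereal (T \<omega>))) B"
    proof -
      have pre: "(\<lambda>\<omega>. real_of_ereal (T \<omega>)) -` B \<inter> space M \<in> sets M" by measurable
      have "emeasure (distr (density M (indicator A')) borel (\<lambda>\<omega>. real_of_ereal (T \<omega>))) B =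
          emeasure (density M (indicator A')) ((\<lambda>\<omega>. real_of_ereal (T \<omega>)) -` B \<inter> space M)"
        by (subst emeasure_distr) auto
      also have "\<dots> = (\<integral>\<^sup>+\<omega>. indicator (A' \<inter> ((\<lambda>\<omega>. real_of_ereal (T \<omega>)) -` B \<inter> space M)) \<omega> \<partial>M)"
        unfolding indicator_inter_arith[of A'] using pre by (intro emeasure_density) auto
      also have "\<dots> = emeasure M (A' \<inter> ((\<lambda>\<omega>. real_of_ereal (T \<omega>)) -` B \<inter> space M))"
        using sets.Int[OF \<open>A' \<in> sets M\<close> pre] by (rule nn_integral_indicator)
      finally show ?thesis by simp
    qed
    finally show "emeasure (density lborel (\<lambda>t. ennreal (f t) * indicator {0<..} t)) B =
        emeasure (distr (density M (indicator A')) borel (\<lambda>\<omega>. real_of_ereal (T \<omega>))) B" .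
  qed simp
  have "(\<integral>\<^sup>+t. ennreal (f t) * indicator {0<..} t * h t \<partial>lborel) =
      (\<integral>\<^sup>+t. h t \<partial>density lborel (\<lambda>t. ennreal (f t) * indicator {0<..} t))"
    using h by (subst nn_integral_density) auto
  also have "\<dots> = (\<integral>\<^sup>+\<omega>. indicator A' \<omega> * h (real_of_ereal (T \<omega>)) \<partial>M)"
    unfolding eq using h by (subst nn_integral_distr) (auto intro!: nn_integral_density)
  also have "\<dots> = (\<integral>\<^sup>+\<omega>. indicator {\<omega>. A \<omega>} \<omega> * h (real_of_ereal (T \<omega>)) \<partial>M)"
    by (intro nn_integral_cong) (auto simp: A'_def indicator_def)
  finally show ?thesis .
qed

lemma exp_moment_eq:
  assumes "density_on_event M T A f" "T \<in> borel_measurable M" "{\<omega> \<in> space M. A \<omega>} \<in> sets M"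
    and "AE \<omega> in M. A \<omega> \<longrightarrow> 0 < T \<omega> \<and> T \<omega> < \<infinity>"
  shows "exp_moment f c = (\<integral>\<^sup>+\<omega>. ennreal (exp (c * real_of_ereal (T \<omega>))) * indicator {\<omega>. A \<omega>} \<omega> \<partial>M)"
proof -
  have "exp_moment f c = (\<integral>\<^sup>+t. ennreal (f t) * indicator {0<..} t * ennreal (exp (c * t)) \<partial>lborel)"
    unfolding exp_moment_def ennreal_mult'[OF exp_ge_zero] by (intro nn_integral_cong) (simp add: mult_ac)
  also have "\<dots> = (\<integral>\<^sup>+\<omega>. indicator {\<omega>. A \<omega>} \<omega> * ennreal (exp (c * real_of_ereal (T \<omega>))) \<partial>M)"
    using assms by (intro density_nn_integral) auto
  finally show ?thesis by (simp add: mult.commute)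
qed

lemma density_atomless:
  assumes f: "density_on_event M T A f" and T: "T \<in> borel_measurable M"
    and A: "{\<omega> \<in> space M. A \<omega>} \<in> sets M"
    and fin: "AE \<omega> in M. A \<omega> \<longrightarrow> 0 < T \<omega> \<and> T \<omega> < \<infinity>"
  shows "AE \<omega> in M. A \<omega> \<longrightarrow> T \<omega> \<noteq> ereal r"
proof (cases "0 < r")
  case True
  have [measurable]: "T \<in> borel_measurable M" by (rule T)
  have "{\<omega> \<in> space M. T \<omega> = ereal r \<and> A \<omega>} = (T -` {ereal r} \<inter> space M) \<inter> {\<omega> \<in> space M. A \<omega>}" by auto
  also have "\<dots> \<in> sets M" by (intro sets.Int[OF _ A] measurable_sets[OF T]) simp
  finally have s: "{\<omega> \<in> space M. T \<omega> = ereal r \<and> A \<omega>} \<in> sets M" .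
  have "(\<integral>\<^sup>+t\<in>B. ennreal (f t) \<partial>lborel) = emeasure M {\<omega> \<in> space M. T \<omega> \<in> ereal ` B \<and> A \<omega>}"
    if "B \<in> sets borel" "B \<subseteq> {0<..}" for B
    using f that unfolding density_on_event_def by blast
  from this[of "{r}", symmetric] True
  have "emeasure M {\<omega> \<in> space M. T \<omega> \<in> ereal ` {r} \<and> A \<omega>} = (\<integral>\<^sup>+t\<in>{r}. ennreal (f t) \<partial>lborel)"
    by simp
  also have "\<dots> = (\<integral>\<^sup>+t. 0 \<partial>(lborel :: real measure))"
  proof (rule nn_integral_cong_AE)
    show "AE t in lborel. ennreal (f t) * indicator {r} t = 0"
      using AE_lborel_singleton[of r] by eventually_elim simp
  qed
  finally have "emeasure M {\<omega> \<in> space M. T \<omega> = ereal r \<and> A \<omega>} = 0" by simp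
  then have "AE \<omega> in M. \<omega> \<notin> {\<omega> \<in> space M. T \<omega> = ereal r \<and> A \<omega>}"
    using s by (intro AE_not_in) (auto simp: null_sets_def)
  then show ?thesis using AE_space by eventually_elim auto
next
  case False
  show ?thesis using fin by eventually_elim (use False in auto)
qed

lemma integral_exp_linear_pos:
  fixes l c :: real
  assumes "0 < c"
  shows "0 < integral {0..c} (\<lambda>s. exp (l * s))"
proof (cases "l = 0")
  case False
  have "0 < (exp (l * c) - 1) / l"
  proof (cases "0 < l")
    case True
    then show ?thesis using assms by (intro divide_pos_pos) auto
  next
    case neg: False
    then have "l * c < 0" using assms False by (intro mult_neg_pos) auto
    then show ?thesis using neg False by (intro divide_neg_neg) auto
  qed
  then show ?thesis using assms False by (simp add: integral_exp_linear)
qed (use assms in simp)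

section \<open>Transfer from the given chain to its laws on path space\<close>

locale chain_laws =
  fixes S :: "nat set" and q :: "nat \<Rightarrow> nat \<Rightarrow> real" and P :: "nat \<Rightarrow> 'w measure" and X :: "real \<Rightarrow> 'w \<Rightarrow> nat"
  assumes state_space: "state_space S" and chain: "nonexplosive_chain S q P X"
    and irr: "irreducible_chain S P X" and rec: "recurrent_chain S P X"
begin

definition path :: "'w \<Rightarrow> real \<Rightarrow> nat" where
  "path \<omega> = (\<lambda>t. X t \<omega>)"

definition Q :: "nat \<Rightarrow> (real \<Rightarrow> nat) measure" where
  "Q i = distr (P i) (path_space S) path"

lemma prob_P: "i \<in> S \<Longrightarrow> prob_space (P i)"
  and X_measurable: "i \<in> S \<Longrightarrow> 0 \<le> t \<Longrightarrow> X t \<in> measurable (P i) (count_space UNIV)"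
  and path_step: "i \<in> S \<Longrightarrow> \<omega> \<in> space (P i) \<Longrightarrow> path \<omega> \<in> step_paths S"
  and X_0: "i \<in> S \<Longrightarrow> AE \<omega> in P i. X 0 \<omega> = i"
  and markov_P: "markov_property S P X"
  and q_deriv: "i \<in> S \<Longrightarrow> j \<in> S \<Longrightarrow> ((\<lambda>t. trans_prob P X t i j) has_real_derivative q i j) (at_right 0)"
  using chain by (auto simp: nonexplosive_chain_def step_paths_def path_def)

lemma path_measurable: "i \<in> S \<Longrightarrow> path \<in> measurable (P i) (path_space S)"
proof (rule measurable_paths_I)
  fix t :: real assume "i \<in> S" "t \<in> {0..}"
  then show "(\<lambda>\<omega>. path \<omega> t) \<in> measurable (P i) (count_space UNIV)"
    unfolding path_def using X_measurable[of i t] by simp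
qed (rule path_step)

lemma zero_in_S: "0 \<in> S"
  using state_space by (auto simp: state_space_def)

lemma measure_Q:
  assumes "i \<in> S" "{x \<in> step_paths S. B x} \<in> sets (path_space S)"
  shows "measure (Q i) {x \<in> step_paths S. B x} = measure (P i) {\<omega> \<in> space (P i). B (path \<omega>)}"
proof -
  have "path -` {x \<in> step_paths S. B x} \<inter> space (P i) = {\<omega> \<in> space (P i). B (path \<omega>)}"
    using path_step[OF assms(1)] by auto
  then show ?thesis unfolding Q_def using path_measurable[OF assms(1)] assms(2) by (simp add: measure_distr)
qed

lemma AE_Q:
  assumes "i \<in> S" "{x \<in> step_paths S. B x} \<in> sets (path_space S)"
  shows "(AE x in Q i. B x) \<longleftrightarrow> (AE \<omega> in P i. B (path \<omega>))"
  unfolding Q_def using path_measurable[OF assms(1)] assms(2) by (subst AE_distr_iff) auto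

lemma measure_cyl:
  assumes "i \<in> S" "finite L" "fst ` L \<subseteq> {0..}"
  shows "measure (Q i) (cyl S L) = measure (P i) {\<omega> \<in> space (P i). \<forall>p\<in>L. X (fst p) \<omega> = snd p}"
  unfolding cyl_def using assms cyl_in_paths[of L "{0..}" S]
  by (subst measure_Q) (auto simp: path_def cyl_def)

lemma trans_prob_cyl:
  assumes "i \<in> S" "0 \<le> t"
  shows "trans_prob P X t i j = measure (Q i) (cyl S {(t, j)})"
  using assms by (subst measure_cyl) (auto simp: trans_prob_def)

text \<open>Cylinders use a finite set of constraints, the given Markov property an ordered sequence
  of times. The times are sorted and the states read off from any path in the cylinder; if there is
  none, the constraints are contradictory and both sides are 0.\<close>

lemma markov_step:
  assumes i: "i \<in> S" and l: "l \<in> S" and L: "finite L" "fst ` L \<subseteq> {0..s}" "(s, j) \<in> L" and h: "0 \<le> h"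
  shows "measure (Q i) (cyl S (insert (s + h, l) L)) = measure (Q i) (cyl S L) * measure (Q j) (cyl S {(h, l)})"
proof (cases "cyl S L = {}")
  case True
  then have "cyl S (insert (s + h, l) L) = {}" by (auto simp: cyl_def)
  then show ?thesis using True by simp
next
  case False
  then obtain x where x: "x \<in> step_paths S" "\<And>p. p \<in> L \<Longrightarrow> x (fst p) = snd p" by (auto simp: cyl_def)
  define J where "J = fst ` L"
  have J: "finite J" "J \<noteq> {}" "s \<in> J" "J \<subseteq> {0..s}" using L by (force simp: J_def)+
  define ts where "ts = sorted_list_of_set J"
  have ts: "set ts = J" "sorted ts" using J by (auto simp: ts_def)
  define n where "n = length ts - 1"
  have len: "length ts = Suc n" using ts J by (cases ts) (auto simp: n_def)
  define t where "t k = ts ! k" for k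
  have tJ: "t k \<in> J" if "k \<le> n" for k using that ts len by (auto simp: t_def set_conv_nth)
  have Jt: "\<exists>k\<le>n. r = t k" if "r \<in> J" for r
    using that ts len by (auto simp: t_def set_conv_nth less_Suc_eq_le)
  have t_mono: "t k \<le> t m" if "k \<le> m" "m \<le> n" for k m
    unfolding t_def using ts(2) that len by (intro sorted_nth_mono) auto
  have tn: "t n = s"
  proof (rule antisym)
    show "t n \<le> s" using tJ[of n] J by auto
    obtain k where "k \<le> n" "s = t k" using Jt[OF J(3)] by blast
    then show "s \<le> t n" using t_mono[of k n] by simp
  qed
  have xj: "x s = j" using x(2)[OF L(3)] by simp
  have s0: "0 \<le> s" using J by auto
  have jS: "j \<in> S" using x(1) s0 xj by (auto simp: step_paths_def)
  have conds: "0 \<le> t 0 \<and> (\<forall>k<n. t k \<le> t (Suc k)) \<and> (\<forall>k\<le>n. x (t k) \<in> S)"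
  proof (intro conjI allI impI)
    show "0 \<le> t 0" using tJ[of 0] J by auto
    show "t k \<le> t (Suc k)" if "k < n" for k using that by (intro t_mono) auto
    show "x (t k) \<in> S" if "k \<le> n" for k using tJ[OF that] J x(1) by (auto simp: step_paths_def)
  qed
  have same: "(\<forall>k\<le>n. X (t k) \<omega> = x (t k)) \<longleftrightarrow> (\<forall>p\<in>L. X (fst p) \<omega> = snd p)" for \<omega>
  proof
    assume a: "\<forall>k\<le>n. X (t k) \<omega> = x (t k)"
    show "\<forall>p\<in>L. X (fst p) \<omega> = snd p"
    proof
      fix p assume p: "p \<in> L"
      then obtain k where "k \<le> n" "fst p = t k" using Jt[of "fst p"] by (auto simp: J_def)
      then show "X (fst p) \<omega> = snd p" using a x(2)[OF p] by simp
    qed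
  next
    assume a: "\<forall>p\<in>L. X (fst p) \<omega> = snd p"
    show "\<forall>k\<le>n. X (t k) \<omega> = x (t k)"
    proof (intro allI impI)
      fix k assume "k \<le> n"
      then obtain p where "p \<in> L" "t k = fst p" using tJ[of k] unfolding J_def by blast
      then show "X (t k) \<omega> = x (t k)" using a x(2) by simp
    qed
  qed
  have "measure (P i) {\<omega> \<in> space (P i). (\<forall>k\<le>n. X (t k) \<omega> = x (t k)) \<and> X (t n + h) \<omega> = l} =
      measure (P i) {\<omega> \<in> space (P i). \<forall>k\<le>n. X (t k) \<omega> = x (t k)} * trans_prob P X h (x (t n)) l"
    using markov_P[unfolded markov_property_def, THEN bspec, OF i, THEN spec[of _ n], THEN spec[of _ t],
        THEN spec[of _ "\<lambda>k. x (t k)"], THEN spec[of _ h], THEN mp, OF h, THEN bspec, OF l, THEN mp, OF conds] .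
  then have "measure (P i) {\<omega> \<in> space (P i). (\<forall>p\<in>L. X (fst p) \<omega> = snd p) \<and> X (s + h) \<omega> = l} =
      measure (P i) {\<omega> \<in> space (P i). \<forall>p\<in>L. X (fst p) \<omega> = snd p} * trans_prob P X h j l"
    unfolding same by (simp add: tn xj)
  moreover have "{\<omega> \<in> space (P i). \<forall>p\<in>insert (s + h, l) L. X (fst p) \<omega> = snd p} =
      {\<omega> \<in> space (P i). (\<forall>p\<in>L. X (fst p) \<omega> = snd p) \<and> X (s + h) \<omega> = l}" by auto
  ultimately show ?thesis
    using L s0 h i jS by (subst measure_cyl measure_cyl[of i L], auto)+ (auto simp: trans_prob_cyl)
qed

sublocale Q: killed_chain S Q "- q 0 0"
proof (intro killed_chain.intro path_chain.intro killed_chain_axioms.intro)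
  show "0 \<in> S" by (rule zero_in_S)
  show "prob_space (Q i)" if "i \<in> S" for i
    unfolding Q_def using prob_P[OF that] path_measurable[OF that] by (rule prob_space.prob_space_distr)
  show "sets (Q i) = sets (path_space S)" for i by (simp add: Q_def)
  show "AE x in Q i. x 0 = i" if "i \<in> S" for i
    using X_0[OF that] coord_event[of 0 "{0..}" S "\<lambda>j. j = i"] by (subst AE_Q[OF that]) (auto simp: path_def)
  show "measure (Q i) (cyl S (insert (s + h, l) L)) = measure (Q i) (cyl S L) * measure (Q j) (cyl S {(h, l)})"
    if "i \<in> S" "l \<in> S" "finite L" "fst ` L \<subseteq> {0..s}" "(s, j) \<in> L" "0 \<le> h" for i j l s h L
    using that by (rule markov_step)
  show "((\<lambda>t. measure (Q 0) (cyl S {(t, 0)})) has_real_derivative - (- q 0 0)) (at_right 0)"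
  proof -
    have "((\<lambda>t. trans_prob P X t 0 0) has_real_derivative q 0 0) (at_right 0)"
      by (intro q_deriv zero_in_S)
    then show ?thesis
      unfolding minus_minus has_field_derivative_iff
      by (rule Lim_transform_eventually)
         (use eventually_at_right_less[of "0::real"] in
           \<open>auto elim!: eventually_mono simp: trans_prob_cyl zero_in_S\<close>)
  qed
  show "\<exists>t\<ge>0. measure (Q 0) (cyl S {(t, i)}) > 0" if "i \<in> S" for i
    using irr that zero_in_S by (force simp: irreducible_chain_def trans_prob_cyl)
  show "AE x in Q 0. \<exists>s\<ge>t. x s = 0" if "0 \<le> t" for t
  proof (subst AE_Q[OF zero_in_S late_zero_event[OF that]])
    have "AE \<omega> in P 0. \<forall>t\<ge>0. \<exists>s\<ge>t. X s \<omega> = 0"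
      using rec zero_in_S by (simp add: recurrent_chain_def)
    then show "AE \<omega> in P 0. \<exists>s\<ge>t. path \<omega> s = 0"
      by eventually_elim (use that in \<open>simp add: path_def\<close>)
  qed
qed

lemma nn_integral_Q:
  assumes "i \<in> S" "f \<in> borel_measurable (path_space S)"
  shows "(\<integral>\<^sup>+x. f x \<partial>Q i) = (\<integral>\<^sup>+\<omega>. f (path \<omega>) \<partial>P i)"
  unfolding Q_def using path_measurable[OF assms(1)] assms(2) by (subst nn_integral_distr) auto

lemma survival_Q:
  assumes "i \<in> S" "0 \<le> u" "u < 1"
  shows "measure (P i) {\<omega> \<in> space (P i). ereal t < kill_time u (\<lambda>r. X r \<omega>)} =
    measure (Q i) {x \<in> step_paths S. ereal t < kill_time u x}"
  by (subst measure_Q[OF assms(1) Q.alive_measurable[OF assms(2,3)]]) (simp add: path_def)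

lemma return_P: "(\<lambda>\<omega>. return_time (\<lambda>t. X t \<omega>)) \<in> borel_measurable (P 0)"
  and hold_P: "{\<omega> \<in> space (P 0). hold_time (\<lambda>t. X t \<omega>) < 1} \<in> sets (P 0)"
  using measurable_compose[OF path_measurable[OF zero_in_S] return_time_measurable]
    measurable_compose[OF path_measurable[OF zero_in_S] hold_time_measurable]
  by (simp_all add: path_def)

lemma hit_P: "i \<in> S \<Longrightarrow> (\<lambda>\<omega>. hit_time (\<lambda>t. X t \<omega>)) \<in> borel_measurable (P i)"
  using measurable_compose[OF path_measurable hit_time_measurable] by (simp add: path_def)

lemma AE_hold_leave: "AE \<omega> in P 0. hold_time (path \<omega>) < 1 \<longleftrightarrow> path \<omega> \<in> Q.leave 1"
proof -
  have [measurable]: "{x \<in> step_paths S. hold_time x < ereal 1} \<in> sets (path_space S)"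
    "Q.leave 1 \<in> sets (path_space S)"
    by ((rule hold_time_event, force), rule Q.leave_path_space)
  have "{x \<in> step_paths S. hold_time x < ereal 1 \<longleftrightarrow> \<not> zero_on x 0 1} =
      {x \<in> space (path_space S). x \<in> {x \<in> step_paths S. hold_time x < ereal 1} \<longleftrightarrow> x \<in> Q.leave 1}"
    by (auto simp: Q.leave_def)
  also have "\<dots> \<in> sets (path_space S)"
    by measurable
  finally have "AE \<omega> in P 0. hold_time (path \<omega>) < ereal 1 \<longleftrightarrow> \<not> zero_on (path \<omega>) 0 1"
    using Q.AE_hold_time_less[of 1] AE_Q[OF zero_in_S] by simp
  then show ?thesis
    using AE_space
    by eventually_elim (use path_step[OF zero_in_S] in \<open>auto simp: Q.leave_def one_ereal_def\<close>)
qed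

lemma AE_return: "AE \<omega> in P 0. path \<omega> \<in> Q.leave 1 \<longrightarrow> 0 < return_time (path \<omega>) \<and> return_time (path \<omega>) < \<infinity>"
proof -
  have [measurable]: "Q.leave 1 \<in> sets (path_space S)" "return_time \<in> borel_measurable (path_space S)"
    by (rule Q.leave_path_space) (rule return_time_measurable)
  have "{x \<in> step_paths S. x \<in> Q.leave 1 \<longrightarrow> 0 < return_time x \<and> return_time x < \<infinity>} =
     {x \<in> space (path_space S). x \<in> Q.leave 1 \<longrightarrow> 0 < return_time x \<and> return_time x < \<infinity>}" by simp
  also have "\<dots> \<in> sets (path_space S)"
    by measurable
  finally have sets: "{x \<in> step_paths S. x \<in> Q.leave 1 \<longrightarrow> 0 < return_time x \<and> return_time x < \<infinity>} \<in> sets (path_space S)" .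
  have "AE x in Q 0. x \<in> Q.leave 1 \<longrightarrow> 0 < return_time x \<and> return_time x < \<infinity>"
    using Q.AE_return_finite[of 1, simplified] Q.AE_step_path[OF zero_in_S]
  proof eventually_elim
    case (elim x)
    then show ?case using Q.return_finiteD(1)[of x] by auto
  qed
  then show ?thesis by (subst (asm) AE_Q[OF zero_in_S sets])
qed

lemma AE_hit:
  assumes i: "i \<in> S" "i \<noteq> 0"
  shows "AE \<omega> in P i. 0 < hit_time (path \<omega>) \<and> hit_time (path \<omega>) < \<infinity>"
proof -
  have [measurable]: "hit_time \<in> borel_measurable (path_space S)" by (rule hit_time_measurable)
  have "{x \<in> step_paths S. 0 < hit_time x \<and> hit_time x < \<infinity>} =
     {x \<in> space (path_space S). 0 < hit_time x \<and> hit_time x < \<infinity>}" by simp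
  also have "\<dots> \<in> sets (path_space S)"
    by measurable
  finally have sets: "{x \<in> step_paths S. 0 < hit_time x \<and> hit_time x < \<infinity>} \<in> sets (path_space S)" .
  have "AE x in Q i. 0 < hit_time x \<and> hit_time x < \<infinity>"
    using Q.AE_hits[OF i(1)] Q.AE_step_path[OF i(1)] Q.start[OF i(1)]
  proof eventually_elim
    case (elim x)
    have "x (Q.R x) = 0" "0 \<le> Q.R x"
      using hit_time_attained[OF step_pathsD[OF elim(2)] elim(1)] by blast+
    then have "0 < Q.R x" using elim(3) i by (cases "Q.R x = 0") auto
    then show ?case unfolding elim(1) by simp
  qed
  then show ?thesis by (subst (asm) AE_Q[OF i(1) sets])
qed

end

text \<open>A real \<open>D\<close> as left derivative expresses its finiteness. The conversion
  \<open>enn2real\<close> loses nothing there: as \<open>W > 0\<close> almost surely on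
  \<open>H\<^sup>1 < 1\<close>, \<open>I\<close> is at most \<open>I \<phi> = 1\<close> to the left
  of \<phi>.\<close>

theorem theorem1p2:
  fixes S :: "nat set" and q :: "nat \<Rightarrow> nat \<Rightarrow> real"
    and P :: "nat \<Rightarrow> 'w measure" and X :: "real \<Rightarrow> 'w \<Rightarrow> nat"
    and g :: "real \<Rightarrow> real" and \<rho> :: "nat \<Rightarrow> real \<Rightarrow> real"
    and \<phi> D q\<^sub>0 \<kappa> :: real
    and I :: "real \<Rightarrow> ennreal" and F :: "nat \<Rightarrow> real \<Rightarrow> ennreal"
  defines "q\<^sub>0 \<equiv> - q 0 0"
    and "I \<equiv> exp_moment g"
    and "F \<equiv> \<lambda>i. exp_moment (\<rho> i)"
    and "\<kappa> \<equiv> exp (\<phi> - q\<^sub>0) / (\<phi> * D)"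
  assumes "state_space S"
    and "nonexplosive_chain S q P X"
    and "irreducible_chain S P X"
    and "recurrent_chain S P X"
    and g_density: "density_on_event (P 0) (\<lambda>\<omega>. return_time (\<lambda>t. X t \<omega>))
                      (\<lambda>\<omega>. hold_time (\<lambda>t. X t \<omega>) < 1) g"
    and rho_density: "\<And>i. i \<in> S - {0} \<Longrightarrow>
                      density_on_event (P i) (\<lambda>\<omega>. hit_time (\<lambda>t. X t \<omega>)) (\<lambda>\<omega>. True) (\<rho> i)"
    and "I \<phi> = 1"
    and left_derivative: "((\<lambda>x. enn2real (I x)) has_real_derivative D) (at_left \<phi>)"
  shows "(\<forall>x. I x = (\<integral>\<^sup>+\<omega>. ennreal (exp (x * real_of_ereal (return_time (\<lambda>t. X t \<omega>)))) *
                        indicator {\<omega>. hold_time (\<lambda>t. X t \<omega>) < 1} \<omega> \<partial>P 0)) \<and>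
         (\<forall>i\<in>S - {0}. \<forall>x. F i x =
            (\<integral>\<^sup>+\<omega>. ennreal (exp (x * real_of_ereal (hit_time (\<lambda>t. X t \<omega>)))) \<partial>P i)) \<and>
         (\<exists>p. (\<forall>i\<in>S_hat S. 0 < p i \<and> ((\<lambda>t. exp (\<phi> * t) * survival P X i t) \<longlongrightarrow> p i) at_top) \<and>
              p (AtZero 0) = \<kappa> \<and>
              (\<forall>u\<in>{0..<1}. p (AtZero u) =
                 integral {0..1 - u} (\<lambda>s. exp ((\<phi> - q\<^sub>0) * s)) /
                 integral {0..1} (\<lambda>s. exp ((\<phi> - q\<^sub>0) * s)) * \<kappa>) \<and>
              (\<forall>i\<in>S - {0}. F i \<phi> < \<infinity> \<and> p (Away i) = enn2real (F i \<phi>) * \<kappa>))"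
proof -
  interpret chain_laws S q P X
    by standard fact+
  note zero = zero_in_S
  have fin_g: "AE \<omega> in P 0. hold_time (\<lambda>t. X t \<omega>) < 1 \<longrightarrow>
      0 < return_time (\<lambda>t. X t \<omega>) \<and> return_time (\<lambda>t. X t \<omega>) < \<infinity>"
    using AE_hold_leave AE_return by eventually_elim (simp add: path_def)
  have I_eq: "I x = (\<integral>\<^sup>+\<omega>. ennreal (exp (x * real_of_ereal (return_time (\<lambda>t. X t \<omega>)))) *
      indicator {\<omega>. hold_time (\<lambda>t. X t \<omega>) < 1} \<omega> \<partial>P 0)" for x
    unfolding I_def by (rule exp_moment_eq[OF g_density return_P hold_P fin_g])
  have fin_rho: "AE \<omega> in P i. True \<longrightarrow> 0 < hit_time (\<lambda>t. X t \<omega>) \<and> hit_time (\<lambda>t. X t \<omega>) < \<infinity>"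
    if "i \<in> S - {0}" for i
    using AE_hit[of i] that by (simp add: path_def)
  have true_sets: "{\<omega> \<in> space (P i). True} \<in> sets (P i)" for i by simp
  have F_eq: "F i x = (\<integral>\<^sup>+\<omega>. ennreal (exp (x * real_of_ereal (hit_time (\<lambda>t. X t \<omega>)))) \<partial>P i)"
    if "i \<in> S - {0}" for i x
    using exp_moment_eq[OF rho_density[OF that] hit_P true_sets fin_rho[OF that]] that
    by (simp add: F_def)
  \<comment> \<open>The given \<open>I\<close> uses \<open>hold_time < 1\<close>, the path-space
    moment uses \<open>leave 1\<close>. They agree because a departure exactly at time 1 has
    probability 0.\<close>
  have I_mom: "I x = Q.leave_moment x 1" for x
  proof -
    have "(\<lambda>p. indicator (Q.leave 1) p * ennreal (exp (x * Q.W p))) \<in> borel_measurable (path_space S)"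
      unfolding Q.W_def using Q.leave_path_space[of 1] return_time_measurable[of S] by measurable
    then have "Q.leave_moment x 1 = (\<integral>\<^sup>+\<omega>. indicator (Q.leave 1) (path \<omega>) * ennreal (exp (x * Q.W (path \<omega>))) \<partial>P 0)"
      unfolding Q.leave_moment_def by (intro nn_integral_Q zero)
    also have "\<dots> = I x"
      unfolding I_eq
    proof (rule nn_integral_cong_AE)
      show "AE \<omega> in P 0. indicator (Q.leave 1) (path \<omega>) * ennreal (exp (x * Q.W (path \<omega>))) =
          ennreal (exp (x * real_of_ereal (return_time (\<lambda>t. X t \<omega>)))) *
          indicator {\<omega>. hold_time (\<lambda>t. X t \<omega>) < 1} \<omega>"
        using AE_hold_leave by eventually_elim (auto simp: Q.W_def path_def indicator_def)
    qed
    finally show ?thesis by simp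
  qed
  have F_R: "F i x = (\<integral>\<^sup>+p. ennreal (exp (x * Q.R p)) \<partial>Q i)" if "i \<in> S - {0}" for i x
  proof -
    have "(\<lambda>p. ennreal (exp (x * Q.R p))) \<in> borel_measurable (path_space S)" by measurable
    then show ?thesis
      unfolding F_eq[OF that] using that by (subst nn_integral_Q) (auto simp: Q.R_def path_def)
  qed
  \<comment> \<open>What the renewal argument and the strong Markov property take from the density
    \<open>g\<close> is that the return time has no atoms on \<open>leave 1\<close>.\<close>
  have atomless_return: "AE p in Q 0. p \<in> Q.leave 1 \<longrightarrow> return_time p \<noteq> ereal r" for r
  proof -
    have [measurable]: "Q.leave 1 \<in> sets (path_space S)" by (rule Q.leave_path_space)
    have "return_time -` {ereal r} \<inter> space (path_space S) \<in> sets (path_space S)"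
      by (rule measurable_sets[OF return_time_measurable]) simp
    then have "space (path_space S) - Q.leave 1 \<inter> (return_time -` {ereal r} \<inter> space (path_space S)) \<in> sets (path_space S)"
      by measurable
    moreover have "space (path_space S) - Q.leave 1 \<inter> (return_time -` {ereal r} \<inter> space (path_space S)) =
        {p \<in> step_paths S. p \<in> Q.leave 1 \<longrightarrow> return_time p \<noteq> ereal r}" by auto
    ultimately have sets: "{p \<in> step_paths S. p \<in> Q.leave 1 \<longrightarrow> return_time p \<noteq> ereal r} \<in> sets (path_space S)"
      by (simp only:)
    have "AE \<omega> in P 0. path \<omega> \<in> Q.leave 1 \<longrightarrow> return_time (path \<omega>) \<noteq> ereal r"
      using density_atomless[OF g_density return_P hold_P fin_g, of r] AE_hold_leave
      by eventually_elim (simp add: path_def)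
    then show ?thesis by (subst AE_Q[OF zero sets])
  qed
  have atomless_hit: "AE p in Q i. hit_time p \<noteq> ereal r" if "i \<in> S - {0}" for i r
  proof -
    have "hit_time -` {ereal r} \<inter> space (path_space S) \<in> sets (path_space S)"
      by (rule measurable_sets[OF hit_time_measurable]) simp
    then have "space (path_space S) - (hit_time -` {ereal r} \<inter> space (path_space S)) \<in> sets (path_space S)"
      by (rule sets.compl_sets)
    moreover have "space (path_space S) - (hit_time -` {ereal r} \<inter> space (path_space S)) =
        {p \<in> step_paths S. hit_time p \<noteq> ereal r}" by auto
    ultimately have sets: "{p \<in> step_paths S. hit_time p \<noteq> ereal r} \<in> sets (path_space S)"
      by (simp only:)
    have "AE \<omega> in P i. hit_time (path \<omega>) \<noteq> ereal r"
      using density_atomless[OF rho_density[OF that] hit_P true_sets fin_rho[OF that], of r] that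
      by (simp add: path_def)
    then show ?thesis using that by (subst AE_Q[OF _ sets]) auto
  qed
  interpret T: tilted_chain S Q "- q 0 0" \<phi> D
  proof
    show "AE p in Q 0. p \<in> Q.leave 1 \<longrightarrow> return_time p \<noteq> ereal r" for r by (rule atomless_return)
    show "Q.leave_moment \<phi> 1 = 1" using \<open>I \<phi> = 1\<close> by (simp add: I_mom)
    show "((\<lambda>x. enn2real (Q.leave_moment x 1)) has_real_derivative D) (at_left \<phi>)"
      using left_derivative by (simp add: I_mom)
  qed
  have \<kappa>: "T.\<kappa> = \<kappa>" by (simp add: T.\<kappa>_def \<kappa>_def q\<^sub>0_def)
  have \<kappa>_pos: "0 < \<kappa>" using T.\<kappa>_pos \<kappa> by simp
  define J where "J c = integral {0..c} (\<lambda>s. exp ((\<phi> - q\<^sub>0) * s))" for c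
  have J_pos: "0 < J c" if "0 < c" for c
    unfolding J_def using that by (rule integral_exp_linear_pos)
  define p where "p h = (case h of Away i \<Rightarrow> enn2real (F i \<phi>) * \<kappa> | AtZero u \<Rightarrow> J (1 - u) / J 1 * \<kappa>)" for h
  have zero_lim: "((\<lambda>t. exp (\<phi> * t) * survival P X (AtZero u) t) \<longlongrightarrow> p (AtZero u)) at_top"
    if "0 \<le> u" "u < 1" for u
    using T.limit_from_zero[OF that]
    by (simp add: survival_Q[OF zero that] p_def J_def q\<^sub>0_def \<kappa>)
  have away: "F i \<phi> < \<infinity> \<and> 0 < p (Away i) \<and>
      ((\<lambda>t. exp (\<phi> * t) * survival P X (Away i) t) \<longlongrightarrow> p (Away i)) at_top"
    if i: "i \<in> S - {0}" for i
    using T.limit_from_away[of i] atomless_hit[OF i] i \<kappa>_pos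
    by (simp add: survival_Q p_def F_R[OF i] \<kappa>)
  have main: "0 < p h \<and> ((\<lambda>t. exp (\<phi> * t) * survival P X h t) \<longlongrightarrow> p h) at_top" if "h \<in> S_hat S" for h
  proof (cases h)
    case (Away i)
    then show ?thesis using that away[of i] by (auto simp: S_hat_def)
  next
    case (AtZero u)
    then have u: "0 \<le> u" "u < 1" using that by (auto simp: S_hat_def)
    then have "0 < p (AtZero u)" using J_pos[of 1] J_pos[of "1 - u"] \<kappa>_pos by (simp add: p_def)
    then show ?thesis using zero_lim[OF u] AtZero by simp
  qed
  have "p (AtZero 0) = \<kappa>" using J_pos[of 1] by (simp add: p_def)
  moreover have "\<forall>u\<in>{0..<1}. p (AtZero u) = integral {0..1 - u} (\<lambda>s. exp ((\<phi> - q\<^sub>0) * s)) /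
      integral {0..1} (\<lambda>s. exp ((\<phi> - q\<^sub>0) * s)) * \<kappa>"
    by (simp add: p_def J_def)
  moreover have "\<forall>i\<in>S - {0}. F i \<phi> < \<infinity> \<and> p (Away i) = enn2real (F i \<phi>) * \<kappa>"
  proof
    fix i assume "i \<in> S - {0}"
    with away show "F i \<phi> < \<infinity> \<and> p (Away i) = enn2real (F i \<phi>) * \<kappa>" by (simp add: p_def)
  qed
  moreover have "\<forall>h\<in>S_hat S. 0 < p h \<and> ((\<lambda>t. exp (\<phi> * t) * survival P X h t) \<longlongrightarrow> p h) at_top"
    using main by (rule ballI)
  moreover have "\<forall>x. I x = (\<integral>\<^sup>+\<omega>. ennreal (exp (x * real_of_ereal (return_time (\<lambda>t. X t \<omega>)))) *
      indicator {\<omega>. hold_time (\<lambda>t. X t \<omega>) < 1} \<omega> \<partial>P 0)"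
    using I_eq by (rule allI)
  moreover have "\<forall>i\<in>S - {0}. \<forall>x. F i x = (\<integral>\<^sup>+\<omega>. ennreal (exp (x * real_of_ereal (hit_time (\<lambda>t. X t \<omega>)))) \<partial>P i)"
    using F_eq by (intro ballI allI)
  ultimately show ?thesis
    by (intro conjI exI[of _ p])
qed

end
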